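(* Let $S=\mathbb{C}[x_1,x_2,x_3,x_4]$. For positive integers $a<b$, set $p_a=x_1^a+x_2^a+x_3^a+x_4^a$ and $p_b=x_1^b+x_2^b+x_3^b+x_4^b$. If $a=1$, then $S/(p_a,p_b)$ is a normal domain if and only if $b$ is even. If $1<a<b$, then $S/(p_a,p_b)$ is a normal domain if and only if both of the following hold: (1) $\nu_2(a)\neq\nu_2(b)$, and (2) either $\nu_3(a)\neq\nu_3(b)$, or $\nu_3(a)=\nu_3(b)=\nu_3(a-b)$.
   Context: For a prime integer $p$, $\nu_p$ denotes the $p$-adic valuation on $\mathbb{Z}\smallsetminus\{0\}$, i.e., $\nu_p(n)$ is the largest integer $e$ such that $p^e$ divides $n$. *)

theory Defs
  imports
    "HOL-Library.Poly_Mapping"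
    "HOL-Library.Numeral_Type"
    "HOL-Algebra.Algebraic_Closure_Type"
begin

section \<open>The polynomial ring in four variables\<close>

text \<open>Exponent vectors are finitely supported functions from the four-element type \<open>4\<close>
  to \<open>nat\<close>, and a polynomial is a finitely supported function from exponent vectors to
  coefficients. The product on \<^typ>\<open>(4 \<Rightarrow>\<^sub>0 nat) \<Rightarrow>\<^sub>0 complex\<close> is the convolution product.\<close>

type_synonym poly4 = "(4 \<Rightarrow>\<^sub>0 nat) \<Rightarrow>\<^sub>0 complex"

abbreviation S4 :: "poly4 ring"
  where "S4 \<equiv> ring_of_type_algebra"

definition var :: "4 \<Rightarrow> poly4"
  where "var i = Poly_Mapping.single (Poly_Mapping.single i 1) 1"

definition power_sum :: "nat \<Rightarrow> poly4"
  where "power_sum k = (\<Sum>i\<in>UNIV. var i ^ k)"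


section \<open>The field of fractions of a domain\<close>

text \<open>As usual, \<open>(a, b) \<sim> (c, d)\<close> iff \<open>ad = cb\<close>.\<close>

definition frac_pairs :: "('a, 'm) ring_scheme \<Rightarrow> ('a \<times> 'a) set"
  where "frac_pairs R = carrier R \<times> (carrier R - {\<zero>\<^bsub>R\<^esub>})"

definition frac_rel :: "('a, 'm) ring_scheme \<Rightarrow> (('a \<times> 'a) \<times> ('a \<times> 'a)) set"
  where "frac_rel R = {(x, y). x \<in> frac_pairs R \<and> y \<in> frac_pairs R \<and>
           fst x \<otimes>\<^bsub>R\<^esub> snd y = fst y \<otimes>\<^bsub>R\<^esub> snd x}"

definition frac_class :: "('a, 'm) ring_scheme \<Rightarrow> 'a \<Rightarrow> 'a \<Rightarrow> ('a \<times> 'a) set"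
  where "frac_class R a b = frac_rel R `` {(a, b)}"

definition frac_field :: "('a, 'm) ring_scheme \<Rightarrow> ('a \<times> 'a) set ring"
  where "frac_field R = \<lparr>
    carrier = frac_pairs R // frac_rel R,
    monoid.mult = (\<lambda>U V. \<Union>(a, b)\<in>U. \<Union>(c, d)\<in>V. frac_class R (a \<otimes>\<^bsub>R\<^esub> c) (b \<otimes>\<^bsub>R\<^esub> d)),
    one = frac_class R \<one>\<^bsub>R\<^esub> \<one>\<^bsub>R\<^esub>,
    ring.zero = frac_class R \<zero>\<^bsub>R\<^esub> \<one>\<^bsub>R\<^esub>,
    add = (\<lambda>U V. \<Union>(a, b)\<in>U. \<Union>(c, d)\<in>V.
      frac_class R ((a \<otimes>\<^bsub>R\<^esub> d) \<oplus>\<^bsub>R\<^esub> (c \<otimes>\<^bsub>R\<^esub> b)) (b \<otimes>\<^bsub>R\<^esub> d))\<rparr>"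

definition frac_embed :: "('a, 'm) ring_scheme \<Rightarrow> 'a \<Rightarrow> ('a \<times> 'a) set"
  where "frac_embed R a = frac_class R a \<one>\<^bsub>R\<^esub>"

context domain
begin

lemma frac_pairs_iff: "(a, b) \<in> frac_pairs R \<longleftrightarrow> a \<in> carrier R \<and> b \<in> carrier R \<and> b \<noteq> \<zero>"
  by (auto simp: frac_pairs_def)

lemma frac_rel_iff:
  "((a, b), (c, d)) \<in> frac_rel R \<longleftrightarrow>
     (a, b) \<in> frac_pairs R \<and> (c, d) \<in> frac_pairs R \<and> a \<otimes> d = c \<otimes> b"
  by (auto simp: frac_rel_def)

lemma equiv_frac_rel: "equiv (frac_pairs R) (frac_rel R)"
proof (rule equivI)
  show "frac_rel R \<subseteq> frac_pairs R \<times> frac_pairs R"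
    by (auto simp: frac_rel_def)
  show "refl_on (frac_pairs R) (frac_rel R)"
    by (auto simp: refl_on_def frac_rel_def)
  show "sym (frac_rel R)"
    by (auto simp: sym_def frac_rel_def)
  show "trans (frac_rel R)"
  proof (rule transI, clarify)
    fix a b c d e f
    assume 1: "((a, b), (c, d)) \<in> frac_rel R" and 2: "((c, d), (e, f)) \<in> frac_rel R"
    then have cl: "a \<in> carrier R" "b \<in> carrier R" "c \<in> carrier R" "d \<in> carrier R" "d \<noteq> \<zero>"
      "e \<in> carrier R" "f \<in> carrier R" and eq: "a \<otimes> d = c \<otimes> b" "c \<otimes> f = e \<otimes> d"
      by (auto simp: frac_rel_iff frac_pairs_iff)
    have "d \<otimes> (a \<otimes> f) = (a \<otimes> d) \<otimes> f"
      using cl by (simp add: m_ac)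
    also have "\<dots> = (c \<otimes> f) \<otimes> b"
      using cl by (simp add: eq(1) m_ac)
    also have "\<dots> = d \<otimes> (e \<otimes> b)"
      using cl by (simp add: eq(2) m_ac)
    finally have "a \<otimes> f = e \<otimes> b"
      using cl m_lcancel[of d "a \<otimes> f" "e \<otimes> b"] by auto
    then show "((a, b), (e, f)) \<in> frac_rel R"
      using 1 2 by (simp add: frac_rel_iff)
  qed
qed

lemma frac_eq_iff:
  assumes "(a, b) \<in> frac_pairs R" "(c, d) \<in> frac_pairs R"
  shows "frac_class R a b = frac_class R c d \<longleftrightarrow> a \<otimes> d = c \<otimes> b"
  unfolding frac_class_def
  using eq_equiv_class_iff[OF equiv_frac_rel assms] assms by (simp add: frac_rel_iff)

lemma frac_in_carrier: "(a, b) \<in> frac_pairs R \<Longrightarrow> frac_class R a b \<in> carrier (frac_field R)"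
  by (simp add: frac_field_def frac_class_def quotientI)

lemma frac_carrierE:
  assumes "U \<in> carrier (frac_field R)"
  obtains a b where "U = frac_class R a b" "(a, b) \<in> frac_pairs R"
  using assms by (auto simp: frac_field_def frac_class_def elim!: quotientE)

lemma frac_pairs_prod:
  "(a, b) \<in> frac_pairs R \<Longrightarrow> (c, d) \<in> frac_pairs R \<Longrightarrow> (a \<otimes> c, b \<otimes> d) \<in> frac_pairs R"
  by (auto simp: frac_pairs_iff integral_iff)

lemma frac_pairs_sum:
  "(a, b) \<in> frac_pairs R \<Longrightarrow> (c, d) \<in> frac_pairs R \<Longrightarrow>
   (a \<otimes> d \<oplus> c \<otimes> b, b \<otimes> d) \<in> frac_pairs R"
  by (auto simp: frac_pairs_iff integral_iff)

lemma frac_mult: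
  assumes "(a, b) \<in> frac_pairs R" "(c, d) \<in> frac_pairs R"
  shows "frac_class R a b \<otimes>\<^bsub>frac_field R\<^esub> frac_class R c d = frac_class R (a \<otimes> c) (b \<otimes> d)"
proof -
  let ?f = "\<lambda>x y. frac_class R (fst x \<otimes> fst y) (snd x \<otimes> snd y)"
  have "congruent2 (frac_rel R) (frac_rel R) ?f"
  proof (rule congruent2_commuteI[OF equiv_frac_rel])
    fix x y assume "x \<in> frac_pairs R" "y \<in> frac_pairs R"
    then show "?f x y = ?f y x"
      by (cases x; cases y) (simp add: frac_pairs_iff m_comm)
  next
    fix x y z assume z: "z \<in> frac_pairs R" and "(x, y) \<in> frac_rel R"
    then show "?f z x = ?f z y"
    proof (cases x; cases y; cases z; clarify)
      fix a b c d e f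
      assume yx: "((a, b), (c, d)) \<in> frac_rel R" and z: "(e, f) \<in> frac_pairs R"
      then have p: "(a, b) \<in> frac_pairs R" "(c, d) \<in> frac_pairs R" and eq: "a \<otimes> d = c \<otimes> b"
        by (auto simp: frac_rel_iff)
      have cl: "a \<in> carrier R" "b \<in> carrier R" "c \<in> carrier R" "d \<in> carrier R"
        "e \<in> carrier R" "f \<in> carrier R"
        using p z by (auto simp: frac_pairs_iff)
      have "(e \<otimes> a) \<otimes> (f \<otimes> d) = (e \<otimes> f) \<otimes> (a \<otimes> d)"
        using cl by (simp add: m_ac)
      also have "\<dots> = (e \<otimes> c) \<otimes> (f \<otimes> b)"
        unfolding eq using cl by (simp add: m_ac)
      finally have "frac_class R (e \<otimes> a) (f \<otimes> b) = frac_class R (e \<otimes> c) (f \<otimes> d)"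
        using frac_eq_iff[OF frac_pairs_prod[OF z p(1)] frac_pairs_prod[OF z p(2)]] by simp
      then show "?f (e, f) (a, b) = ?f (e, f) (c, d)"
        by simp
    qed
  qed
  from UN_equiv_class2[OF equiv_frac_rel equiv_frac_rel this assms] show ?thesis
    by (simp add: frac_field_def frac_class_def case_prod_unfold)
qed

lemma frac_add:
  assumes "(a, b) \<in> frac_pairs R" "(c, d) \<in> frac_pairs R"
  shows "frac_class R a b \<oplus>\<^bsub>frac_field R\<^esub> frac_class R c d = frac_class R (a \<otimes> d \<oplus> c \<otimes> b) (b \<otimes> d)"
proof -
  let ?f = "\<lambda>x y. frac_class R (fst x \<otimes> snd y \<oplus> fst y \<otimes> snd x) (snd x \<otimes> snd y)"
  have "congruent2 (frac_rel R) (frac_rel R) ?f"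
  proof (rule congruent2_commuteI[OF equiv_frac_rel])
    fix x y assume "x \<in> frac_pairs R" "y \<in> frac_pairs R"
    then show "?f x y = ?f y x"
      by (cases x; cases y) (simp add: frac_pairs_iff m_comm a_comm)
  next
    fix x y z assume z: "z \<in> frac_pairs R" and "(x, y) \<in> frac_rel R"
    then show "?f z x = ?f z y"
    proof (cases x; cases y; cases z; clarify)
      fix a b c d e f
      assume yx: "((a, b), (c, d)) \<in> frac_rel R" and z: "(e, f) \<in> frac_pairs R"
      then have p: "(a, b) \<in> frac_pairs R" "(c, d) \<in> frac_pairs R" and eq: "a \<otimes> d = c \<otimes> b"
        by (auto simp: frac_rel_iff)
      have cl: "a \<in> carrier R" "b \<in> carrier R" "c \<in> carrier R" "d \<in> carrier R"
        "e \<in> carrier R" "f \<in> carrier R"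
        using p z by (auto simp: frac_pairs_iff)
      have "(e \<otimes> b \<oplus> a \<otimes> f) \<otimes> (f \<otimes> d) = e \<otimes> b \<otimes> f \<otimes> d \<oplus> (f \<otimes> f) \<otimes> (a \<otimes> d)"
        using cl by (simp add: l_distr r_distr m_ac)
      also have "\<dots> = (e \<otimes> d \<oplus> c \<otimes> f) \<otimes> (f \<otimes> b)"
        unfolding eq using cl by (simp add: l_distr r_distr m_ac)
      finally have "frac_class R (e \<otimes> b \<oplus> a \<otimes> f) (f \<otimes> b) = frac_class R (e \<otimes> d \<oplus> c \<otimes> f) (f \<otimes> d)"
        using frac_eq_iff[OF frac_pairs_sum[OF z p(1)] frac_pairs_sum[OF z p(2)]] by simp
      then show "?f (e, f) (a, b) = ?f (e, f) (c, d)"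
        by simp
    qed
  qed
  from UN_equiv_class2[OF equiv_frac_rel equiv_frac_rel this assms] show ?thesis
    by (simp add: frac_field_def frac_class_def case_prod_unfold)
qed

lemma frac_one: "\<one>\<^bsub>frac_field R\<^esub> = frac_class R \<one> \<one>"
  by (simp add: frac_field_def)

lemma frac_zero: "\<zero>\<^bsub>frac_field R\<^esub> = frac_class R \<zero> \<one>"
  by (simp add: frac_field_def)

lemma field_frac_field: "field (frac_field R)"
proof -
  have one: "(\<one>, \<one>) \<in> frac_pairs R" and zero: "(\<zero>, \<one>) \<in> frac_pairs R"
    by (auto simp: frac_pairs_iff)
  have neg: "\<exists>V\<in>carrier (frac_field R). V \<oplus>\<^bsub>frac_field R\<^esub> U = \<zero>\<^bsub>frac_field R\<^esub>"
    if "U \<in> carrier (frac_field R)" for U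
    using that
  proof (rule frac_carrierE)
    fix a b assume U: "U = frac_class R a b" and p: "(a, b) \<in> frac_pairs R"
    have cl: "a \<in> carrier R" "b \<in> carrier R" using p by (auto simp: frac_pairs_iff)
    have n: "(\<ominus> a, b) \<in> frac_pairs R" using p by (auto simp: frac_pairs_iff)
    have "frac_class R (\<ominus> a \<otimes> b \<oplus> a \<otimes> b) (b \<otimes> b) = frac_class R \<zero> \<one>"
      unfolding frac_eq_iff[OF frac_pairs_sum[OF n p] zero] using cl by (simp add: l_minus l_neg)
    then show ?thesis
      using frac_add[OF n p] U frac_in_carrier[OF n] by (auto simp: frac_zero)
  qed
  have inv: "\<exists>V\<in>carrier (frac_field R). V \<otimes>\<^bsub>frac_field R\<^esub> U = \<one>\<^bsub>frac_field R\<^esub>"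
    if "U \<in> carrier (frac_field R)" "U \<noteq> \<zero>\<^bsub>frac_field R\<^esub>" for U
    using that(1)
  proof (rule frac_carrierE)
    fix a b assume U: "U = frac_class R a b" and p: "(a, b) \<in> frac_pairs R"
    have cl: "a \<in> carrier R" "b \<in> carrier R" using p by (auto simp: frac_pairs_iff)
    have "a \<noteq> \<zero>"
      using that(2) frac_eq_iff[OF p zero] cl by (auto simp: U frac_zero)
    then have n: "(b, a) \<in> frac_pairs R" using cl by (auto simp: frac_pairs_iff)
    have "frac_class R (b \<otimes> a) (a \<otimes> b) = frac_class R \<one> \<one>"
      unfolding frac_eq_iff[OF frac_pairs_prod[OF n p] one] using cl by (simp add: m_comm)
    then show ?thesis
      using frac_mult[OF n p] U frac_in_carrier[OF n] by (auto simp: frac_one)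
  qed
  have "cring (frac_field R)"
  proof (intro cringI abelian_groupI comm_monoidI neg)
    show "\<one>\<^bsub>frac_field R\<^esub> \<in> carrier (frac_field R)" "\<zero>\<^bsub>frac_field R\<^esub> \<in> carrier (frac_field R)"
      by (simp_all add: frac_one frac_zero frac_in_carrier one zero)
  next
    fix U assume "U \<in> carrier (frac_field R)"
    then show "\<one>\<^bsub>frac_field R\<^esub> \<otimes>\<^bsub>frac_field R\<^esub> U = U"
      "\<zero>\<^bsub>frac_field R\<^esub> \<oplus>\<^bsub>frac_field R\<^esub> U = U"
      by (auto elim!: frac_carrierE simp: frac_one frac_zero frac_mult frac_add one zero frac_pairs_iff)
  next
    fix U V assume "U \<in> carrier (frac_field R)" "V \<in> carrier (frac_field R)"
    then obtain a b c d where [simp]: "U = frac_class R a b" "V = frac_class R c d"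
      and p: "(a, b) \<in> frac_pairs R" "(c, d) \<in> frac_pairs R"
      by (meson frac_carrierE)
    have cl: "a \<in> carrier R" "b \<in> carrier R" "c \<in> carrier R" "d \<in> carrier R"
      using p by (auto simp: frac_pairs_iff)
    show "U \<otimes>\<^bsub>frac_field R\<^esub> V \<in> carrier (frac_field R)"
      "U \<oplus>\<^bsub>frac_field R\<^esub> V \<in> carrier (frac_field R)"
      using frac_pairs_prod[OF p] frac_pairs_sum[OF p]
      by (simp_all add: frac_mult frac_add p frac_in_carrier)
    show "U \<otimes>\<^bsub>frac_field R\<^esub> V = V \<otimes>\<^bsub>frac_field R\<^esub> U"
      "U \<oplus>\<^bsub>frac_field R\<^esub> V = V \<oplus>\<^bsub>frac_field R\<^esub> U"
      using cl by (simp_all add: frac_mult frac_add p m_comm a_comm)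
  next
    fix U V W
    assume "U \<in> carrier (frac_field R)" "V \<in> carrier (frac_field R)" "W \<in> carrier (frac_field R)"
    then obtain a b c d e f where [simp]: "U = frac_class R a b" "V = frac_class R c d" "W = frac_class R e f"
      and p: "(a, b) \<in> frac_pairs R" "(c, d) \<in> frac_pairs R" "(e, f) \<in> frac_pairs R"
      by (meson frac_carrierE)
    have cl: "a \<in> carrier R" "b \<in> carrier R" "c \<in> carrier R" "d \<in> carrier R"
      "e \<in> carrier R" "f \<in> carrier R"
      using p by (auto simp: frac_pairs_iff)
    note q = frac_pairs_prod frac_pairs_sum
    show "U \<otimes>\<^bsub>frac_field R\<^esub> V \<otimes>\<^bsub>frac_field R\<^esub> W = U \<otimes>\<^bsub>frac_field R\<^esub> (V \<otimes>\<^bsub>frac_field R\<^esub> W)"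
      using cl by (simp add: frac_mult p q m_assoc)
    show "U \<oplus>\<^bsub>frac_field R\<^esub> V \<oplus>\<^bsub>frac_field R\<^esub> W = U \<oplus>\<^bsub>frac_field R\<^esub> (V \<oplus>\<^bsub>frac_field R\<^esub> W)"
      using cl by (simp add: frac_add p q, simp add: l_distr r_distr m_ac a_ac)
    show "(U \<oplus>\<^bsub>frac_field R\<^esub> V) \<otimes>\<^bsub>frac_field R\<^esub> W =
      (U \<otimes>\<^bsub>frac_field R\<^esub> W) \<oplus>\<^bsub>frac_field R\<^esub> (V \<otimes>\<^bsub>frac_field R\<^esub> W)"
      using cl by (simp add: frac_mult frac_add p q frac_eq_iff, simp add: l_distr r_distr m_ac a_ac)
  qed
  then interpret F: cring "frac_field R" .
  have "\<one>\<^bsub>frac_field R\<^esub> \<noteq> \<zero>\<^bsub>frac_field R\<^esub>"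
    by (simp add: frac_one frac_zero frac_eq_iff one zero)
  then show ?thesis
    using inv by (metis F.cring_fieldI2 F.m_comm)
qed

lemma frac_embed_hom: "frac_embed R \<in> ring_hom R (frac_field R)"
  by (rule ring_hom_memI)
    (auto simp: frac_embed_def frac_mult frac_add frac_one frac_pairs_iff intro!: frac_in_carrier)

lemma inj_on_frac_embed: "inj_on (frac_embed R) (carrier R)"
  by (auto simp: inj_on_def frac_embed_def frac_eq_iff frac_pairs_iff)

end


section \<open>Normal domains\<close>

text \<open>Polynomials over a ring are coefficient lists with the leading coefficient first.\<close>

definition integral_over :: "('a, 'm) ring_scheme \<Rightarrow> 'a set \<Rightarrow> 'a \<Rightarrow> bool"
  where "integral_over K A x \<longleftrightarrow>
    (\<exists>p. polynomial\<^bsub>K\<^esub> A p \<and> p \<noteq> [] \<and> hd p = \<one>\<^bsub>K\<^esub> \<and> ring.eval K p x = \<zero>\<^bsub>K\<^esub>)"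

definition normal_domain :: "('a, 'm) ring_scheme \<Rightarrow> bool"
  where "normal_domain R \<longleftrightarrow> domain R \<and>
    (\<forall>x\<in>carrier (frac_field R).
       integral_over (frac_field R) (frac_embed R ` carrier R) x \<longrightarrow>
       x \<in> frac_embed R ` carrier R)"

end

theory Submission
  imports
    Defs
    "HOL-Computational_Algebra.Computational_Algebra"
    "HOL-Analysis.Complex_Transcendental"
begin

text \<open>Let \<open>F\<close> and \<open>G\<close> be the power sums of degrees \<open>a < b\<close> in four variables, \<open>Q\<close> the ideal that they
generate, and \<open>C\<close> the curve \<open>F = G = 0\<close> in projective space. When \<open>C\<close> is a complete intersection, the
quotient is Cohen--Macaulay of dimension two, so by Serre's criterion it is normal iff \<open>C\<close> is smooth.
A point \<open>p\<close> of \<open>C\<close> is singular iff the vectors \<open>(p\<^sub>i ^ (a - 1))\<close> and \<open>(p\<^sub>i ^ (b - 1))\<close> are linearly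
dependent. If \<open>p\<^sub>k = 1\<close>, this says that each \<open>p\<^sub>i\<close> is a root of unity of order dividing \<open>b - a\<close> or,
when \<open>a > 1\<close>, zero. Hence the \<open>p\<^sub>i ^ a\<close> are zeros and complex numbers of modulus one with sum zero, which
is only possible if one of them is \<open>-1\<close>, or if they are 0 and the three cube roots of unity
(\<open>unimodular_sum_zero\<close>). Whether \<open>-1\<close> or a primitive cube root of unity is the \<open>a\<close>-th power of a
\<open>(b - a)\<close>-th root of unity depends on the valuations of \<open>a\<close> and \<open>b - a\<close> at 2 and 3
(\<open>root_of_unity_multiplicity\<close>, \<open>exists_root_of_unity\<close>), and comparing with \<open>b\<close> gives the stated
conditions.

The smooth case does not pass through the general form of Serre's criterion. Its two halves appear as
follows. Depth: if the valuations at 2 differ, \<open>F\<close> and \<open>G\<close> stay coprime after setting two variables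
to zero, so any two variables form a regular sequence modulo \<open>Q\<close>
(\<open>variable_powers_regular_sequence\<close>). Regularity in codimension one: at a point of \<open>C\<close>, a Jacobian
minor \<open>h\<close> and a linear form \<open>\<pi>\<close> satisfy \<open>h P \<subseteq> Q + (\<pi>)\<close> for the prime ideal \<open>P\<close> of the point
(\<open>uniformizer_at_point\<close>), which together with the basis theorem makes the local ring a discrete
valuation ring (\<open>local_order\<close>). Given a fraction \<open>u / s\<close> that is integral over the quotient, the
homogeneous ideal of its denominators is therefore contained in no point of \<open>C\<close>; by the
Nullstellensatz it contains powers of all variables, and the regular sequence shows that \<open>u / s\<close>
lies in the ring (\<open>homogeneous_almost_integral\<close>). The same argument, applied to the annihilators of a
homogeneous zero divisor, proves that the quotient is a domain (\<open>cone_ideal_prime\<close>).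
Integral fractions with inhomogeneous numerator and denominator are reduced to homogeneous ones by
comparing leading forms; this works for almost integral fractions, those all of whose powers have a
common denominator (\<open>almost_integral_in_ring\<close>).

In the singular case, if \<open>\<zeta> ^ a = \<zeta> ^ b = -1\<close>, then \<open>Q\<close> vanishes on the plane
\<open>x\<^sub>0 = \<zeta> x\<^sub>1, x\<^sub>2 = \<zeta> x\<^sub>3\<close>; a Jacobian determinant multiplies a linear form into \<open>Q\<close>, and the quotient is not
a domain (\<open>plane_component\<close>). If instead \<open>\<zeta> ^ a = \<zeta> ^ b\<close> is a primitive cube root of unity and \<open>a > 1\<close>,
then \<open>C\<close> has the double point \<open>(1, \<zeta>, \<zeta>\<^sup>2, 0)\<close>, and a Jacobian determinant \<open>u\<close> in the first three variables
has a square divisible by \<open>x\<^sub>3\<^sup>2\<close> without being divisible by \<open>x\<^sub>3\<close> itself; the fraction \<open>u / x\<^sub>3\<close>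
violates normality (\<open>double_point\<close>).\<close>

section \<open>Ideals of commutative rings\<close>

text \<open>Ideals are the submodules of a ring acting on itself, so the theory of modules supplies the ideal
generated by a set and its closure properties.\<close>

interpretation idl: Modules.module "(*) :: 'a::comm_ring_1 \<Rightarrow> 'a \<Rightarrow> 'a"
  by standard (auto simp: algebra_simps)

\<comment> \<open>For a ring acting on itself this rewrites against the orientation of \<open>mult.assoc\<close>.\<close>
declare idl.scale_scale [simp del]

abbreviation is_ideal :: "'a::comm_ring_1 set \<Rightarrow> bool"
  where "is_ideal \<equiv> Modules.module.subspace (*)"

abbreviation ideal_span :: "'a::comm_ring_1 set \<Rightarrow> 'a set"
  where "ideal_span \<equiv> Modules.module.span (*)"

definition is_prime :: "'a::comm_ring_1 set \<Rightarrow> bool"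
  where "is_prime P \<longleftrightarrow> is_ideal P \<and> 1 \<notin> P \<and> (\<forall>x y. x * y \<in> P \<longrightarrow> x \<in> P \<or> y \<in> P)"

lemma ideal_lincomb2:
  assumes "is_ideal I" "x \<in> I" "y \<in> I"
  shows "a * x + b * y \<in> I"
  using assms by (intro idl.subspace_add idl.subspace_scale)

lemma ideal_mult_right:
  assumes "is_ideal I" "x \<in> I"
  shows "x * a \<in> I"
  using idl.subspace_scale[OF assms, of a] by (simp add: mult.commute)

lemma ideal_diff_cong:
  assumes "is_ideal I" "x - y \<in> I"
  shows "x \<in> I \<longleftrightarrow> y \<in> I"
  using idl.subspace_diff[OF assms(1) _ assms(2), of x] idl.subspace_add[OF assms(1) assms(2), of y]
  by auto

lemma prime_power: "is_prime P \<Longrightarrow> x ^ n \<in> P \<Longrightarrow> x \<in> P"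
  by (induction n) (auto simp: is_prime_def)

lemma prime_mult_iff: "is_prime P \<Longrightarrow> x * y \<in> P \<longleftrightarrow> x \<in> P \<or> y \<in> P"
  unfolding is_prime_def using idl.subspace_scale ideal_mult_right by blast

lemma ideal_span_insert:
  assumes "is_ideal I"
  shows "x \<in> ideal_span (insert a I) \<longleftrightarrow> (\<exists>k. x - k * a \<in> I)"
proof -
  have "ideal_span I = I"
    using assms by (rule idl.span_eq_iff[THEN iffD2])
  then show ?thesis
    by (simp only: idl.span_insert mem_Collect_eq)
qed

lemma ideal_span_singleton: "f \<in> ideal_span {x} \<longleftrightarrow> (\<exists>q. f = q * x)"
  by (auto simp: idl.span_singleton)

lemma ideal_cong_mult:
  assumes "is_ideal Q" "x - y \<in> Q" "x' - y' \<in> Q"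
  shows "x * x' - y * y' \<in> Q"
  using ideal_lincomb2[OF assms, of x' y] by (simp add: algebra_simps)

lemma ideal_cong_power: "is_ideal Q \<Longrightarrow> x - y \<in> Q \<Longrightarrow> x ^ n - y ^ n \<in> Q"
  by (induction n) (simp_all add: idl.subspace_0 ideal_cong_mult)

lemma ideal_cong_trans: "is_ideal Q \<Longrightarrow> x - y \<in> Q \<Longrightarrow> y - z \<in> Q \<Longrightarrow> x - z \<in> Q"
  using idl.subspace_add[of Q "x - y" "y - z"] by simp

lemma ideal_cong_sym: "is_ideal Q \<Longrightarrow> x - y \<in> Q \<Longrightarrow> y - x \<in> Q"
  using idl.subspace_neg[of Q "x - y"] by simp

section \<open>Noetherian rings and the basis theorem\<close>

definition noetherian :: "'a::comm_ring_1 itself \<Rightarrow> bool"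
  where "noetherian _ \<longleftrightarrow> (\<forall>I :: 'a set. is_ideal I \<longrightarrow> (\<exists>A. finite A \<and> ideal_span A = I))"

text \<open>The ideal generated by the whole sequence has finitely many generators, and these lie in the ideal
generated by some initial segment. This form of the ascending chain condition is the one that the
basis theorem and the analysis of orders of vanishing need.\<close>

lemma noetherian_sequence:
  fixes s :: "nat \<Rightarrow> 'a::comm_ring_1"
  assumes "noetherian TYPE('a)"
  shows "\<exists>k. s k \<in> ideal_span (s ` {..<k})"
proof -
  obtain B where B: "finite B" "ideal_span B = ideal_span (range s)"
    using assms idl.subspace_span unfolding noetherian_def by metis
  have "\<exists>k. b \<in> ideal_span (s ` {..<k})" if b: "b \<in> ideal_span (range s)" for b
    using b
  proof (induction rule: idl.span_induct_alt)
    case base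
    then show ?case using idl.span_zero by blast
  next
    case (step c x y)
    then obtain i k where x: "x = s i" and y: "y \<in> ideal_span (s ` {..<k})"
      by blast
    have "x \<in> ideal_span (s ` {..<max k (Suc i)})"
      unfolding x by (rule idl.span_base) auto
    moreover have "y \<in> ideal_span (s ` {..<max k (Suc i)})"
      using y by (rule subsetD[OF idl.span_mono, rotated]) auto
    ultimately show ?case
      by (blast intro: idl.span_add idl.span_scale)
  qed
  moreover have "b \<in> ideal_span (range s)" if "b \<in> B" for b
    using that B(2) idl.span_base by blast
  ultimately obtain K where K: "b \<in> B \<Longrightarrow> b \<in> ideal_span (s ` {..<K b})" for b
    by metis
  define k where "k = Max (K ` B)"
  have "B \<subseteq> ideal_span (s ` {..<k})"
  proof
    fix b assume b: "b \<in> B"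
    then have "K b \<le> k"
      unfolding k_def using B(1) by simp
    then have "s ` {..<K b} \<subseteq> s ` {..<k}"
      by auto
    then show "b \<in> ideal_span (s ` {..<k})"
      using K[OF b] idl.span_mono by blast
  qed
  then have "ideal_span (range s) \<subseteq> ideal_span (s ` {..<k})"
    using idl.span_minimal idl.subspace_span unfolding B(2)[symmetric] by blast
  moreover have "s k \<in> ideal_span (range s)"
    by (rule idl.span_base) simp
  ultimately show ?thesis by blast
qed

lemma noetherian_field: "noetherian TYPE('a::field)"
  unfolding noetherian_def
proof (intro allI impI)
  fix I :: "'a set" assume I: "is_ideal I"
  show "\<exists>A. finite A \<and> ideal_span A = I"
  proof (cases "I = {0}")
    case True
    then show ?thesis by (intro exI[of _ "{}"]) simp
  next
    case False
    then obtain x where x: "x \<in> I" "x \<noteq> 0"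
      using idl.subspace_0[OF I] by blast
    have "y \<in> I" for y
      using idl.subspace_scale[OF I x(1), of "y / x"] x(2) by simp
    moreover have "y \<in> ideal_span {1}" for y :: 'a
      using idl.span_scale[OF idl.span_base[of 1 "{1}"], of y] by simp
    ultimately show ?thesis by blast
  qed
qed

lemma noetherian_image:
  fixes f :: "'a::comm_ring_1 \<Rightarrow> 'b::comm_ring_1"
  assumes "noetherian TYPE('a)" "surj f"
    and add: "\<And>x y. f (x + y) = f x + f y" and mult: "\<And>x y. f (x * y) = f x * f y"
  shows "noetherian TYPE('b)"
  unfolding noetherian_def
proof (intro allI impI)
  fix I :: "'b set" assume I: "is_ideal I"
  have f0: "f 0 = 0"
    using add[of 0 0] by simp
  have "is_ideal (f -` I)"
    using I unfolding idl.subspace_def by (simp add: add mult f0)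
  then obtain A where A: "finite A" "ideal_span A = f -` I"
    using assms(1) unfolding noetherian_def by blast
  have "f x \<in> ideal_span (f ` A)" if "x \<in> ideal_span A" for x
    using that
  proof (induction rule: idl.span_induct_alt)
    case base
    then show ?case by (simp add: f0 idl.span_zero)
  next
    case (step c x y)
    then show ?case
      by (simp add: add mult idl.span_add idl.span_scale idl.span_base)
  qed
  then have "I \<subseteq> ideal_span (f ` A)"
    using assms(2) unfolding A(2) by (metis subsetI surjD vimageI)
  moreover have "f ` A \<subseteq> I"
    using A(2) idl.span_superset[of A] by blast
  ultimately have "ideal_span (f ` A) = I"
    using idl.span_subspace[OF _ _ I] by blast
  then show "\<exists>A. finite A \<and> ideal_span A = I"
    using A(1) by blast
qed

text \<open>If an ideal \<open>I\<close> had no finite set of generators, one could choose \<open>f\<^sub>0, f\<^sub>1, \<dots>\<close> so that \<open>f\<^sub>k\<close> has least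
degree among the elements of \<open>I\<close> outside the ideal generated by its predecessors. The degrees increase,
so when the leading coefficient of some \<open>f\<^sub>k\<close> is a combination of the earlier ones, subtracting the
corresponding combination of shifted polynomials \<open>f\<^sub>i\<close> leaves an element of smaller degree that is
still outside that ideal, against the choice of \<open>f\<^sub>k\<close>.\<close>

theorem Hilbert_basis:
  assumes N: "noetherian TYPE('a::comm_ring_1)"
  shows "noetherian TYPE('a poly)"
  unfolding noetherian_def
proof (intro allI impI, rule ccontr)
  fix I :: "'a poly set"
  assume I: "is_ideal I" and nfg: "\<not> (\<exists>A. finite A \<and> ideal_span A = I)"
  have ex: "\<exists>p. p \<in> I - ideal_span A" if "finite A" "A \<subseteq> I" for A
  proof (rule ccontr)
    assume "\<not> ?thesis"
    then have "ideal_span A = I"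
      using that by (intro idl.span_subspace[OF _ _ I]) auto
    with nfg that show False by blast
  qed
  define g where "g A = (ARG_MIN degree p. p \<in> I - ideal_span A)" for A
  have g: "g A \<in> I - ideal_span A" if "finite A" "A \<subseteq> I" for A
    unfolding g_def using ex[OF that] by (metis (mono_tags, lifting) arg_min_natI)
  have gmin: "degree (g A) \<le> degree p" if "p \<in> I - ideal_span A" for A p
    unfolding g_def by (rule arg_min_nat_le) (use that in simp)
  define B where "B = rec_nat {} (\<lambda>_ A. insert (g A) A)"
  define f where "f k = g (B k)" for k
  have B_Suc: "B (Suc k) = insert (f k) (B k)" for k
    by (simp add: B_def f_def)
  have B_eq: "B k = f ` {..<k}" for k
    by (induction k) (auto simp: B_Suc lessThan_Suc, simp add: B_def)
  have B_fin: "finite (B k)" for k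
    by (simp add: B_eq)
  have BI: "B k \<subseteq> I" for k
  proof (induction k)
    case 0
    show ?case by (simp add: B_def)
  next
    case (Suc k)
    then show ?case using g[OF B_fin Suc] by (simp add: B_Suc f_def)
  qed
  have f: "f k \<in> I" "f k \<notin> ideal_span (f ` {..<k})" for k
    using g[OF B_fin BI, of k] unfolding B_eq[symmetric] by (simp_all add: f_def)
  have fmin: "degree (f k) \<le> degree p" if "p \<in> I" "p \<notin> ideal_span (f ` {..<k})" for k p
    unfolding f_def[of k] by (rule gmin) (simp add: that B_eq[of k])
  obtain k where k: "lead_coeff (f k) \<in> ideal_span ((\<lambda>i. lead_coeff (f i)) ` {..<k})"
    using noetherian_sequence[OF N, of "\<lambda>i. lead_coeff (f i)"] by auto
  define d where "d = degree (f k)"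
  have le: "degree (f i) \<le> d" if "i < k" for i
  proof -
    have "ideal_span (f ` {..<i}) \<subseteq> ideal_span (f ` {..<k})"
      using that by (intro idl.span_mono image_mono) auto
    then show ?thesis
      unfolding d_def using f(2)[of k] by (intro fmin[OF f(1)]) blast
  qed
  have "\<exists>q. q \<in> ideal_span (f ` {..<k}) \<and> degree q \<le> d \<and> coeff q d = c"
    if "c \<in> ideal_span ((\<lambda>i. lead_coeff (f i)) ` {..<k})" for c
    using that
  proof (induction rule: idl.span_induct_alt)
    case base
    show ?case by (rule exI[of _ 0]) (auto simp: idl.span_zero)
  next
    case (step r x y)
    then obtain i q where i: "i < k" "x = lead_coeff (f i)"
      and q: "q \<in> ideal_span (f ` {..<k})" "degree q \<le> d" "coeff q d = y"
      by blast
    let ?q = "monom r (d - degree (f i)) * f i + q"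
    have "?q \<in> ideal_span (f ` {..<k})"
      by (rule idl.span_add[OF idl.span_scale q(1)]) (use i in \<open>auto intro: idl.span_base\<close>)
    moreover have "degree ?q \<le> d"
      using degree_mult_le[of "monom r (d - degree (f i))" "f i"] degree_monom_le[of r "d - degree (f i)"]
        le[OF i(1)] q(2) by (intro degree_add_le) auto
    moreover have "coeff ?q d = r * x + y"
      using le[OF i(1)] q(3) i(2) by (simp add: coeff_monom_mult)
    ultimately show ?case by blast
  qed
  from this[OF k] obtain q where q: "q \<in> ideal_span (f ` {..<k})" "degree q \<le> d" "coeff q d = lead_coeff (f k)"
    by blast
  have span_I: "ideal_span (f ` {..<k}) \<subseteq> I"
    using BI[of k] I idl.span_minimal by (simp add: B_eq)
  \<comment> \<open>Cancelling the leading coefficient keeps the difference outside the ideal generated so far.\<close>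
  have new: "f k - q \<in> I" "f k - q \<notin> ideal_span (f ` {..<k})"
    using q(1) f[of k] span_I idl.subspace_diff[OF I] idl.span_add[of "f k - q" _ q] by auto
  have "degree (f k - q) \<le> d"
    using q(2) by (intro degree_diff_le) (auto simp: d_def)
  moreover have "coeff (f k - q) d = 0"
    using q(3) by (simp add: d_def)
  moreover have "f k - q \<noteq> 0"
    using new(2) by (auto simp: idl.span_zero)
  ultimately have "degree (f k - q) < d"
    by (metis leading_coeff_0_iff le_neq_implies_less)
  with fmin[OF new] show False
    by (simp add: d_def)
qed

section \<open>Local rings whose maximal ideal is principal\<close>

text \<open>A substitute for Krull's intersection theorem: locally at \<open>P\<close>, where \<open>h\<close> is a unit, the ideal \<open>P\<close> is
generated by \<open>\<pi>\<close> modulo \<open>Q\<close>, and an element either vanishes or is a power of \<open>\<pi>\<close> times a unit. Otherwise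
division by \<open>\<pi>\<close> never stops: there are \<open>s\<^sub>0 = f, s\<^sub>1, s\<^sub>2, \<dots>\<close> in \<open>P\<close> with \<open>h s\<^sub>k = \<pi> s\<^bsub>k+1\<^esub>\<close> modulo \<open>Q\<close>. Some
\<open>s\<^sub>k\<close> is a combination of its predecessors, whence \<open>h ^ k s\<^sub>k = r \<pi> s\<^sub>k\<close> for some \<open>r\<close>. The factor
\<open>h ^ k - r \<pi>\<close> is not in \<open>P\<close>, and it annihilates \<open>s\<^sub>k\<close> modulo \<open>Q\<close>; so \<open>f\<close> vanishes locally after all.\<close>

lemma local_order:
  fixes h \<pi> :: "'a::comm_ring_1"
  assumes N: "noetherian TYPE('a)" and Q: "is_ideal Q" and P: "is_prime P"
    and h: "h \<notin> P" and pi: "\<pi> \<in> P" and hP: "\<And>f. f \<in> P \<Longrightarrow> \<exists>g. h * f - \<pi> * g \<in> Q"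
  shows "(\<exists>c. c \<notin> P \<and> c * f \<in> Q) \<or> (\<exists>n g. g \<notin> P \<and> h ^ n * f - \<pi> ^ n * g \<in> Q)"
proof (rule ccontr)
  assume "\<not> ?thesis"
  then have no_kill: "\<And>c. c * f \<in> Q \<Longrightarrow> c \<in> P"
    and no_ord: "\<And>n g. h ^ n * f - \<pi> ^ n * g \<in> Q \<Longrightarrow> g \<in> P"
    by blast+
  define nx where "nx g = (SOME g'. h * g - \<pi> * g' \<in> Q)" for g
  have nx: "h * g - \<pi> * nx g \<in> Q" if "g \<in> P" for g
    unfolding nx_def using hP[OF that] by (rule someI_ex)
  define s where "s k = (nx ^^ k) f" for k
  have s_ord: "h ^ k * f - \<pi> ^ k * s k \<in> Q" for k
  proof (induction k)
    case 0
    then show ?case using idl.subspace_0[OF Q] by (simp add: s_def)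
  next
    case (Suc k)
    have "h ^ Suc k * f - \<pi> ^ Suc k * s (Suc k)
      = h * (h ^ k * f - \<pi> ^ k * s k) + \<pi> ^ k * (h * s k - \<pi> * s (Suc k))"
      by (simp add: algebra_simps)
    also have "\<dots> \<in> Q"
      using nx[OF no_ord[OF Suc]] by (intro ideal_lincomb2 Q Suc) (simp add: s_def)
    finally show ?case .
  qed
  have s_step: "h * s k - \<pi> * s (Suc k) \<in> Q" for k
    using nx[OF no_ord[OF s_ord]] by (simp add: s_def)
  have s_add: "h ^ m * s i - \<pi> ^ m * s (i + m) \<in> Q" for i m
  proof (induction m)
    case 0
    then show ?case using idl.subspace_0[OF Q] by simp
  next
    case (Suc m)
    have "h ^ Suc m * s i - \<pi> ^ Suc m * s (i + Suc m)
      = h * (h ^ m * s i - \<pi> ^ m * s (i + m)) + \<pi> ^ m * (h * s (i + m) - \<pi> * s (Suc (i + m)))"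
      by (simp add: algebra_simps)
    also have "\<dots> \<in> Q"
      by (intro ideal_lincomb2 Q Suc s_step)
    finally show ?case .
  qed
  obtain k where k: "s k \<in> ideal_span (s ` {..<k})"
    using noetherian_sequence[OF N, of s] by auto
  have "\<exists>r. h ^ k * y - r * \<pi> * s k \<in> Q" if "y \<in> ideal_span (s ` {..<k})" for y
    using that
  proof (induction rule: idl.span_induct_alt)
    case base
    show ?case by (rule exI[of _ 0]) (simp add: idl.subspace_0[OF Q])
  next
    case (step c x y)
    then obtain i r where i: "i < k" "x = s i" and r: "h ^ k * y - r * \<pi> * s k \<in> Q"
      by blast
    define m where "m = k - i - 1"
    have k_eq: "k = i + Suc m" using i by (simp add: m_def)
    have "h ^ k * (c * x + y) - (c * h ^ i * \<pi> ^ m + r) * \<pi> * s k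
      = (c * h ^ i) * (h ^ Suc m * s i - \<pi> ^ Suc m * s (i + Suc m)) + 1 * (h ^ k * y - r * \<pi> * s k)"
      unfolding i(2) by (simp add: k_eq algebra_simps power_add)
    also have "\<dots> \<in> Q"
      by (intro ideal_lincomb2 Q s_add r)
    finally show ?case by blast
  qed
  from this[OF k] obtain r where r: "h ^ k * s k - r * \<pi> * s k \<in> Q"
    by blast
  let ?c = "h ^ k - r * \<pi>"
  have "h ^ k * ?c * f = ?c * (h ^ k * f - \<pi> ^ k * s k) + \<pi> ^ k * (h ^ k * s k - r * \<pi> * s k)"
    by (simp add: algebra_simps)
  also have "\<dots> \<in> Q"
    by (intro ideal_lincomb2 Q s_ord r)
  finally have "h ^ k * ?c \<in> P"
    by (rule no_kill)
  then have "?c \<in> P"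
    using P h prime_power[OF P, of h k] by (auto simp: prime_mult_iff)
  moreover have "r * \<pi> \<in> P"
    using P pi by (simp add: prime_mult_iff)
  moreover have "is_ideal P" using P by (simp add: is_prime_def)
  ultimately have "h ^ k \<in> P"
    using idl.subspace_add[of P ?c "r * \<pi>"] by simp
  then show False
    using h prime_power[OF P] by blast
qed

text \<open>The localization at \<open>P\<close> of the ring modulo \<open>Q\<close> is a discrete valuation ring with uniformizer \<open>\<pi>\<close>.
Instead of forming it, one works in the ring itself and multiplies by elements outside \<open>P\<close>.\<close>

locale uniformizer =
  fixes Q P :: "'a::comm_ring_1 set" and h \<pi> :: 'a
  assumes noeth: "noetherian TYPE('a)" and Q: "is_ideal Q" and P: "is_prime P" and QP: "Q \<subseteq> P"
    and h: "h \<notin> P" and pi: "\<pi> \<in> P"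
    and hP: "\<And>f. f \<in> P \<Longrightarrow> \<exists>g. h * f - \<pi> * g \<in> Q"
    and pi_regular: "\<And>f. \<pi> * f \<in> Q \<Longrightarrow> f \<in> Q"
begin

lemma order_cases:
  obtains (killed) c where "c \<notin> P" "c * f \<in> Q"
  | (order) n g where "g \<notin> P" "h ^ n * f - \<pi> ^ n * g \<in> Q"
  using local_order[OF noeth Q P h pi hP] by blast

lemma pi_power_regular: "\<pi> ^ n * f \<in> Q \<Longrightarrow> f \<in> Q"
  by (induction n) (auto simp: mult.assoc dest: pi_regular)

lemma h_power: "h ^ n \<notin> P"
  using prime_power[OF P] h by blast

text \<open>If neither factor vanished locally, both would be powers of \<open>\<pi>\<close> times local units, and \<open>\<pi>\<close> is not a
zero divisor modulo \<open>Q\<close>.\<close>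

lemma local_domain:
  assumes fg: "f * g \<in> Q"
  shows "(\<exists>c. c \<notin> P \<and> c * f \<in> Q) \<or> (\<exists>c. c \<notin> P \<and> c * g \<in> Q)"
proof (cases rule: order_cases[of f])
  case (order n f')
  note f' = this
  show ?thesis
  proof (cases rule: order_cases[of g])
    case (order m g')
    have "h ^ n * f * (h ^ m * g) - \<pi> ^ n * f' * (\<pi> ^ m * g') \<in> Q"
      by (intro ideal_cong_mult Q f' order)
    moreover have "h ^ n * f * (h ^ m * g) \<in> Q"
      using idl.subspace_scale[OF Q fg, of "h ^ n * h ^ m"] by (simp add: ac_simps)
    ultimately have "\<pi> ^ n * f' * (\<pi> ^ m * g') \<in> Q"
      using ideal_diff_cong[OF Q] by blast
    then have "\<pi> ^ (n + m) * (f' * g') \<in> Q"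
      by (simp add: power_add ac_simps)
    then have "f' * g' \<in> P"
      using pi_power_regular QP by blast
    then show ?thesis
      using f'(1) order(1) prime_mult_iff[OF P] by blast
  qed blast
qed blast

text \<open>For the valuation \<open>v\<close> of the local ring, divisibility of \<open>c u ^ n\<close> by \<open>s ^ n\<close> gives
\<open>n (v s - v u) \<le> v c\<close>. As this holds for all \<open>n\<close>, it follows that \<open>v s \<le> v u\<close>, so \<open>s\<close> divides \<open>u\<close>
locally.\<close>

lemma local_almost_integral:
  assumes prime: "is_prime Q" and s: "s \<notin> Q" and c: "c \<notin> Q"
    and almost: "\<And>n. \<exists>r. c * u ^ n - s ^ n * r \<in> Q"
  shows "\<exists>e r. e \<notin> P \<and> e * u - s * r \<in> Q"
proof -
  have order_nz: "\<exists>n g. g \<notin> P \<and> h ^ n * f - \<pi> ^ n * g \<in> Q" if "f \<notin> Q" for f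
  proof (cases rule: order_cases[of f])
    case (killed e)
    then show ?thesis using that prime_mult_iff[OF prime] QP by blast
  qed blast
  obtain i s' where s': "s' \<notin> P" "h ^ i * s - \<pi> ^ i * s' \<in> Q"
    using order_nz[OF s] by blast
  obtain l c' where c': "c' \<notin> P" "h ^ l * c - \<pi> ^ l * c' \<in> Q"
    using order_nz[OF c] by blast
  show ?thesis
  proof (cases rule: order_cases[of u])
    case (killed e)
    then show ?thesis by (intro exI[of _ e] exI[of _ 0]) simp
  next
    case (order j u')
    show ?thesis
    proof (cases "i \<le> j")
      case True
      then have j: "j = i + (j - i)" by simp
      have "h ^ j * s' * u - s * (h ^ i * \<pi> ^ (j - i) * u')
        = s' * (h ^ j * u - \<pi> ^ j * u') + (- (\<pi> ^ (j - i) * u')) * (h ^ i * s - \<pi> ^ i * s')"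
        by (subst (3) j) (simp add: algebra_simps power_add)
      also have "\<dots> \<in> Q"
        by (intro ideal_lincomb2 Q order s')
      finally show ?thesis
        using s'(1) h_power prime_mult_iff[OF P] by blast
    next
      case False
      define m where "m = i - j"
      \<comment> \<open>One more than the order \<open>l\<close> of \<open>c\<close>, so that the divisibility by \<open>s ^ n\<close> becomes contradictory.\<close>
      define n where "n = Suc l"
      have i: "i = j + m" "0 < m"
        using False by (auto simp: m_def)
      have "Suc l \<le> m * n"
        using i(2) by (cases m) (auto simp: n_def)
      then obtain d where mn: "m * n = l + Suc d"
        by (auto simp: le_iff_add)
      obtain r where r: "c * u ^ n - s ^ n * r \<in> Q"
        using almost by blast
      have "h ^ l * c * (h ^ j * u) ^ n * h ^ (m * n) - \<pi> ^ l * c' * (\<pi> ^ j * u') ^ n * h ^ (m * n) \<in> Q"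
        by (rule ideal_cong_mult[OF Q ideal_cong_mult[OF Q c'(2) ideal_cong_power[OF Q order(2)]]])
          (simp add: idl.subspace_0[OF Q])
      moreover have "h ^ l * c * (h ^ j * u) ^ n * h ^ (m * n) - h ^ l * r * (h ^ i * s) ^ n \<in> Q"
      proof -
        have "h ^ l * c * (h ^ j * u) ^ n * h ^ (m * n) - h ^ l * r * (h ^ i * s) ^ n
          = h ^ l * h ^ (i * n) * (c * u ^ n - s ^ n * r)"
          by (simp add: i power_mult_distrib power_mult power_add algebra_simps)
        then show ?thesis
          using idl.subspace_scale[OF Q r] by metis
      qed
      moreover have "h ^ l * r * (h ^ i * s) ^ n - h ^ l * r * (\<pi> ^ i * s') ^ n \<in> Q"
        by (rule ideal_cong_mult[OF Q _ ideal_cong_power[OF Q s'(2)]]) (simp add: idl.subspace_0[OF Q])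
      ultimately have "\<pi> ^ l * c' * (\<pi> ^ j * u') ^ n * h ^ (m * n) - h ^ l * r * (\<pi> ^ i * s') ^ n \<in> Q"
        using ideal_cong_trans[OF Q] ideal_cong_sym[OF Q] by blast
      also have "\<pi> ^ l * c' * (\<pi> ^ j * u') ^ n * h ^ (m * n) - h ^ l * r * (\<pi> ^ i * s') ^ n
        = \<pi> ^ (l + j * n) * (c' * u' ^ n * h ^ (m * n)) - h ^ l * r * s' ^ n * (\<pi> ^ (j * n) * \<pi> ^ (m * n))"
        by (simp add: i power_mult_distrib power_mult power_add algebra_simps)
      also have "\<dots> = \<pi> ^ (l + j * n) * (c' * u' ^ n * h ^ (m * n) - h ^ l * r * s' ^ n * \<pi> ^ Suc d)"
        by (simp add: mn power_add algebra_simps)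
      \<comment> \<open>The first summand is a product of local units, the second a multiple of \<open>\<pi>\<close>.\<close>
      finally have "c' * u' ^ n * h ^ (m * n) - h ^ l * r * s' ^ n * \<pi> ^ Suc d \<in> P"
        using pi_power_regular QP by blast
      moreover have "h ^ l * r * s' ^ n * \<pi> ^ Suc d \<in> P"
        using pi prime_mult_iff[OF P] by simp
      ultimately have "c' * u' ^ n * h ^ (m * n) \<in> P"
        using ideal_diff_cong[of P] P unfolding is_prime_def by metis
      moreover have "u' ^ n \<notin> P"
        using order(1) prime_power[OF P] by blast
      ultimately show ?thesis
        using c'(1) h_power by (simp add: prime_mult_iff[OF P])
    qed
  qed
qed

end

section \<open>Ring maps\<close>

definition ring_map :: "('a::comm_ring_1 \<Rightarrow> 'b::comm_ring_1) \<Rightarrow> bool"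
  where "ring_map f \<longleftrightarrow> f 1 = 1 \<and> (\<forall>x y. f (x + y) = f x + f y) \<and> (\<forall>x y. f (x * y) = f x * f y)"

lemma ring_map_simps:
  assumes "ring_map f"
  shows "f 1 = 1" "f (x + y) = f x + f y" "f (x * y) = f x * f y" "f 0 = 0" "f (- x) = - f x"
    "f (x - y) = f x - f y" "f (x ^ n) = f x ^ n"
proof -
  show 1: "f 1 = 1" and 2: "\<And>x y. f (x + y) = f x + f y" and 3: "\<And>x y. f (x * y) = f x * f y"
    using assms by (auto simp: ring_map_def)
  show 0: "f 0 = 0" using 2[of 0 0] by simp
  show 4: "\<And>x. f (- x) = - f x"
    by (metis 0 2 add.right_inverse add_eq_0_iff)
  show "f (x - y) = f x - f y"
    using 2[of x "- y"] by (simp add: 4)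
  show "f (x ^ n) = f x ^ n"
    by (induction n) (simp_all add: 1 3)
qed

lemma ring_map_sum: "ring_map f \<Longrightarrow> f (sum g A) = (\<Sum>x\<in>A. f (g x))"
  by (induction A rule: infinite_finite_induct) (simp_all add: ring_map_simps)

lemma is_prime_kernel:
  fixes f :: "'a::comm_ring_1 \<Rightarrow> 'b::idom"
  assumes "ring_map f"
  shows "is_prime {x. f x = 0}"
  using assms unfolding is_prime_def idl.subspace_def by (simp add: ring_map_simps)

lemma ring_map_id: "ring_map (\<lambda>x. x)"
  by (simp add: ring_map_def)

lemma ring_map_const_poly: "ring_map f \<Longrightarrow> ring_map (\<lambda>x. [:f x:])"
  by (simp add: ring_map_def one_pCons)

lemma ring_map_poly: "ring_map (\<lambda>p. poly p x)"
  by (simp add: ring_map_def)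

definition poly_ev :: "('a::comm_ring_1 \<Rightarrow> 'b::comm_ring_1) \<Rightarrow> 'b \<Rightarrow> 'a poly \<Rightarrow> 'b"
  where "poly_ev \<kappa> x p = poly (map_poly \<kappa> p) x"

lemma poly_ev_0: "poly_ev \<kappa> x 0 = 0"
  by (simp add: poly_ev_def)

lemma poly_ev_pCons:
  assumes "ring_map \<kappa>"
  shows "poly_ev \<kappa> x (pCons a p) = \<kappa> a + x * poly_ev \<kappa> x p"
  by (simp add: poly_ev_def map_poly_pCons ring_map_simps[OF assms])

lemma ring_map_poly_ev:
  assumes "ring_map \<kappa>"
  shows "ring_map (poly_ev \<kappa> x)"
proof -
  note simps = poly_ev_0 poly_ev_pCons[OF assms] ring_map_simps[OF assms]
  have add: "poly_ev \<kappa> x (p + q) = poly_ev \<kappa> x p + poly_ev \<kappa> x q" for p q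
    by (induction p q rule: poly_induct2) (simp_all add: simps algebra_simps)
  have smult: "poly_ev \<kappa> x (smult a p) = \<kappa> a * poly_ev \<kappa> x p" for a p
    by (induction p) (simp_all add: simps algebra_simps)
  have mult: "poly_ev \<kappa> x (p * q) = poly_ev \<kappa> x p * poly_ev \<kappa> x q" for p q
    by (induction p) (simp_all add: simps add smult algebra_simps)
  have "poly_ev \<kappa> x 1 = 1"
    by (simp add: one_pCons simps)
  with add mult show ?thesis
    by (simp add: ring_map_def)
qed

section \<open>Substitution and grading in the polynomial ring\<close>

lemma exhaust_index4: "(i::4) \<in> {0, 1, 2, 3}"
proof (cases i)
  case (of_int z)
  then have "z \<in> {0, 1, 2, 3}" by auto
  then show ?thesis using of_int by auto
qed

lemma UNIV_index4: "(UNIV :: 4 set) = {0, 1, 2, 3}"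
  using exhaust_index4 by blast

lemma index4_distinct [simp]:
  "(0::4) \<noteq> 1" "(0::4) \<noteq> 2" "(0::4) \<noteq> 3" "(1::4) \<noteq> 2" "(1::4) \<noteq> 3" "(2::4) \<noteq> 3"
  "(1::4) \<noteq> 0" "(2::4) \<noteq> 0" "(3::4) \<noteq> 0" "(2::4) \<noteq> 1" "(3::4) \<noteq> 1" "(3::4) \<noteq> 2"
  by simp_all

lemma index4_complement2:
  fixes k l :: 4
  assumes "k \<noteq> l"
  shows "\<exists>i j. i \<noteq> j \<and> i \<noteq> k \<and> i \<noteq> l \<and> j \<noteq> k \<and> j \<noteq> l \<and> UNIV = {k, l, i, j}"
proof -
  have "card (UNIV - {k, l}) = 2"
    using assms by (subst card_Diff_subset) auto
  then obtain i j where ij: "UNIV - {k, l} = {i, j}" "i \<noteq> j"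
    by (meson card_2_iff)
  have "x \<in> {i, j} \<longleftrightarrow> x \<noteq> k \<and> x \<noteq> l" for x
    unfolding ij(1)[symmetric] by simp
  then have "i \<noteq> k" "i \<noteq> l" "j \<noteq> k" "j \<noteq> l" "UNIV = {k, l, i, j}"
    by auto
  then show ?thesis
    using ij(2) by metis
qed

lemma sum_index4: "(\<Sum>i\<in>UNIV. f (i::4)) = f 0 + f 1 + f 2 + f 3"
proof -
  have "(\<Sum>i\<in>UNIV. f (i::4)) = (\<Sum>i\<in>{0, 1, 2, 3}. f i)"
    by (simp only: UNIV_index4)
  also have "\<dots> = f 0 + f 1 + f 2 + f 3"
    by (simp add: add.assoc)
  finally show ?thesis .
qed

definition const :: "complex \<Rightarrow> poly4"
  where "const c = Poly_Mapping.single 0 c"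

lemma ring_map_const: "ring_map const"
  by (auto simp: ring_map_def const_def single_add mult_single)

lemma single_eq_monomial:
  "Poly_Mapping.single m c = const c * (\<Prod>i\<in>UNIV. var i ^ Poly_Mapping.lookup m i)"
proof -
  have pow: "var i ^ n = Poly_Mapping.single (Poly_Mapping.single i n) 1" for i n
    by (induction n) (auto simp: var_def mult_single simp flip: single_add)
  have prod: "(\<Prod>i\<in>A. Poly_Mapping.single (g i) (1::complex)) = Poly_Mapping.single (\<Sum>i\<in>A. g i) 1"
    for g :: "4 \<Rightarrow> 4 \<Rightarrow>\<^sub>0 nat" and A
    by (induction A rule: infinite_finite_induct) (auto simp: mult_single)
  have "(\<Sum>i\<in>UNIV. Poly_Mapping.single i (Poly_Mapping.lookup m i)) = m"
    by (rule poly_mapping_eqI) (simp add: lookup_sum lookup_single when_def)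
  then show ?thesis
    by (simp add: pow prod const_def mult_single)
qed

lemma poly4_eq_sum: "(f :: poly4) = (\<Sum>m\<in>Poly_Mapping.keys f. Poly_Mapping.single m (Poly_Mapping.lookup f m))"
proof (rule poly_mapping_eqI)
  fix k
  show "Poly_Mapping.lookup f k = Poly_Mapping.lookup (\<Sum>m\<in>Poly_Mapping.keys f. Poly_Mapping.single m (Poly_Mapping.lookup f m)) k"
    using in_keys_iff[of k f] by (simp add: lookup_sum lookup_single when_def sum.delta')
qed

text \<open>Two ring maps that agree on constants and variables agree everywhere, and the same induction proves
congruences \<open>f \<equiv> \<phi> f\<close> modulo an ideal for a ring map \<open>\<phi>\<close>.\<close>

lemma poly4_induct [case_names const var add mult]:
  assumes "\<And>c. P (const c)" "\<And>i. P (var i)"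
    "\<And>f g. P f \<Longrightarrow> P g \<Longrightarrow> P (f + g)" "\<And>f g. P f \<Longrightarrow> P g \<Longrightarrow> P (f * g)"
  shows "P f"
proof -
  have P0: "P 0" and P1: "P 1"
    using assms(1)[of 0] assms(1)[of 1] by (simp_all add: const_def)
  have pow: "P (var i ^ n)" for i n
    by (induction n) (auto intro: assms P1)
  have prod: "P (\<Prod>i\<in>A. var i ^ Poly_Mapping.lookup m i)" for A m
    by (induction A rule: infinite_finite_induct) (auto intro: assms P1 pow)
  have "P (\<Sum>m\<in>A. Poly_Mapping.single m (Poly_Mapping.lookup f m))" for A
    by (induction A rule: infinite_finite_induct)
      (auto intro: assms P0 prod simp: single_eq_monomial)
  then show ?thesis
    using poly4_eq_sum[of f] by metis
qed

text \<open>The universal property of the polynomial ring: \<open>\<kappa>\<close> prescribes the images of the constants and \<open>x\<close>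
those of the variables.\<close>

definition subst :: "(complex \<Rightarrow> 'r::comm_ring_1) \<Rightarrow> (4 \<Rightarrow> 'r) \<Rightarrow> poly4 \<Rightarrow> 'r"
  where "subst \<kappa> x f = (\<Sum>m\<in>Poly_Mapping.keys f. \<kappa> (Poly_Mapping.lookup f m) * (\<Prod>i\<in>UNIV. x i ^ Poly_Mapping.lookup m i))"

context
  fixes \<kappa> :: "complex \<Rightarrow> 'r::comm_ring_1" and x :: "4 \<Rightarrow> 'r"
  assumes \<kappa>: "ring_map \<kappa>"
begin

private lemma subst_superset:
  assumes "finite K" "Poly_Mapping.keys f \<subseteq> K"
  shows "subst \<kappa> x f = (\<Sum>m\<in>K. \<kappa> (Poly_Mapping.lookup f m) * (\<Prod>i\<in>UNIV. x i ^ Poly_Mapping.lookup m i))"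
  unfolding subst_def using assms
  by (intro sum.mono_neutral_left) (auto simp: in_keys_iff ring_map_simps[OF \<kappa>])

private lemma subst_add: "subst \<kappa> x (f + g) = subst \<kappa> x f + subst \<kappa> x g"
proof -
  let ?K = "Poly_Mapping.keys f \<union> Poly_Mapping.keys g"
  have "finite ?K" "Poly_Mapping.keys f \<subseteq> ?K" "Poly_Mapping.keys g \<subseteq> ?K" "Poly_Mapping.keys (f + g) \<subseteq> ?K"
    using Poly_Mapping.keys_add[of f g] by auto
  then show ?thesis
    by (simp add: subst_superset[of ?K] lookup_add ring_map_simps[OF \<kappa>] distrib_right sum.distrib)
qed

private lemma subst_sum: "subst \<kappa> x (sum g A) = (\<Sum>a\<in>A. subst \<kappa> x (g a))"
proof (induction A rule: infinite_finite_induct)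
  case (insert a A)
  then show ?case by (simp add: subst_add)
qed (simp_all add: subst_def)

private lemma subst_single:
  "subst \<kappa> x (Poly_Mapping.single m c) = \<kappa> c * (\<Prod>i\<in>UNIV. x i ^ Poly_Mapping.lookup m i)"
  by (simp add: subst_def ring_map_simps[OF \<kappa>])

lemma ring_map_subst: "ring_map (subst \<kappa> x)"
proof -
  have "subst \<kappa> x (f * g) = subst \<kappa> x f * subst \<kappa> x g" for f g
  proof -
    let ?s = "\<lambda>f m. Poly_Mapping.single m (Poly_Mapping.lookup f m)"
    have "subst \<kappa> x (f * g) = subst \<kappa> x (\<Sum>m\<in>Poly_Mapping.keys f. \<Sum>n\<in>Poly_Mapping.keys g. ?s f m * ?s g n)"
      using arg_cong2[where f = "(*)", OF poly4_eq_sum[of f] poly4_eq_sum[of g]] by (simp only: sum_product)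
    also have "\<dots> = (\<Sum>m\<in>Poly_Mapping.keys f. \<Sum>n\<in>Poly_Mapping.keys g. subst \<kappa> x (?s f m) * subst \<kappa> x (?s g n))"
      by (simp add: subst_sum mult_single subst_single ring_map_simps[OF \<kappa>] lookup_add power_add
          prod.distrib ac_simps)
    also have "\<dots> = (\<Sum>m\<in>Poly_Mapping.keys f. subst \<kappa> x (?s f m)) * (\<Sum>n\<in>Poly_Mapping.keys g. subst \<kappa> x (?s g n))"
      by (simp add: sum_product)
    also have "\<dots> = subst \<kappa> x f * subst \<kappa> x g"
      by (simp only: subst_sum[symmetric] poly4_eq_sum[symmetric])
    finally show ?thesis .
  qed
  moreover have "subst \<kappa> x 1 = 1"
    using subst_single[of 0 1] by (simp add: ring_map_simps[OF \<kappa>])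
  ultimately show ?thesis
    by (simp add: ring_map_def subst_add)
qed

lemma subst_const: "subst \<kappa> x (const c) = \<kappa> c"
  by (simp add: const_def subst_single)

lemma subst_var: "subst \<kappa> x (var i) = x i"
proof -
  have "(\<Prod>j\<in>UNIV. x j ^ Poly_Mapping.lookup (Poly_Mapping.single i 1) j) = (\<Prod>j\<in>UNIV. if j = i then x i else 1)"
    by (rule prod.cong) (auto simp: lookup_single)
  then show ?thesis
    by (simp add: var_def subst_single ring_map_simps[OF \<kappa>])
qed

lemma subst_power_sum: "subst \<kappa> x (power_sum n) = (\<Sum>i\<in>UNIV. x i ^ n)"
  by (simp add: power_sum_def ring_map_sum[OF ring_map_subst] ring_map_simps[OF ring_map_subst] subst_var)

end

lemma poly4_hom_eqI:
  assumes "ring_map \<phi>" "ring_map \<psi>" "\<And>c. \<phi> (const c) = \<psi> (const c)" "\<And>i. \<phi> (var i) = \<psi> (var i)"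
  shows "\<phi> f = \<psi> f"
  by (induction f rule: poly4_induct) (simp_all add: assms ring_map_simps)

text \<open>The grading in the guise of the ring map \<open>f \<mapsto> f(t x\<^sub>0, \<dots>, t x\<^sub>3)\<close> into polynomials in \<open>t\<close>: the coefficient
of \<open>t ^ d\<close> is the homogeneous component of degree \<open>d\<close>. The product formula for components is then the one
for coefficients.\<close>

definition grade :: "poly4 \<Rightarrow> poly4 poly"
  where "grade = subst (\<lambda>c. [:const c:]) (\<lambda>i. monom (var i) 1)"

definition hcomp :: "nat \<Rightarrow> poly4 \<Rightarrow> poly4"
  where "hcomp d f = coeff (grade f) d"

lemma ring_map_grade: "ring_map grade"
  unfolding grade_def by (intro ring_map_subst ring_map_const_poly ring_map_const)

lemma grade_const: "grade (const c) = monom (const c) 0"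
  unfolding grade_def by (simp add: subst_const ring_map_const_poly ring_map_const monom_0)

lemma grade_var: "grade (var i) = monom (var i) 1"
  unfolding grade_def by (simp add: subst_var ring_map_const_poly ring_map_const)

lemma hcomp_add: "hcomp d (f + g) = hcomp d f + hcomp d g"
  and hcomp_diff: "hcomp d (f - g) = hcomp d f - hcomp d g"
  and hcomp_zero: "hcomp d 0 = 0"
  by (simp_all add: hcomp_def ring_map_simps[OF ring_map_grade])

lemma hcomp_mult: "hcomp d (f * g) = (\<Sum>i\<le>d. hcomp i f * hcomp (d - i) g)"
  by (simp add: hcomp_def ring_map_simps[OF ring_map_grade] coeff_mult)

lemma hcomp_sum: "hcomp d (sum f A) = (\<Sum>x\<in>A. hcomp d (f x))"
  by (simp add: hcomp_def ring_map_sum[OF ring_map_grade] coeff_sum)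

lemma grade_hcomp: "grade (hcomp d f) = monom (hcomp d f) d"
proof (induction f arbitrary: d rule: poly4_induct)
  case (mult f g)
  have "grade (hcomp d (f * g)) = (\<Sum>i\<le>d. monom (hcomp i f) i * monom (hcomp (d - i) g) (d - i))"
    by (simp add: hcomp_mult ring_map_sum[OF ring_map_grade] ring_map_simps[OF ring_map_grade] mult)
  also have "\<dots> = (\<Sum>i\<le>d. monom (hcomp i f * hcomp (d - i) g) d)"
    by (intro sum.cong) (simp_all add: mult_monom)
  finally show ?case
    by (simp add: hcomp_mult monom_sum)
qed (simp_all add: hcomp_def grade_const grade_var ring_map_simps[OF ring_map_grade] add_monom)

lemma hcomp_hcomp: "hcomp d (hcomp e f) = (if d = e then hcomp e f else 0)"
  using grade_hcomp[of e f] by (simp add: hcomp_def)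

lemma hcomp_hcomp_mult: "hcomp d (hcomp e f * g) = (if e \<le> d then hcomp e f * hcomp (d - e) g else 0)"
  unfolding hcomp_def[of d] ring_map_simps[OF ring_map_grade] grade_hcomp coeff_monom_mult
  by (simp add: hcomp_def)

lemma hcomp_const: "hcomp d (const c) = (if d = 0 then const c else 0)"
  by (simp add: hcomp_def grade_const)

lemma hcomp_var_power: "hcomp d (var i ^ n) = (if d = n then var i ^ n else 0)"
  by (simp add: hcomp_def ring_map_simps[OF ring_map_grade] grade_var monom_power)

lemma hcomp_0: "\<exists>c. hcomp 0 f = const c"
proof (induction f rule: poly4_induct)
  case (var i)
  then show ?case
    using hcomp_var_power[of 0 i 1] by (auto intro: exI[of _ 0] simp: const_def)
next
  case (add f g)
  then show ?case using ring_map_simps(2)[OF ring_map_const] by (metis hcomp_add)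
next
  case (mult f g)
  then show ?case using ring_map_simps(3)[OF ring_map_const] by (auto simp: hcomp_mult) metis
qed (auto simp: hcomp_const)

lemma sum_hcomp:
  assumes "degree (grade f) \<le> n"
  shows "(\<Sum>d\<le>n. hcomp d f) = f"
proof -
  have "poly (grade f) 1 = f"
    using poly4_hom_eqI[of "\<lambda>f. poly (grade f) 1" "\<lambda>f. f"] ring_map_grade
    by (simp add: ring_map_def grade_const grade_var poly_monom)
  then show ?thesis
    using poly_altdef[of "grade f" 1] assms
      sum.mono_neutral_left[of "{..n}" "{..degree (grade f)}" "\<lambda>d. hcomp d f"]
    by (simp add: hcomp_def coeff_eq_0)
qed

lemma hcomp_eq_0: "degree (grade f) < d \<Longrightarrow> hcomp d f = 0"
  by (simp add: hcomp_def coeff_eq_0)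

lemma hcomp_power_sum: "hcomp d (power_sum n) = (if d = n then power_sum n else 0)"
  by (simp add: power_sum_def hcomp_sum hcomp_var_power)

definition homogeneous_ideal :: "poly4 set \<Rightarrow> bool"
  where "homogeneous_ideal I \<longleftrightarrow> is_ideal I \<and> (\<forall>f\<in>I. \<forall>d. hcomp d f \<in> I)"

lemma mem_of_comps:
  assumes "is_ideal I" "\<And>d. hcomp d f \<in> I"
  shows "f \<in> I"
  using idl.subspace_sum[OF assms(1), of "{..degree (grade f)}" "\<lambda>d. hcomp d f"] assms(2)
    sum_hcomp[of f] by auto

definition ev :: "(4 \<Rightarrow> complex) \<Rightarrow> poly4 \<Rightarrow> complex"
  where "ev p = subst (\<lambda>c. c) p"

text \<open>The restriction of a polynomial to the line through the origin and \<open>p\<close>, as a polynomial in the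
parameter of the line. Its kernel is the homogeneous prime ideal of the projective point \<open>p\<close>.\<close>

definition line :: "(4 \<Rightarrow> complex) \<Rightarrow> poly4 \<Rightarrow> complex poly"
  where "line p = subst (\<lambda>c. [:c:]) (\<lambda>i. [:0, p i:])"

lemma ring_map_ev: "ring_map (ev p)"
  unfolding ev_def by (intro ring_map_subst ring_map_id)

lemma ev_const: "ev p (const c) = c" and ev_var: "ev p (var i) = p i"
  and ev_power_sum: "ev p (power_sum n) = (\<Sum>i\<in>UNIV. p i ^ n)"
  unfolding ev_def
  by (simp_all add: subst_const[OF ring_map_id] subst_var[OF ring_map_id] subst_power_sum[OF ring_map_id])

lemma ring_map_line: "ring_map (line p)"
  unfolding line_def by (intro ring_map_subst ring_map_const_poly ring_map_id)

lemma line_const: "line p (const c) = [:c:]" and line_var: "line p (var i) = [:0, p i:]"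
  unfolding line_def
  by (simp_all add: subst_const[OF ring_map_const_poly[OF ring_map_id]]
      subst_var[OF ring_map_const_poly[OF ring_map_id]])

lemma coeff_line: "coeff (line p f) d = ev p (hcomp d f)"
proof (induction f arbitrary: d rule: poly4_induct)
  case (const c)
  then show ?case
    by (cases d) (simp_all add: line_const hcomp_const ev_const ring_map_simps[OF ring_map_ev])
next
  case (var i)
  then show ?case
    using hcomp_var_power[of d i 1]
    by (auto simp: line_var ev_var ring_map_simps[OF ring_map_ev] coeff_pCons split: nat.split)
next
  case (add f g)
  then show ?case
    by (simp add: hcomp_add ring_map_simps[OF ring_map_ev] ring_map_simps[OF ring_map_line])
next
  case (mult f g)
  then show ?case
    by (simp add: hcomp_mult ring_map_sum[OF ring_map_ev] ring_map_simps[OF ring_map_ev]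
        ring_map_simps[OF ring_map_line] coeff_mult)
qed

lemma poly_line: "poly (line p f) t = ev (\<lambda>i. t * p i) f"
  by (rule poly4_hom_eqI) (simp_all add: ring_map_def ring_map_simps[OF ring_map_line]
      ring_map_simps[OF ring_map_ev] line_const line_var ev_const ev_var)

lemma hcomp_var: "hcomp d (var i) = (if d = 1 then var i else 0)"
  using hcomp_var_power[of d i 1] by simp

lemma hcomp_const_mult_var: "hcomp 1 (const c * var i) = const c * var i"
  using hcomp_hcomp_mult[of 1 0 "const c" "var i"] by (simp add: hcomp_const hcomp_var)

lemma hcomp_one: "hcomp d 1 = (if d = 0 then 1 else 0)"
  using hcomp_const[of d 1] by (simp add: ring_map_simps[OF ring_map_const])

lemma const_inverse: "c \<noteq> 0 \<Longrightarrow> const (1 / c) * const c = 1"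
  using ring_map_simps(1)[OF ring_map_const] by (simp flip: ring_map_simps(3)[OF ring_map_const])

text \<open>The polynomial ring is the image of the ring of polynomials in one variable, iterated four times.\<close>

lemma noetherian_poly4: "noetherian TYPE(poly4)"
proof -
  define \<sigma> where "\<sigma> = poly_ev (poly_ev (poly_ev (poly_ev const (var 0)) (var 1)) (var 2)) (var 3)"
  note h0 = ring_map_const
  note h1 = ring_map_poly_ev[OF h0, of "var 0"]
  note h2 = ring_map_poly_ev[OF h1, of "var 1"]
  note h3 = ring_map_poly_ev[OF h2, of "var 2"]
  have h: "ring_map \<sigma>"
    unfolding \<sigma>_def by (rule ring_map_poly_ev[OF h3])
  note simps = poly_ev_0 poly_ev_pCons[OF h0] poly_ev_pCons[OF h1] poly_ev_pCons[OF h2]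
    poly_ev_pCons[OF h3] ring_map_simps(1,4)[OF h0] ring_map_simps(1,4)[OF h1]
    ring_map_simps(1,4)[OF h2] ring_map_simps(1,4)[OF h3]
  have "\<exists>p. \<sigma> p = f" for f
  proof (induction f rule: poly4_induct)
    case (const c)
    have "\<sigma> [:[:[:[:c:]:]:]:] = const c"
      by (simp add: \<sigma>_def simps)
    then show ?case by blast
  next
    case (var i)
    have "\<sigma> [:[:[:[:0, 1:]:]:]:] = var 0" "\<sigma> [:[:[:0, 1:]:]:] = var 1"
      "\<sigma> [:[:0, 1:]:] = var 2" "\<sigma> [:0, 1:] = var 3"
      by (simp_all add: \<sigma>_def simps)
    then show ?case
      using exhaust_index4[of i] by fast
  next
    case (add f g)
    then show ?case by (metis ring_map_simps(2)[OF h])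
  next
    case (mult f g)
    then show ?case by (metis ring_map_simps(3)[OF h])
  qed
  then have "surj \<sigma>"
    by (metis surjI)
  moreover have "noetherian TYPE(complex poly poly poly poly)"
    by (intro Hilbert_basis noetherian_field)
  ultimately show ?thesis
    using noetherian_image[of \<sigma>] ring_map_simps[OF h] by blast
qed

section \<open>Hilbert's Nullstellensatz\<close>

lemma uncountable_fibre:
  fixes f :: "complex \<Rightarrow> 'b"
  assumes "countable (range f)"
  shows "\<exists>y. infinite {x. f x = y}"
proof (rule ccontr)
  assume "\<not> ?thesis"
  then have "countable (\<Union>y\<in>range f. {x. f x = y})"
    using assms by (intro countable_UN) (auto intro: countable_finite)
  moreover have "(\<Union>y\<in>range f. {x. f x = y}) = UNIV"
    by auto
  ultimately show False
    using uncountable_UNIV_complex by simp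
qed

lemma countable_exponents: "countable (UNIV :: (4 \<Rightarrow>\<^sub>0 nat) set)"
proof -
  have "inj (\<lambda>m :: 4 \<Rightarrow>\<^sub>0 nat. map (Poly_Mapping.lookup m) [0, 1, 2, 3])"
  proof (rule injI, rule poly_mapping_eqI)
    fix m n :: "4 \<Rightarrow>\<^sub>0 nat" and i
    assume "map (Poly_Mapping.lookup m) [0, 1, 2, 3] = map (Poly_Mapping.lookup n) [0, 1, 2, 3]"
    then show "Poly_Mapping.lookup m i = Poly_Mapping.lookup n i"
      using exhaust_index4[of i] by auto
  qed
  then show ?thesis
    by (rule countableI')
qed

text \<open>If the ideal became trivial for every \<open>c\<close>, each \<open>var i - const c\<close> would have an inverse \<open>q\<^sub>c\<close> modulo \<open>J\<close>.
There are uncountably many \<open>c\<close> but only countably many finite sets of monomials, so infinitely many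
of the distinct polynomials \<open>q\<^sub>c\<close> involve the same monomials, and finitely many of them are linearly
dependent. Clearing denominators in the dependency yields a nonzero polynomial \<open>g\<close> in the single variable
\<open>var i\<close> that lies in \<open>J\<close>. But \<open>g\<close> is a product of linear factors, and these are units modulo \<open>J\<close>.\<close>

lemma specialize_variable:
  fixes J :: "poly4 set"
  assumes J: "is_ideal J" "1 \<notin> J"
  shows "\<exists>c. 1 \<notin> ideal_span (insert (var i - const c) J)"
proof (rule ccontr)
  assume "\<not> ?thesis"
  then have "\<exists>q. 1 - q * (var i - const c) \<in> J" for c
    by (simp add: ideal_span_insert[OF J(1)])
  then obtain q where q: "\<And>c. 1 - q c * (var i - const c) \<in> J"
    by metis
  have const_unit: "const c \<notin> J" if "c \<noteq> 0" for c
    using idl.subspace_scale[OF J(1), of "const c" "const (1 / c)"] const_inverse[OF that] J(2) by auto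
  have "q c \<noteq> q d" if "c \<noteq> d" for c d
  proof
    assume eq: "q c = q d"
    have "(1 - q d * (var i - const d)) - (1 - q c * (var i - const c)) = const (d - c) * q c"
      by (simp add: eq algebra_simps ring_map_simps[OF ring_map_const])
    then have "const (d - c) * q c \<in> J"
      using idl.subspace_diff[OF J(1) q q] by metis
    then have "const (1 / (d - c)) * (const (d - c) * q c) \<in> J"
      by (rule idl.subspace_scale[OF J(1)])
    moreover have "const (1 / (d - c)) * const (d - c) = 1"
      using that by (intro const_inverse) simp
    ultimately have "q c \<in> J"
      by (simp only: mult.assoc[symmetric] mult_1)
    then have "1 - q c * (var i - const c) + q c * (var i - const c) \<in> J"
      using idl.subspace_add[OF J(1) q] ideal_mult_right[OF J(1)] by blast
    then show False using J(2) by simp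
  qed
  then have inj: "inj q"
    by (auto simp: inj_def)
  define \<sigma> where "\<sigma> = poly_ev const (var i)"
  have hom: "ring_map \<sigma>"
    unfolding \<sigma>_def by (intro ring_map_poly_ev ring_map_const)
  note \<sigma>_simps = ring_map_simps[OF hom]
  have \<sigma>_const: "\<sigma> [:c:] = const c" and \<sigma>_lin: "\<sigma> [:- c, 1:] = var i - const c" for c
    by (simp_all add: \<sigma>_def poly_ev_pCons[OF ring_map_const] poly_ev_0 ring_map_simps[OF ring_map_const])
  have cancel: "f \<in> J" if "(var i - const c) * f \<in> J" for f c
  proof -
    have "f = f * (1 - q c * (var i - const c)) + q c * ((var i - const c) * f)"
      by (simp add: algebra_simps)
    then show ?thesis
      using ideal_lincomb2[OF J(1) q that] by metis
  qed
  have nonzero: "\<sigma> g \<notin> J" if "g \<noteq> 0" for g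
    using that
  proof (induction "degree g" arbitrary: g)
    case 0
    then obtain c where "g = [:c:]" "c \<noteq> 0"
      by (metis degree_eq_zeroE pCons_eq_0_iff)
    then show ?case using const_unit by (simp add: \<sigma>_const)
  next
    case (Suc n)
    then have "\<not> constant (poly g)"
      by (simp add: constant_degree)
    then obtain c where "poly g c = 0"
      using fundamental_theorem_of_algebra by blast
    then obtain g' where g': "g = [:- c, 1:] * g'"
      by (metis dvdE poly_eq_0_iff_dvd)
    then have "g' \<noteq> 0"
      using Suc.prems by auto
    then have "degree g = Suc (degree g')"
      unfolding g' by (subst degree_mult_eq) auto
    then have "\<sigma> g' \<notin> J"
      using Suc.hyps \<open>g' \<noteq> 0\<close> by simp
    then show ?case
      unfolding g' using cancel by (auto simp only: \<sigma>_simps \<sigma>_lin)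
  qed
  have "countable (range (\<lambda>c. Poly_Mapping.keys (q c)))"
    by (rule countable_subset[OF _ countable_Collect_finite_subset[OF countable_exponents]]) auto
  from uncountable_fibre[OF this] obtain K where K: "infinite {c. Poly_Mapping.keys (q c) = K}"
    by blast
  interpret V: vector_space "\<lambda>c f. const c * f"
    by standard (auto simp: algebra_simps ring_map_simps[OF ring_map_const])
  define A where "A = {c. Poly_Mapping.keys (q c) = K}"
  have "finite K"
    using K by (metis (mono_tags, lifting) Collect_empty_eq finite.emptyI finite_keys)
  have "q ` A \<subseteq> V.span ((\<lambda>m. Poly_Mapping.single m 1) ` K)"
  proof clarify
    fix c assume "c \<in> A"
    then have keys: "Poly_Mapping.keys (q c) = K"
      by (simp add: A_def)
    have "q c = (\<Sum>m\<in>K. const (Poly_Mapping.lookup (q c) m) * Poly_Mapping.single m 1)"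
      using poly4_eq_sum[of "q c"] by (simp add: keys const_def mult_single)
    also have "\<dots> \<in> V.span ((\<lambda>m. Poly_Mapping.single m 1) ` K)"
      by (intro V.span_sum V.span_scale V.span_base imageI)
    finally show "q c \<in> V.span ((\<lambda>m. Poly_Mapping.single m 1) ` K)" .
  qed
  moreover have "infinite (q ` A)"
    using K inj finite_imageD[of q A] by (auto simp: A_def inj_on_def inj_def)
  ultimately have "V.dependent (q ` A)"
    using V.independent_span_bound[of "(\<lambda>m. Poly_Mapping.single m 1) ` K" "q ` A"] \<open>finite K\<close> by blast
  then obtain t u v where t: "finite t" "t \<subseteq> q ` A" "(\<Sum>w\<in>t. const (u w) * w) = 0"
    and v: "v \<in> t" "u v \<noteq> 0"
    unfolding V.dependent_explicit by blast
  define B where "B = q -` t"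
  have "finite B"
    unfolding B_def using t(1) inj by (rule finite_vimageI)
  have tB: "t = q ` B"
    using t(2) by (auto simp: B_def)
  obtain d where d: "d \<in> B" "u (q d) \<noteq> 0"
    using v by (auto simp: tB)
  have rel: "(\<Sum>c\<in>B. const (u (q c)) * q c) = 0"
    using t(3) inj unfolding tB by (subst (asm) sum.reindex) (auto simp: inj_on_def inj_def)
  \<comment> \<open>The linear dependency of the inverses, multiplied by all the linear factors.\<close>
  define g where "g = (\<Sum>c\<in>B. [:u (q c):] * (\<Prod>e\<in>B - {c}. [:- e, 1:]))"
  have "poly g d = (\<Sum>c\<in>B. u (q c) * (\<Prod>e\<in>B - {c}. d - e))"
    by (simp add: g_def poly_sum poly_prod)
  also have "\<dots> = (\<Sum>c\<in>B. if c = d then u (q d) * (\<Prod>e\<in>B - {d}. d - e) else 0)"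
    using \<open>finite B\<close> d(1) by (intro sum.cong) auto
  also have "\<dots> \<noteq> 0"
    using \<open>finite B\<close> d by simp
  finally have "g \<noteq> 0"
    by auto
  have \<sigma>_prod: "\<sigma> (\<Prod>e\<in>C. [:- e, 1:]) = (\<Prod>e\<in>C. var i - const e)" for C
    by (induction C rule: infinite_finite_induct) (simp_all only: prod.infinite prod.empty prod.insert \<sigma>_simps \<sigma>_lin not_False_eq_True)
  let ?\<Pi> = "\<Prod>e\<in>B. var i - const e"
  have "\<sigma> g = (\<Sum>c\<in>B. const (u (q c)) * (\<Prod>e\<in>B - {c}. var i - const e))"
    by (simp only: g_def ring_map_sum[OF hom] \<sigma>_simps \<sigma>_const \<sigma>_prod)
  also have "\<dots> = (\<Sum>c\<in>B. const (u (q c)) * (\<Prod>e\<in>B - {c}. var i - const e)) - ?\<Pi> * (\<Sum>c\<in>B. const (u (q c)) * q c)"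
    by (simp add: rel)
  also have "\<dots> = (\<Sum>c\<in>B. const (u (q c)) * (\<Prod>e\<in>B - {c}. var i - const e) * (1 - q c * (var i - const c)))"
    unfolding sum_distrib_left sum_subtractf[symmetric]
  proof (intro sum.cong refl)
    fix c assume "c \<in> B"
    then have split: "?\<Pi> = (var i - const c) * (\<Prod>e\<in>B - {c}. var i - const e)"
      using \<open>finite B\<close> by (simp add: prod.remove)
    show "const (u (q c)) * (\<Prod>e\<in>B - {c}. var i - const e) - ?\<Pi> * (const (u (q c)) * q c)
      = const (u (q c)) * (\<Prod>e\<in>B - {c}. var i - const e) * (1 - q c * (var i - const c))"
      unfolding split by (simp add: algebra_simps)
  qed
  also have "\<dots> \<in> J"
    by (intro idl.subspace_sum[OF J(1)] idl.subspace_scale[OF J(1)] q)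
  finally show False
    using nonzero[OF \<open>g \<noteq> 0\<close>] by blast
qed

text \<open>Specializing the variables one after the other leads to a proper ideal that contains all
\<open>var i - const (p i)\<close>, modulo which every polynomial is congruent to its value at \<open>p\<close>.\<close>

theorem weak_nullstellensatz:
  fixes J :: "poly4 set"
  assumes J: "is_ideal J" "1 \<notin> J"
  shows "\<exists>p. \<forall>f\<in>J. ev p f = 0"
proof -
  have "\<exists>I p. is_ideal I \<and> J \<subseteq> I \<and> 1 \<notin> I \<and> (\<forall>i\<in>A. var i - const (p i) \<in> I)" if "finite A" for A :: "4 set"
    using that
  proof induction
    case empty
    then show ?case using J by blast
  next
    case (insert j A)
    then obtain I p where I: "is_ideal I" "J \<subseteq> I" "1 \<notin> I" "\<forall>i\<in>A. var i - const (p i) \<in> I"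
      by blast
    obtain c where c: "1 \<notin> ideal_span (insert (var j - const c) I)"
      using specialize_variable[OF I(1,3)] by blast
    let ?I = "ideal_span (insert (var j - const c) I)"
    have "I \<subseteq> ?I" "var j - const c \<in> ?I"
      using idl.span_superset by blast+
    then have "\<forall>i\<in>insert j A. var i - const ((p(j := c)) i) \<in> ?I" "J \<subseteq> ?I"
      using I(2,4) insert.hyps by auto
    then show ?case
      using c idl.subspace_span by blast
  qed
  from this[of UNIV] obtain I p where I: "is_ideal I" "J \<subseteq> I" "1 \<notin> I"
    and p: "\<And>i. var i - const (p i) \<in> I"
    by auto
  have cong: "f - const (ev p f) \<in> I" for f
  proof (induction f rule: poly4_induct)
    case (const c)
    then show ?case using idl.subspace_0[OF I(1)] by (simp add: ev_const)
  next
    case (var i)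
    then show ?case using p by (simp add: ev_var)
  next
    case (add f g)
    then show ?case
      using idl.subspace_add[OF I(1) add]
      by (simp add: ring_map_simps[OF ring_map_ev] ring_map_simps[OF ring_map_const] algebra_simps)
  next
    case (mult f g)
    then show ?case
      using ideal_lincomb2[OF I(1) mult, of g "const (ev p f)"]
      by (simp add: ring_map_simps[OF ring_map_ev] ring_map_simps[OF ring_map_const] algebra_simps)
  qed
  have "ev p f = 0" if "f \<in> J" for f
  proof (rule ccontr)
    assume nz: "ev p f \<noteq> 0"
    have "const (ev p f) \<in> I"
      using ideal_diff_cong[OF I(1) cong] that I(2) by blast
    then have "const (1 / ev p f) * const (ev p f) \<in> I"
      by (rule idl.subspace_scale[OF I(1)])
    with nz I(3) show False
      by (simp add: const_inverse)
  qed
  then show ?thesis by blast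
qed

text \<open>On the affine chart where the variable \<open>k\<close> is 1, the ideal stays proper: if \<open>1 - g (var k - 1)\<close> lies in \<open>I\<close>,
comparing homogeneous components shows that the component of degree \<open>d\<close> of \<open>g\<close> is \<open>- var k ^ d\<close>
modulo \<open>I\<close>, and \<open>g\<close> has only finitely many components. A zero on the chart gives a line of zeros
because \<open>I\<close> is homogeneous.\<close>

theorem homogeneous_nullstellensatz:
  assumes I: "homogeneous_ideal I" and pow: "\<And>N. var k ^ N \<notin> I"
  shows "\<exists>p. p k = 1 \<and> (\<forall>f\<in>I. line p f = 0)"
proof -
  have idl: "is_ideal I" and hI: "\<And>f d. f \<in> I \<Longrightarrow> hcomp d f \<in> I"
    using I by (auto simp: homogeneous_ideal_def)
  have "1 \<notin> ideal_span (insert (var k - 1) I)"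
  proof
    assume "1 \<in> ideal_span (insert (var k - 1) I)"
    then obtain g where "1 - g * (var k - 1) \<in> I"
      by (auto simp: ideal_span_insert[OF idl])
    then have g: "hcomp d (1 - g * (var k - 1)) \<in> I" for d
      by (rule hI)
    have one: "hcomp d 1 = (if d = 0 then 1 else 0)" for d
      using hcomp_const[of d 1] by (simp add: ring_map_simps[OF ring_map_const])
    have vark: "hcomp d (var k * g) = (if d = 0 then 0 else var k * hcomp (d - 1) g)" for d
      using hcomp_hcomp_mult[of d 1 "var k" g] hcomp_var_power[of 1 k 1] by auto
    have comp: "hcomp d (1 - g * (var k - 1))
      = (if d = 0 then 1 + hcomp d g else hcomp d g - var k * hcomp (d - 1) g)" for d
    proof -
      have "1 - g * (var k - 1) = 1 + g - var k * g"
        by (simp add: algebra_simps)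
      then show ?thesis
        by (simp only: hcomp_add hcomp_diff one vark) simp
    qed
    have "hcomp d g + var k ^ d \<in> I" for d
    proof (induction d)
      case 0
      then show ?case using g[of 0] by (simp add: comp add.commute)
    next
      case (Suc d)
      have "hcomp (Suc d) g + var k ^ Suc d
        = 1 * (hcomp (Suc d) g - var k * hcomp d g) + var k * (hcomp d g + var k ^ d)"
        by (simp add: algebra_simps)
      also have "\<dots> \<in> I"
        using g[of "Suc d"] by (intro ideal_lincomb2 idl Suc) (simp add: comp)
      finally show ?case .
    qed
    from this[of "Suc (degree (grade g))"] show False
      using pow[of "Suc (degree (grade g))"] by (simp add: hcomp_eq_0)
  qed
  then obtain p where p: "\<forall>f\<in>ideal_span (insert (var k - 1) I). ev p f = 0"
    using weak_nullstellensatz[OF idl.subspace_span] by blast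
  then have pI: "ev p f = 0" if "f \<in> insert (var k - 1) I" for f
    using that idl.span_base by blast
  have "p k = 1"
    using pI[of "var k - 1"] by (simp add: ring_map_simps[OF ring_map_ev] ev_var)
  moreover have "line p f = 0" if "f \<in> I" for f
    by (rule poly_eqI) (simp add: coeff_line pI hI that)
  ultimately show ?thesis by blast
qed

section \<open>Roots of unity and valuations of exponents\<close>

lemma multiplicity_int_nat:
  fixes q n :: nat
  assumes "1 < q" "0 < n"
  shows "multiplicity (int q) (int n) = multiplicity q n"
proof (rule multiplicity_eqI)
  show "int q ^ multiplicity q n dvd int n"
    using multiplicity_dvd[of q n] by (metis int_dvd_int_iff of_nat_power)
  have "\<not> q ^ Suc (multiplicity q n) dvd n"
    using power_dvd_iff_le_multiplicity[of n q "Suc (multiplicity q n)"] assms by auto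
  then show "\<not> int q ^ Suc (multiplicity q n) dvd int n"
    by (metis int_dvd_int_iff of_nat_power)
qed

text \<open>The left-hand side is the condition that roots of unity of order dividing \<open>b - a\<close> lead to, the
right-hand side compares \<open>a\<close> with \<open>b\<close>. If \<open>b - a\<close> is divisible by a higher power of \<open>q\<close> than \<open>a\<close>, the
sum \<open>b\<close> has the valuation of \<open>a\<close>; and \<open>b - a\<close> is divisible by all common powers of \<open>q\<close>
in \<open>a\<close> and \<open>b\<close>.\<close>

lemma multiplicity_less_diff_iff:
  fixes q a b :: nat
  assumes q: "prime q" and ab: "0 < a" "a < b"
  shows "multiplicity q a < multiplicity q (b - a) \<longleftrightarrow>
    multiplicity q a = multiplicity q b \<and> multiplicity q b \<noteq> multiplicity q (b - a)"
proof -
  have le_iff: "n \<le> multiplicity q x \<longleftrightarrow> q ^ n dvd x" if "0 < x" for n x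
    using power_dvd_iff_le_multiplicity[of x q n] that prime_gt_1_nat[OF q] by simp
  have pos: "0 < a" "0 < b" "0 < b - a"
    using ab by auto
  have b: "b = a + (b - a)"
    using ab by simp
  show ?thesis
  proof
    assume lt: "multiplicity q a < multiplicity q (b - a)"
    have "q ^ multiplicity q a dvd b"
      by (subst b, rule dvd_add[OF multiplicity_dvd]) (use lt in \<open>simp flip: le_iff[OF pos(3)]\<close>)
    moreover have "\<not> q ^ Suc (multiplicity q a) dvd b"
    proof
      assume "q ^ Suc (multiplicity q a) dvd b"
      moreover have "q ^ Suc (multiplicity q a) dvd b - a"
        using lt le_iff[OF pos(3)] by (simp flip: Suc_le_eq)
      ultimately have "q ^ Suc (multiplicity q a) dvd a"
        using b by (metis dvd_add_left_iff)
      then show False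
        using le_iff[OF pos(1), of "Suc (multiplicity q a)"] by simp
    qed
    ultimately have "multiplicity q a = multiplicity q b"
      using le_iff[OF pos(2)] by (metis le_antisym not_less_eq_eq)
    then show "multiplicity q a = multiplicity q b \<and> multiplicity q b \<noteq> multiplicity q (b - a)"
      using lt by simp
  next
    assume eq: "multiplicity q a = multiplicity q b \<and> multiplicity q b \<noteq> multiplicity q (b - a)"
    have "q ^ multiplicity q a dvd b - a"
      using eq multiplicity_dvd[of q a] multiplicity_dvd[of q b] by (simp add: dvd_diff_nat)
    then show "multiplicity q a < multiplicity q (b - a)"
      using eq le_iff[OF pos(3)] by (metis le_neq_implies_less)
  qed
qed

text \<open>For the prime 2, equal valuations of \<open>a\<close> and \<open>b\<close> already suffice, as the difference of two odd numbers
is even.\<close>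

lemma multiplicity_2_less_diff_iff:
  fixes a b :: nat
  assumes ab: "0 < a" "a < b"
  shows "multiplicity 2 a < multiplicity 2 (b - a) \<longleftrightarrow> multiplicity 2 a = multiplicity 2 b"
proof -
  have "multiplicity 2 a < multiplicity 2 (b - a)" if eq: "multiplicity 2 a = multiplicity 2 b"
  proof -
    let ?v = "multiplicity 2 a"
    obtain x where x: "a = 2 ^ ?v * x" "odd x"
      using multiplicity_decompose'[of a 2] ab(1) by auto
    obtain y where y: "b = 2 ^ ?v * y" "odd y"
      using multiplicity_decompose'[of b 2] ab eq by auto
    have "b - a = 2 ^ ?v * (y - x)"
      using x(1) y(1) by (metis right_diff_distrib')
    moreover have "even (y - x)"
      using x y by simp
    ultimately have "2 ^ Suc ?v dvd b - a"
      by (simp add: mult_dvd_mono)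
    then show ?thesis
      using power_dvd_iff_le_multiplicity[of "b - a" 2 "Suc ?v"] ab by simp
  qed
  then show ?thesis
    using multiplicity_less_diff_iff[OF two_is_prime_nat ab] by auto
qed

text \<open>If \<open>d = q ^ m d'\<close> with \<open>d'\<close> prime to \<open>q\<close> and \<open>q ^ m\<close> divides \<open>a\<close>, then \<open>d\<close> divides \<open>a d'\<close>, so the order of
\<open>z ^ a\<close> divides both \<open>d'\<close> and \<open>q\<close>.\<close>

lemma root_of_unity_multiplicity:
  fixes z :: complex
  assumes q: "prime q" and pos: "0 < a" "0 < d" and z: "z ^ d = 1" "(z ^ a) ^ q = 1" "z ^ a \<noteq> 1"
  shows "multiplicity q a < multiplicity q d"
proof (rule ccontr)
  assume "\<not> ?thesis"
  then have "q ^ multiplicity q d dvd a"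
    using power_dvd_iff_le_multiplicity[of a q "multiplicity q d"] pos prime_gt_1_nat[OF q] by simp
  then obtain a' where a': "a = q ^ multiplicity q d * a'" ..
  obtain d' where d': "d = q ^ multiplicity q d * d'" "\<not> q dvd d'"
    using multiplicity_decompose'[of d q] pos prime_gt_1_nat[OF q] by auto
  have "a * d' = d * a'"
    using a' d'(1) by (metis mult.commute mult.assoc)
  then have "(z ^ a) ^ d' = (z ^ d) ^ a'"
    by (simp flip: power_mult)
  then have 1: "(z ^ a) ^ d' = 1"
    by (simp add: z)
  have "coprime d' q"
    using prime_imp_coprime[OF q d'(2)] by (simp add: coprime_commute)
  moreover have "q \<noteq> 1"
    using q by auto
  ultimately obtain x y where xy: "d' * x = q * y + 1"
    using coprime_bezout_strong by blast
  have "1 = ((z ^ a) ^ d') ^ x"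
    by (simp add: 1)
  also have "\<dots> = ((z ^ a) ^ q) ^ y * z ^ a"
    by (simp only: power_mult[symmetric] mult.assoc[symmetric] xy)
       (simp add: xy power_mult power_add distrib_left mult.assoc)
  finally show False
    using z by simp
qed

text \<open>Conversely, a primitive root of unity of order \<open>q ^ (m + 1)\<close> serves, where \<open>m\<close> is the valuation of \<open>a\<close>.\<close>

lemma exists_root_of_unity:
  fixes q a d :: nat
  assumes q: "prime q" and pos: "0 < a" "0 < d" and lt: "multiplicity q a < multiplicity q d"
  shows "\<exists>z :: complex. z ^ d = 1 \<and> (z ^ a) ^ q = 1 \<and> z ^ a \<noteq> 1"
proof -
  define n where "n = q ^ Suc (multiplicity q a)"
  define z where "z = exp (2 * of_real pi * \<i> * of_nat 1 / of_nat n)"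
  have n: "1 \<le> n"
    using prime_gt_0_nat[OF q] by (simp add: n_def)
  have z: "z ^ j = 1 \<longleftrightarrow> n dvd j" for j
  proof -
    have "z ^ j = exp (2 * of_real pi * \<i> * of_nat j / of_nat n)"
      by (simp add: z_def mult.commute flip: exp_of_nat_mult)
    then show ?thesis
      using complex_root_unity_eq_1[OF n, of j] by simp
  qed
  have le_iff: "q ^ m dvd x \<longleftrightarrow> m \<le> multiplicity q x" if "0 < x" for m x
    using power_dvd_iff_le_multiplicity[of x q m] that prime_gt_1_nat[OF q] by simp
  have "n dvd d" "\<not> n dvd a"
    using lt le_iff[OF pos(2)] le_iff[OF pos(1)] by (auto simp: n_def simp del: power_Suc)
  moreover have "n dvd a * q"
    unfolding n_def using multiplicity_dvd[of q a] by (simp add: mult.commute mult_dvd_mono)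
  ultimately show ?thesis
    using z by (metis power_mult)
qed

text \<open>The conjugate of a number of modulus one is its inverse, so the conjugate of the equation relates the
elementary symmetric functions of the nonzero summands. If there are four summands,
\<open>(1 + x) (1 + y) (1 + z)\<close> turns out to be the sum and hence zero; if there are three, they are the
cube roots of unity.\<close>

lemma unimodular_sum_zero:
  fixes x y z :: complex
  assumes unit: "\<And>w. w \<in> {x, y, z} \<Longrightarrow> w = 0 \<or> norm w = 1" and sum: "1 + x + y + z = 0"
  shows "-1 \<in> {x, y, z} \<or> 0 \<in> {x, y, z} \<and> (\<exists>w\<in>{x, y, z}. w\<^sup>2 + w + 1 = 0)"
proof -
  have cnj: "w * cnj w = 1" if "w \<in> {x, y, z}" "w \<noteq> 0" for w
    using unit[OF that(1)] that(2) by (simp add: complex_norm_square[symmetric])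
  have sum': "1 + cnj x + cnj y + cnj z = 0"
    using arg_cong[OF sum, of cnj] by simp
  have two: "u\<^sup>2 + u + 1 = 0" if "u * cnj u = 1" "v * cnj v = 1" "1 + u + v = 0" "1 + cnj u + cnj v = 0" for u v
  proof -
    have "u * v * (1 + cnj u + cnj v) = u * v + v * (u * cnj u) + u * (v * cnj v)"
      by (simp add: algebra_simps)
    then have "u * v + u + v = 0"
      using that by (simp add: ac_simps)
    moreover have "u\<^sup>2 + u + 1 = u * (1 + u + v) + (1 + u + v) - (u * v + u + v)"
      by (simp add: algebra_simps power2_eq_square)
    ultimately show ?thesis
      using that by simp
  qed
  show ?thesis
  proof (cases "0 \<in> {x, y, z}")
    case False
    have c: "x * cnj x = 1" "y * cnj y = 1" "z * cnj z = 1"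
      using cnj False by auto
    have "x * y * z * (1 + cnj x + cnj y + cnj z)
      = x * y * z + y * z * (x * cnj x) + x * z * (y * cnj y) + x * y * (z * cnj z)"
      by (simp add: algebra_simps)
    then have "x * y * z + y * z + x * z + x * y = 0"
      using c sum' by simp
    then have "(1 + x) * (1 + y) * (1 + z) = 1 + x + y + z"
      by (simp add: algebra_simps)
    then have "1 + x = 0 \<or> 1 + y = 0 \<or> 1 + z = 0"
      using sum by simp
    then show ?thesis
      by (auto simp: add_eq_0_iff)
  next
    case True
    have one: "u = - 1" if "1 + u = 0" for u :: complex
      using that by (simp add: add_eq_0_iff)
    consider "x = 0" "y = 0" | "x = 0" "z = 0" | "y = 0" "z = 0" | "x = 0" "y \<noteq> 0" "z \<noteq> 0"
      | "y = 0" "x \<noteq> 0" "z \<noteq> 0" | "z = 0" "x \<noteq> 0" "y \<noteq> 0"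
      using True by auto
    then show ?thesis
    proof cases
      case 4
      then show ?thesis using two[of y z] cnj sum sum' by auto
    next
      case 5
      then show ?thesis using two[of x z] cnj sum sum' by auto
    next
      case 6
      then show ?thesis using two[of x y] cnj sum sum' by auto
    qed (use sum one in auto)
  qed
qed

lemma no_common_zero_of_power_plus_one:
  fixes r :: complex
  assumes ab: "0 < a" "a < b" and v: "\<not> multiplicity 2 a < multiplicity 2 (b - a)"
  shows "\<not> (r ^ a + 1 = 0 \<and> r ^ b + 1 = 0)"
proof
  assume "r ^ a + 1 = 0 \<and> r ^ b + 1 = 0"
  then have r: "r ^ a = - 1" "r ^ b = - 1"
    by (simp_all add: eq_neg_iff_add_eq_0)
  have "r ^ b = r ^ a * r ^ (b - a)"
    using ab by (simp flip: power_add)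
  then have "r ^ (b - a) = 1"
    using r by simp
  then have "multiplicity 2 a < multiplicity 2 (b - a)"
    using root_of_unity_multiplicity[of 2 a "b - a" r] ab r(1) by simp
  with v show False ..
qed

text \<open>The Jacobian criterion on the chart \<open>p\<^sub>k = 1\<close>. By Euler's relation the column \<open>k\<close> of the Jacobian matrix is a
combination of the others, so if the minors avoiding it vanish, all minors vanish. Then every
nonzero \<open>p\<^sub>j\<close> is a root of unity of order dividing \<open>b - a\<close>, and the classification of vanishing sums of
the \<open>p\<^sub>j ^ a\<close> contradicts the assumptions on the valuations.\<close>

lemma smooth_point_minor:
  fixes p :: "4 \<Rightarrow> complex"
  assumes ab: "0 < a" "a < b" and v2: "\<not> multiplicity 2 a < multiplicity 2 (b - a)"
    and v3: "a = 1 \<or> \<not> multiplicity 3 a < multiplicity 3 (b - a)"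
    and p: "p k = 1" "(\<Sum>i\<in>UNIV. p i ^ a) = 0" "(\<Sum>i\<in>UNIV. p i ^ b) = 0"
  shows "\<exists>i j. i \<noteq> k \<and> j \<noteq> k \<and> i \<noteq> j \<and> p i ^ (a - 1) * p j ^ (b - 1) \<noteq> p j ^ (a - 1) * p i ^ (b - 1)"
proof (rule ccontr)
  assume "\<not> ?thesis"
  then have minor: "p i ^ (a - 1) * p j ^ (b - 1) = p j ^ (a - 1) * p i ^ (b - 1)" if "i \<noteq> k" "j \<noteq> k" for i j
    using that by (cases "i = j") auto
  have pw: "x * x ^ (n - 1) = x ^ n" if "0 < n" for x :: complex and n
    using that by (cases n) auto
  have col: "p j ^ (b - 1) = p j ^ (a - 1)" for j
  proof (cases "j = k")
    case False
    have "(\<Sum>i\<in>UNIV. p i * (p i ^ (a - 1) * p j ^ (b - 1) - p j ^ (a - 1) * p i ^ (b - 1)))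
      = p j ^ (b - 1) * (\<Sum>i\<in>UNIV. p i ^ a) - p j ^ (a - 1) * (\<Sum>i\<in>UNIV. p i ^ b)"
      unfolding sum_distrib_left sum_subtractf[symmetric]
    proof (rule sum.cong)
      fix i
      have "p i * (p i ^ (a - 1) * p j ^ (b - 1) - p j ^ (a - 1) * p i ^ (b - 1))
        = p j ^ (b - 1) * (p i * p i ^ (a - 1)) - p j ^ (a - 1) * (p i * p i ^ (b - 1))"
        by (simp add: algebra_simps)
      then show "p i * (p i ^ (a - 1) * p j ^ (b - 1) - p j ^ (a - 1) * p i ^ (b - 1))
        = p j ^ (b - 1) * p i ^ a - p j ^ (a - 1) * p i ^ b"
        using ab pw[of a "p i"] pw[of b "p i"] by simp
    qed simp
    also have "\<dots> = 0"
      by (simp add: p)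
    also have "(\<Sum>i\<in>UNIV. p i * (p i ^ (a - 1) * p j ^ (b - 1) - p j ^ (a - 1) * p i ^ (b - 1)))
      = (\<Sum>i\<in>UNIV. if i = k then p j ^ (b - 1) - p j ^ (a - 1) else 0)"
      using minor[OF _ False] by (intro sum.cong) (auto simp: p)
    finally show ?thesis by simp
  qed (simp add: p)
  have root: "p j ^ (b - a) = 1" if "p j \<noteq> 0" for j
  proof -
    have "p j ^ (b - 1) = p j ^ (a - 1) * p j ^ (b - a)"
      using ab by (simp flip: power_add)
    then show ?thesis
      using col[of j] that by simp
  qed
  have root_a1: "p j \<noteq> 0" if "a = 1" for j
    using col[of j] that ab by (auto simp: power_0_left)
  have norm: "p j ^ a = 0 \<or> norm (p j ^ a) = 1" for j
    using power_eq_1_iff[OF root, of j] ab by (cases "p j = 0") (auto simp: norm_power power_0_left)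
  obtain l where "l \<noteq> k"
    using index4_distinct(1) by metis
  then obtain i j where ij: "i \<noteq> j" "i \<noteq> k" "i \<noteq> l" "j \<noteq> k" "j \<noteq> l" and U: "UNIV = {k, l, i, j}"
    using index4_complement2[of k l] by auto
  have "1 + p l ^ a + p i ^ a + p j ^ a = 0"
    using p(2) ij \<open>l \<noteq> k\<close> by (simp add: U p(1) add.assoc)
  from unimodular_sum_zero[OF _ this] norm
  have cases: "-1 \<in> {p l ^ a, p i ^ a, p j ^ a} \<or> 0 \<in> {p l ^ a, p i ^ a, p j ^ a} \<and>
    (\<exists>w\<in>{p l ^ a, p i ^ a, p j ^ a}. w\<^sup>2 + w + 1 = 0)"
    by blast
  have no2: "p m ^ a \<noteq> - 1" for m
  proof
    assume m: "p m ^ a = - 1"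
    then have "p m \<noteq> 0"
      using ab by (auto simp: power_0_left)
    then show False
      using root_of_unity_multiplicity[of 2 a "b - a" "p m"] root[of m] ab m v2 by simp
  qed
  with cases obtain m n where m: "p m ^ a = 0" and n: "(p n ^ a)\<^sup>2 + p n ^ a + 1 = 0"
    by (metis insertE singletonD)
  have "a \<noteq> 1"
    using m root_a1[of m] by auto
  have "(p n ^ a) ^ 3 - 1 = (p n ^ a - 1) * ((p n ^ a)\<^sup>2 + p n ^ a + 1)"
    by (simp add: algebra_simps power2_eq_square power3_eq_cube)
  then have "(p n ^ a) ^ 3 = 1"
    by (simp add: n)
  moreover have "p n ^ a \<noteq> 1" "p n \<noteq> 0"
    using n ab by (auto simp: power_0_left)
  ultimately have "multiplicity 3 a < multiplicity 3 (b - a)"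
    using root_of_unity_multiplicity[of 3 a "b - a" "p n"] root[of n] ab by simp
  then show False
    using v3 \<open>a \<noteq> 1\<close> by blast
qed

section \<open>Regular sequences\<close>

text \<open>A common divisor \<open>d\<close> of \<open>F\<close> and \<open>G\<close> has a unit as leading coefficient because \<open>F\<close> is monic, so its degree
is preserved when the coefficients are specialized by \<open>\<epsilon>\<close>. As the specializations of \<open>F\<close> and \<open>G\<close> have no
common root, \<open>d\<close> is constant, and a unit. In a unique factorization domain the only syzygies
of two coprime elements are the trivial ones.\<close>

lemma monic_coprime_syzygy:
  fixes F G u v :: "'b::{factorial_ring_gcd,semiring_gcd_mult_normalize} poly" and \<epsilon> :: "'b \<Rightarrow> complex"
  assumes \<epsilon>: "ring_map \<epsilon>" and lc: "lead_coeff F = 1"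
    and no_root: "\<And>r. \<not> (poly_ev \<epsilon> r F = 0 \<and> poly_ev \<epsilon> r G = 0)"
    and rel: "u * F + v * G = 0"
  shows "\<exists>w. u = w * G \<and> v = - w * F"
proof -
  note ev = ring_map_simps[OF ring_map_poly_ev[OF \<epsilon>]]
  have "coprime F G"
  proof (rule coprimeI)
    fix d assume d: "d dvd F" "d dvd G"
    from d(1) obtain e where e: "F = d * e" ..
    have unit: "lead_coeff d * lead_coeff e = 1"
      using lc by (simp add: e lead_coeff_mult)
    have "\<epsilon> (lead_coeff d) * \<epsilon> (lead_coeff e) = 1"
      using arg_cong[OF unit, of \<epsilon>] by (simp add: ring_map_simps[OF \<epsilon>])
    then have "\<epsilon> (lead_coeff d) \<noteq> 0"
      by auto
    then have deg: "degree (map_poly \<epsilon> d) = degree d"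
      by (intro antisym degree_le le_degree)
        (simp_all add: coeff_map_poly ring_map_simps[OF \<epsilon>] coeff_eq_0)
    have "degree d = 0"
    proof (rule ccontr)
      assume "degree d \<noteq> 0"
      then have "\<not> constant (poly (map_poly \<epsilon> d))"
        by (simp add: constant_degree deg)
      then obtain r where r: "poly_ev \<epsilon> r d = 0"
        using fundamental_theorem_of_algebra unfolding poly_ev_def by blast
      have "poly_ev \<epsilon> r F = 0" "poly_ev \<epsilon> r G = 0"
        using d r by (auto elim!: dvdE simp: ev)
      with no_root show False by blast
    qed
    then obtain c where "d = [:c:]"
      by (metis degree_eq_zeroE)
    then have "1 = d * [:lead_coeff e:]"
      using unit by (simp add: one_pCons mult.commute)
    then show "is_unit d" ..
  qed
  moreover have "F dvd v * G"
    using rel by (metis add_eq_0_iff dvd_minus_iff dvd_triv_right)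
  ultimately have "F dvd v"
    by (simp add: coprime_dvd_mult_left_iff)
  then obtain w where w: "v = F * w" ..
  have "F * (u + w * G) = 0"
    using rel by (simp add: w algebra_simps)
  moreover have "F \<noteq> 0"
    using lc by auto
  ultimately have "u + w * G = 0"
    by simp
  then have "u = (- w) * G" "v = - (- w) * F"
    by (simp_all add: w eq_neg_iff_add_eq_0 mult.commute)
  then show ?thesis by blast
qed

text \<open>The ring modulo \<open>I\<close> is identified with the polynomials in \<open>var j\<close> over a unique factorization
domain: \<open>\<eta>\<close> gives the images of the other variables there, and \<open>\<sigma>\<close> lifts coefficients back. In
\<open>var j\<close> the power sums are monic, and \<open>\<epsilon>\<close> specializes them to \<open>r ^ a + 1\<close> and \<open>r ^ b + 1\<close>, which have no
common root.\<close>

lemma power_sum_syzygy: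
  fixes \<kappa> :: "complex \<Rightarrow> 'b::{factorial_ring_gcd,semiring_gcd_mult_normalize}" and \<eta> :: "4 \<Rightarrow> 'b"
    and \<sigma> :: "'b \<Rightarrow> poly4" and \<epsilon> :: "'b \<Rightarrow> complex"
  assumes ab: "0 < a" "a < b" and v2: "\<not> multiplicity 2 a < multiplicity 2 (b - a)"
    and hom: "ring_map \<kappa>" "ring_map \<sigma>" "ring_map \<epsilon>"
    and \<kappa>: "\<And>c. \<epsilon> (\<kappa> c) = c" "\<And>c. \<sigma> (\<kappa> c) = const c"
    and I: "is_ideal I"
    and \<eta>: "\<And>m. m \<noteq> j \<Longrightarrow> var m - \<sigma> (\<eta> m) \<in> I"
    and ker: "\<And>f. f \<in> I \<Longrightarrow> subst (\<lambda>c. [:\<kappa> c:]) (\<lambda>m. if m = j then [:0, 1:] else [:\<eta> m:]) f = 0"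
    and i: "i \<noteq> j" "\<And>m. m \<noteq> j \<Longrightarrow> \<epsilon> (\<eta> m) = (if m = i then 1 else 0)"
    and uv: "u * power_sum a + v * power_sum b \<in> I"
  shows "\<exists>w. u - w * power_sum b \<in> I \<and> v + w * power_sum a \<in> I"
proof -
  define \<theta> where "\<theta> = subst (\<lambda>c. [:\<kappa> c:]) (\<lambda>m. if m = j then [:0, 1:] else [:\<eta> m:])"
  have \<theta>: "ring_map \<theta>"
    unfolding \<theta>_def by (intro ring_map_subst ring_map_const_poly hom)
  have \<theta>_const: "\<theta> (const c) = [:\<kappa> c:]"
    and \<theta>_var: "\<theta> (var m) = (if m = j then [:0, 1:] else [:\<eta> m:])" for c m
    unfolding \<theta>_def using ring_map_const_poly[OF hom(1)] by (simp_all add: subst_const subst_var)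
  define s where "s = poly_ev \<sigma> (var j)"
  have s: "ring_map s"
    unfolding s_def by (intro ring_map_poly_ev hom)
  have s_simps: "s [:x:] = \<sigma> x" "s [:0, 1:] = var j" for x
    by (simp_all add: s_def poly_ev_pCons[OF hom(2)] poly_ev_0 ring_map_simps[OF hom(2)])
  have retract: "f - s (\<theta> f) \<in> I" for f
  proof (induction f rule: poly4_induct)
    case (const c)
    then show ?case
      using idl.subspace_0[OF I] by (simp add: \<theta>_const s_simps \<kappa>)
  next
    case (var m)
    then show ?case
      using idl.subspace_0[OF I] \<eta>[of m] by (simp add: \<theta>_var s_simps)
  next
    case (add f g)
    then show ?case
      using idl.subspace_add[OF I add]
      by (simp add: ring_map_simps[OF \<theta>] ring_map_simps[OF s] algebra_simps)
  next
    case (mult f g)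
    then show ?case
      using ideal_lincomb2[OF I mult, of g "s (\<theta> f)"]
      by (simp add: ring_map_simps[OF \<theta>] ring_map_simps[OF s] algebra_simps)
  qed
  have ev_eq: "poly_ev \<epsilon> r (\<theta> f) = ev (\<lambda>m. if m = j then r else if m = i then 1 else 0) f" for r f
    by (rule poly4_hom_eqI)
      (simp_all add: ring_map_def ring_map_simps[OF \<theta>] ring_map_simps[OF ring_map_poly_ev[OF hom(3)]]
        ring_map_simps[OF ring_map_ev] \<theta>_const \<theta>_var ev_const ev_var poly_ev_pCons[OF hom(3)]
        poly_ev_0 \<kappa> ring_map_simps[OF hom(3)] i)
  have ev_ps: "poly_ev \<epsilon> r (\<theta> (power_sum n)) = r ^ n + 1" if "0 < n" for r n
  proof -
    have "(\<Sum>m\<in>UNIV. (if m = j then r else if m = i then 1 else 0) ^ n)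
      = (\<Sum>m\<in>{i, j}. (if m = j then r else if m = i then 1 else 0) ^ n)"
      using that by (intro sum.mono_neutral_right) auto
    then show ?thesis
      using i(1) by (simp add: ev_eq ev_power_sum)
  qed
  have lc: "lead_coeff (\<theta> (power_sum a)) = 1"
  proof -
    have "\<theta> (power_sum a) = (\<Sum>m\<in>UNIV. \<theta> (var m) ^ a)"
      by (simp add: power_sum_def ring_map_sum[OF \<theta>] ring_map_simps[OF \<theta>])
    also have "\<dots> = \<theta> (var j) ^ a + (\<Sum>m\<in>UNIV - {j}. \<theta> (var m) ^ a)"
      by (rule sum.remove) auto
    also have "(\<Sum>m\<in>UNIV - {j}. \<theta> (var m) ^ a) = (\<Sum>m\<in>UNIV - {j}. [:\<eta> m ^ a:])"
      by (intro sum.cong) (auto simp: \<theta>_var poly_const_pow)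
    also have "\<dots> = [:\<Sum>m\<in>UNIV - {j}. \<eta> m ^ a:]"
      by (rule ring_map_sum[OF ring_map_const_poly[OF ring_map_id], symmetric])
    also have "\<theta> (var j) ^ a = monom 1 a"
      by (simp add: \<theta>_var monom_altdef)
    finally have eq: "\<theta> (power_sum a) = monom 1 a + [:\<Sum>m\<in>UNIV - {j}. \<eta> m ^ a:]" .
    then have "degree (\<theta> (power_sum a)) = a"
      using ab by (simp add: degree_add_eq_left degree_monom_eq)
    then show ?thesis
      using ab by (simp add: eq coeff_pCons split: nat.split)
  qed
  have "\<theta> u * \<theta> (power_sum a) + \<theta> v * \<theta> (power_sum b) = 0"
    using ker[OF uv] by (simp add: ring_map_simps[OF \<theta>] flip: \<theta>_def)
  moreover have "\<not> (poly_ev \<epsilon> r (\<theta> (power_sum a)) = 0 \<and> poly_ev \<epsilon> r (\<theta> (power_sum b)) = 0)" for r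
    using no_common_zero_of_power_plus_one[OF ab v2, of r] ab by (simp add: ev_ps)
  ultimately obtain w where w: "\<theta> u = w * \<theta> (power_sum b)" "\<theta> v = - w * \<theta> (power_sum a)"
    using monic_coprime_syzygy[OF hom(3) lc] by blast
  have "u - s w * power_sum b = 1 * (u - s (\<theta> u)) + (- s w) * (power_sum b - s (\<theta> (power_sum b)))"
    by (simp add: w ring_map_simps[OF s] algebra_simps)
  also have "\<dots> \<in> I"
    by (intro ideal_lincomb2 I retract)
  finally have 1: "u - s w * power_sum b \<in> I" .
  have "v + s w * power_sum a = 1 * (v - s (\<theta> v)) + s w * (power_sum a - s (\<theta> (power_sum a)))"
    by (simp add: w ring_map_simps[OF s] algebra_simps)
  also have "\<dots> \<in> I"
    by (intro ideal_lincomb2 I retract)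
  finally show ?thesis
    using 1 by blast
qed

text \<open>The ideal of the affine cone over the curve cut out by the two power sums.\<close>

definition cone_ideal :: "nat \<Rightarrow> nat \<Rightarrow> poly4 set"
  where "cone_ideal a b = ideal_span {power_sum a, power_sum b}"

lemma is_ideal_cone_ideal: "is_ideal (cone_ideal a b)"
  by (simp add: cone_ideal_def)

lemma mem_cone_ideal_iff: "f \<in> cone_ideal a b \<longleftrightarrow> (\<exists>u v. f = u * power_sum a + v * power_sum b)"
proof -
  have "f \<in> cone_ideal a b \<longleftrightarrow> (\<exists>u v. f - u * power_sum a - v * power_sum b = 0)"
    unfolding cone_ideal_def idl.span_insert idl.span_empty by simp
  then show ?thesis
    by (simp add: diff_diff_eq)
qed

lemma cone_ideal_lincomb: "u * power_sum a + v * power_sum b \<in> cone_ideal a b"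
  by (auto simp: mem_cone_ideal_iff)

lemma cone_ideal_kernel:
  assumes "ring_map f" "f (power_sum a) = 0" "f (power_sum b) = 0" "x \<in> cone_ideal a b"
  shows "f x = 0"
  using assms by (auto simp: mem_cone_ideal_iff ring_map_simps)

lemma homogeneous_cone_ideal: "homogeneous_ideal (cone_ideal a b)"
proof -
  have "hcomp d (u * power_sum n) \<in> cone_ideal a b" if "n \<in> {a, b}" for d n u
  proof -
    have "hcomp d (u * power_sum n) = (if n \<le> d then power_sum n * hcomp (d - n) u else 0)"
      using hcomp_hcomp_mult[of d n "power_sum n" u] by (simp add: hcomp_power_sum mult.commute)
    moreover have "power_sum n \<in> cone_ideal a b"
      unfolding cone_ideal_def using that by (intro idl.span_base) auto
    ultimately show ?thesis
      using idl.subspace_0[OF is_ideal_cone_ideal] ideal_mult_right[OF is_ideal_cone_ideal] by auto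
  qed
  then have "hcomp d f \<in> cone_ideal a b" if "f \<in> cone_ideal a b" for f d
    using that by (auto simp: mem_cone_ideal_iff[of f] hcomp_add intro!: idl.subspace_add is_ideal_cone_ideal)
  then show ?thesis
    by (simp add: homogeneous_ideal_def is_ideal_cone_ideal)
qed

lemma power_sum_syzygy_mod_linear:
  assumes ab: "0 < a" "a < b" and v2: "\<not> multiplicity 2 a < multiplicity 2 (b - a)" and kl: "k \<noteq> l"
    and uv: "u * power_sum a + v * power_sum b \<in> ideal_span {var l - const c * var k}"
  shows "\<exists>w. u - w * power_sum b \<in> ideal_span {var l - const c * var k}
    \<and> v + w * power_sum a \<in> ideal_span {var l - const c * var k}"
proof -
  obtain i j where ij: "i \<noteq> j" "i \<noteq> k" "i \<noteq> l" "j \<noteq> k" "j \<noteq> l" and U: "UNIV = {k, l, i, j}"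
    using index4_complement2[OF kl] by blast
  define \<kappa> :: "complex \<Rightarrow> complex poly poly" where "\<kappa> = (\<lambda>c. [:[:c:]:])"
  define \<eta> :: "4 \<Rightarrow> complex poly poly"
    where "\<eta> = (\<lambda>m. if m = i then [:0, 1:] else if m = k then [:[:0, 1:]:] else [:[:0, c:]:])"
  define \<sigma> where "\<sigma> = poly_ev (poly_ev const (var k)) (var i)"
  define \<epsilon> :: "complex poly poly \<Rightarrow> complex" where "\<epsilon> = (\<lambda>q. poly (poly q 1) 0)"
  note h1 = ring_map_poly_ev[OF ring_map_const, of "var k"]
  have hom: "ring_map \<kappa>" "ring_map \<sigma>" "ring_map \<epsilon>"
    unfolding \<kappa>_def \<sigma>_def \<epsilon>_def
    by (intro ring_map_const_poly ring_map_id, intro ring_map_poly_ev h1, simp add: ring_map_def)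
  note \<sigma>_simps = poly_ev_0 poly_ev_pCons[OF ring_map_const] poly_ev_pCons[OF h1]
    ring_map_simps(1,4)[OF ring_map_const] ring_map_simps(1,4)[OF h1]
  let ?I = "ideal_span {var l - const c * var k}"
  show ?thesis
  proof (rule power_sum_syzygy[OF ab v2 hom])
    show "\<epsilon> (\<kappa> d) = d" for d
      by (simp add: \<epsilon>_def \<kappa>_def)
    show "\<sigma> (\<kappa> d) = const d" for d
      by (simp add: \<sigma>_def \<kappa>_def \<sigma>_simps)
    show "is_ideal ?I"
      by simp
    show "var m - \<sigma> (\<eta> m) \<in> ?I" if "m \<noteq> j" for m
    proof -
      have "m \<in> {k, l, i}"
        using that U by blast
      then show ?thesis
        using ij kl idl.span_base[of "var l - const c * var k" "{var l - const c * var k}"]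
        by (auto simp: \<sigma>_def \<eta>_def \<sigma>_simps idl.span_zero mult.commute)
    qed
    show "subst (\<lambda>d. [:\<kappa> d:]) (\<lambda>m. if m = j then [:0, 1:] else [:\<eta> m:]) f = 0" if f: "f \<in> ?I" for f
    proof -
      note hk = ring_map_const_poly[OF hom(1)]
      obtain q where "f = q * (var l - const c * var k)"
        using f ideal_span_singleton by blast
      then show ?thesis
        using ij kl by (simp add: ring_map_simps[OF ring_map_subst[OF hk]] subst_const[OF hk] subst_var[OF hk] \<eta>_def)
          (simp add: \<kappa>_def)
    qed
    show "i \<noteq> j" by (rule ij)
    show "\<epsilon> (\<eta> m) = (if m = i then 1 else 0)" for m
      by (simp add: \<epsilon>_def \<eta>_def)
    show "u * power_sum a + v * power_sum b \<in> ?I" by (rule uv)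
  qed
qed

lemma power_sum_syzygy_mod_two_variables:
  assumes ab: "0 < a" "a < b" and v2: "\<not> multiplicity 2 a < multiplicity 2 (b - a)" and kl: "k \<noteq> l"
    and uv: "u * power_sum a + v * power_sum b \<in> ideal_span {var k, var l}"
  shows "\<exists>w. u - w * power_sum b \<in> ideal_span {var k, var l}
    \<and> v + w * power_sum a \<in> ideal_span {var k, var l}"
proof -
  obtain i j where ij: "i \<noteq> j" "i \<noteq> k" "i \<noteq> l" "j \<noteq> k" "j \<noteq> l" and U: "UNIV = {k, l, i, j}"
    using index4_complement2[OF kl] by blast
  define \<kappa> :: "complex \<Rightarrow> complex poly" where "\<kappa> = (\<lambda>c. [:c:])"
  define \<eta> :: "4 \<Rightarrow> complex poly" where "\<eta> = (\<lambda>m. if m = i then [:0, 1:] else 0)"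
  define \<sigma> where "\<sigma> = poly_ev const (var i)"
  define \<epsilon> :: "complex poly \<Rightarrow> complex" where "\<epsilon> = (\<lambda>q. poly q 1)"
  have hom: "ring_map \<kappa>" "ring_map \<sigma>" "ring_map \<epsilon>"
    unfolding \<kappa>_def \<sigma>_def \<epsilon>_def
    by (intro ring_map_const_poly ring_map_id ring_map_poly_ev ring_map_const ring_map_poly)+
  note \<sigma>_simps = poly_ev_0 poly_ev_pCons[OF ring_map_const] ring_map_simps(1,4)[OF ring_map_const]
  let ?I = "ideal_span {var k, var l}"
  show ?thesis
  proof (rule power_sum_syzygy[OF ab v2 hom])
    show "\<epsilon> (\<kappa> d) = d" for d
      by (simp add: \<epsilon>_def \<kappa>_def)
    show "\<sigma> (\<kappa> d) = const d" for d
      by (simp add: \<sigma>_def \<kappa>_def \<sigma>_simps)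
    show "is_ideal ?I"
      by simp
    show "var m - \<sigma> (\<eta> m) \<in> ?I" if "m \<noteq> j" for m
    proof -
      have "m \<in> {k, l, i}"
        using that U by blast
      then show ?thesis
        using ij kl by (auto simp: \<sigma>_def \<eta>_def \<sigma>_simps idl.span_zero intro: idl.span_base)
    qed
    show "subst (\<lambda>d. [:\<kappa> d:]) (\<lambda>m. if m = j then [:0, 1:] else [:\<eta> m:]) f = 0" if f: "f \<in> ?I" for f
    proof -
      note hk = ring_map_const_poly[OF hom(1)]
      obtain q q' where "f - q * var k = q' * var l"
        using f by (auto simp: idl.span_insert[of _ "{var l}"] ideal_span_singleton)
      then have "f = q * var k + q' * var l"
        by (simp add: algebra_simps)
      then show ?thesis
        using ij kl by (simp add: ring_map_simps[OF ring_map_subst[OF hk]] subst_var[OF hk] \<eta>_def)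
    qed
    show "i \<noteq> j" by (rule ij)
    show "\<epsilon> (\<eta> m) = (if m = i then 1 else 0)" for m
      by (simp add: \<epsilon>_def \<eta>_def)
    show "u * power_sum a + v * power_sum b \<in> ?I" by (rule uv)
  qed
qed

lemma var_diff_nonzero: "k \<noteq> l \<Longrightarrow> var l - const c * var k \<noteq> 0"
proof
  assume kl: "k \<noteq> l" and eq: "var l - const c * var k = 0"
  have "ev (\<lambda>i. if i = l then 1 else 0) (var l - const c * var k) = 1"
    using kl by (simp add: ring_map_simps[OF ring_map_ev] ev_var)
  with eq show False
    by (simp add: ring_map_simps[OF ring_map_ev])
qed

context
  fixes a b :: nat
  assumes ab: "0 < a" "a < b" and v2: "\<not> multiplicity 2 a < multiplicity 2 (b - a)"
begin

text \<open>Write \<open>X f = u F + v G\<close> for the linear form \<open>X\<close>. Modulo \<open>X\<close> the pair \<open>(u, v)\<close> is a trivial syzygy, so after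
subtracting the latter, \<open>u\<close> and \<open>v\<close> become divisible by \<open>X\<close>, which may be cancelled.\<close>

lemma linear_form_regular:
  assumes kl: "k \<noteq> l" and f: "(var l - const c * var k) * f \<in> cone_ideal a b"
  shows "f \<in> cone_ideal a b"
proof -
  let ?X = "var l - const c * var k"
  obtain u v where uv: "?X * f = u * power_sum a + v * power_sum b"
    using f by (auto simp: mem_cone_ideal_iff)
  have "u * power_sum a + v * power_sum b \<in> ideal_span {?X}"
    by (auto simp: ideal_span_singleton simp flip: uv)
  from power_sum_syzygy_mod_linear[OF ab v2 kl this] obtain w u' v'
    where u': "u - w * power_sum b = u' * ?X" and v': "v + w * power_sum a = v' * ?X"
    unfolding ideal_span_singleton by blast
  have "?X * f = (u - w * power_sum b) * power_sum a + (v + w * power_sum a) * power_sum b"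
    unfolding uv by (simp add: algebra_simps)
  also have "\<dots> = ?X * (u' * power_sum a + v' * power_sum b)"
    unfolding u' v' by (simp add: algebra_simps)
  finally have "f = u' * power_sum a + v' * power_sum b"
    using var_diff_nonzero[OF kl] by (simp only: mult_cancel_left) simp
  then show ?thesis
    by (simp add: cone_ideal_lincomb)
qed

text \<open>Again a syzygy of the power sums, now modulo two variables, is trivial. Removing it leaves the
fact that two distinct variables form a regular sequence.\<close>

lemma second_variable_regular:
  assumes kl: "k \<noteq> l" and f: "var k * f - var l * g \<in> cone_ideal a b"
  shows "\<exists>t. f - var l * t \<in> cone_ideal a b"
proof -
  obtain u v where uv: "var k * f - var l * g = u * power_sum a + v * power_sum b"
    using f by (auto simp: mem_cone_ideal_iff)
  have "var k * f - var l * g \<in> ideal_span {var k, var l}"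
    by (intro idl.span_diff ideal_mult_right[OF idl.subspace_span] idl.span_base) auto
  from power_sum_syzygy_mod_two_variables[OF ab v2 kl this[unfolded uv]] obtain w u1 u2 v1 v2
    where u': "u - w * power_sum b - u1 * var k = u2 * var l"
      and v': "v + w * power_sum a - v1 * var k = v2 * var l"
    by (auto simp: idl.span_insert[of _ "{var l}"] ideal_span_singleton)
  let ?h = "f - (u1 * power_sum a + v1 * power_sum b)"
  have "var k * f - var l * g
    = (u - w * power_sum b) * power_sum a + (v + w * power_sum a) * power_sum b"
    unfolding uv by (simp add: algebra_simps)
  also have "u - w * power_sum b = u1 * var k + u2 * var l"
    using u' by (simp add: algebra_simps)
  also have "v + w * power_sum a = v1 * var k + v2 * var l"
    using v' by (simp add: algebra_simps)
  finally have dvd: "var k * ?h = var l * (g + u2 * power_sum a + v2 * power_sum b)"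
    by (simp add: algebra_simps)
  \<comment> \<open>substituting 0 for the variable \<open>l\<close>\<close>
  define \<theta> where "\<theta> = subst const (\<lambda>m. if m = l then 0 else var m)"
  note \<theta> = ring_map_subst[OF ring_map_const, of "\<lambda>m. if m = l then 0 else var m", folded \<theta>_def]
  have \<theta>_simps: "\<theta> (const c) = const c" "\<theta> (var m) = (if m = l then 0 else var m)" for c m
    by (simp_all add: \<theta>_def subst_const[OF ring_map_const] subst_var[OF ring_map_const])
  have "var k * \<theta> ?h = 0"
    using arg_cong[OF dvd, of \<theta>] kl by (simp add: ring_map_simps(3)[OF \<theta>] \<theta>_simps)
  moreover have "var k \<noteq> 0"
    using var_diff_nonzero[OF kl[symmetric], of 0] ring_map_simps(4)[OF ring_map_const] by simp
  ultimately have \<theta>h: "\<theta> ?h = 0"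
    by simp
  have "h - \<theta> h \<in> ideal_span {var l}" for h
  proof (induction h rule: poly4_induct)
    case (var m)
    then show ?case by (auto simp: \<theta>_simps idl.span_zero intro: idl.span_base)
  next
    case (add f g)
    then show ?case
      using idl.subspace_add[OF idl.subspace_span add] by (simp add: ring_map_simps[OF \<theta>] algebra_simps)
  next
    case (mult f g)
    then show ?case
      using ideal_lincomb2[OF idl.subspace_span mult, of g "\<theta> f"]
      by (simp add: ring_map_simps[OF \<theta>] algebra_simps)
  qed (simp add: \<theta>_simps idl.span_zero)
  then obtain t where t: "?h = t * var l"
    using \<theta>h by (metis diff_zero ideal_span_singleton)
  have "f - var l * t = u1 * power_sum a + v1 * power_sum b"
    using t by (simp add: algebra_simps)
  then show ?thesis
    by (metis cone_ideal_lincomb)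
qed

lemma variable_powers_regular_sequence:
  assumes kl: "k \<noteq> l" and f: "var k ^ N * f - var l ^ M * g \<in> cone_ideal a b"
  shows "\<exists>t. f - var l ^ M * t \<in> cone_ideal a b"
  using f
proof (induction M arbitrary: f g)
  case 0
  show ?case
    using idl.subspace_0[OF is_ideal_cone_ideal] by (intro exI[of _ f]) simp
next
  case (Suc M)
  have pow: "\<exists>t. f - var l * t \<in> cone_ideal a b" if "var k ^ N * f - var l * g \<in> cone_ideal a b" for N f g
    using that
  proof (induction N arbitrary: f)
    case 0
    then show ?case by auto
  next
    case (Suc N)
    then have "var k ^ N * (var k * f) - var l * g \<in> cone_ideal a b"
      by (simp add: ac_simps)
    then obtain t where "var k * f - var l * t \<in> cone_ideal a b"
      using Suc.IH by blast
    then show ?case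
      by (rule second_variable_regular[OF kl])
  qed
  have "var k ^ N * f - var l * (var l ^ M * g) \<in> cone_ideal a b"
    using Suc.prems by (simp add: ac_simps)
  from pow[OF this] obtain t where t: "f - var l * t \<in> cone_ideal a b"
    by blast
  have "(var l - const 0 * var k) * (var k ^ N * t - var l ^ M * g)
    = 1 * (var k ^ N * f - var l ^ Suc M * g) + (- (var k ^ N)) * (f - var l * t)"
    by (simp add: algebra_simps ring_map_simps[OF ring_map_const])
  also have "\<dots> \<in> cone_ideal a b"
    by (intro ideal_lincomb2 is_ideal_cone_ideal Suc.prems t)
  finally have "var k ^ N * t - var l ^ M * g \<in> cone_ideal a b"
    by (rule linear_form_regular[OF kl])
  then obtain t' where t': "t - var l ^ M * t' \<in> cone_ideal a b"
    using Suc.IH by blast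
  have "f - var l ^ Suc M * t' = 1 * (f - var l * t) + var l * (t - var l ^ M * t')"
    by (simp add: algebra_simps)
  also have "\<dots> \<in> cone_ideal a b"
    by (intro ideal_lincomb2 is_ideal_cone_ideal t t')
  finally show ?case by blast
qed

end

section \<open>Uniformizers at the points of the curve\<close>

text \<open>The divided difference of the \<open>n\<close>-th power; on the diagonal it is the derivative.\<close>

definition power_quotient :: "nat \<Rightarrow> 'a::comm_ring_1 \<Rightarrow> 'a \<Rightarrow> 'a"
  where "power_quotient n x y = (\<Sum>i<n. y ^ (n - Suc i) * x ^ i)"

lemma power_quotient: "(x - y) * power_quotient n x y = x ^ n - y ^ n"
  by (simp only: power_quotient_def power_diff_sumr2)

lemma power_quotient_hom:
  assumes "ring_map f" "f x = f y"
  shows "f (power_quotient n x y) = of_nat n * f x ^ (n - 1)"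
proof -
  have "f (power_quotient n x y) = (\<Sum>i<n. f x ^ (n - 1))"
    unfolding power_quotient_def ring_map_sum[OF assms(1)]
    by (intro sum.cong) (simp_all add: ring_map_simps[OF assms(1)] assms(2) flip: power_add)
  then show ?thesis by simp
qed

text \<open>Expansion of the power sum at a point \<open>p\<close> where it vanishes, along the linear forms that vanish
at \<open>p\<close>.\<close>

lemma power_sum_expansion:
  assumes "(\<Sum>j\<in>UNIV. p j ^ n) = 0"
  shows "power_sum n = (\<Sum>j\<in>UNIV. (var j - const (p j) * var k) * power_quotient n (var j) (const (p j) * var k))"
proof -
  have "(\<Sum>j\<in>UNIV. (const (p j) * var k) ^ n) = const (\<Sum>j\<in>UNIV. p j ^ n) * var k ^ n"
    by (simp add: power_mult_distrib ring_map_sum[OF ring_map_const] ring_map_simps[OF ring_map_const] sum_distrib_right)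
  also have "\<dots> = 0"
    by (simp add: assms ring_map_simps[OF ring_map_const])
  finally show ?thesis
    by (simp add: power_quotient sum_subtractf power_sum_def)
qed

text \<open>Modulo the forms \<open>var m - const (p m) * var k\<close>, every polynomial \<open>f\<close> is congruent to \<open>line p f\<close> evaluated at
\<open>var k\<close>. If \<open>p\<^sub>k = 1\<close>, they generate the prime ideal of the point \<open>p\<close>.\<close>

lemma line_kernel_mult:
  assumes J: "is_ideal J" and z: "\<And>m. h * (var m - const (p m) * var k) \<in> J" and f: "line p f = 0"
  shows "h * f \<in> J"
proof -
  define \<psi> where "\<psi> = poly_ev const (var k)"
  have \<psi>: "ring_map \<psi>"
    unfolding \<psi>_def by (intro ring_map_poly_ev ring_map_const)
  have \<psi>_simps: "\<psi> [:c:] = const c" "\<psi> [:0, c:] = const c * var k" for c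
    by (simp_all add: \<psi>_def poly_ev_pCons[OF ring_map_const] poly_ev_0 ring_map_simps[OF ring_map_const] mult.commute)
  have "h * (f - \<psi> (line p f)) \<in> J"
  proof (induction f rule: poly4_induct)
    case (const c)
    then show ?case
      by (simp add: line_const \<psi>_simps idl.subspace_0[OF J])
  next
    case (var i)
    then show ?case
      using z by (simp add: line_var \<psi>_simps)
  next
    case (add f g)
    then show ?case
      using idl.subspace_add[OF J add]
      by (simp add: ring_map_simps[OF \<psi>] ring_map_simps[OF ring_map_line] algebra_simps)
  next
    case (mult f g)
    then show ?case
      using ideal_lincomb2[OF J mult, of g "\<psi> (line p f)"]
      by (simp add: ring_map_simps[OF \<psi>] ring_map_simps[OF ring_map_line] algebra_simps)
  qed
  then show ?thesis
    using f by (simp add: ring_map_simps[OF \<psi>])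
qed

lemma line_eq_0_imp_ev: "line p f = 0 \<Longrightarrow> ev p f = 0"
  using poly_line[of p f 1] by simp

lemma line_power_sum: "(\<Sum>j\<in>UNIV. p j ^ n) = 0 \<Longrightarrow> line p (power_sum n) = 0"
  by (rule poly_eqI) (simp add: coeff_line hcomp_power_sum ev_power_sum ring_map_simps[OF ring_map_ev])

text \<open>Both power sums are combinations of the three linear forms \<open>z\<^sub>i, z\<^sub>j, z\<^sub>l\<close> that vanish at \<open>p\<close>. Cramer's
rule, applied to the columns of a nonvanishing minor \<open>h\<close>, expresses \<open>h z\<^sub>i\<close> and \<open>h z\<^sub>j\<close> through \<open>z\<^sub>l\<close>
modulo the ideal.\<close>

lemma uniformizer_at_point:
  assumes ab: "0 < a" "a < b" and v2: "\<not> multiplicity 2 a < multiplicity 2 (b - a)"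
    and v3: "a = 1 \<or> \<not> multiplicity 3 a < multiplicity 3 (b - a)"
    and p: "p k = 1" "(\<Sum>i\<in>UNIV. p i ^ a) = 0" "(\<Sum>i\<in>UNIV. p i ^ b) = 0"
  shows "\<exists>h \<pi>. uniformizer (cone_ideal a b) {f. line p f = 0} h \<pi>"
proof -
  obtain i j where ij: "i \<noteq> k" "j \<noteq> k" "i \<noteq> j"
    and minor: "p i ^ (a - 1) * p j ^ (b - 1) \<noteq> p j ^ (a - 1) * p i ^ (b - 1)"
    using smooth_point_minor[OF ab v2 v3 p] by blast
  obtain l where l: "l \<noteq> k" "l \<noteq> i" "l \<noteq> j" and U: "UNIV = {k, i, j, l}"
  proof -
    obtain l m where lm: "l \<noteq> m" "l \<noteq> i" "l \<noteq> j" "m \<noteq> i" "m \<noteq> j" and U: "UNIV = {i, j, l, m}"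
      using index4_complement2[OF ij(3)] by blast
    have "k \<in> {i, j, l, m}"
      unfolding U[symmetric] by simp
    then consider "k = l" | "k = m"
      using ij by auto
    then show ?thesis
    proof cases
      case 1
      show ?thesis by (rule that[of m]) (use lm U 1 in \<open>auto simp: insert_commute\<close>)
    next
      case 2
      show ?thesis by (rule that[of l]) (use lm U 2 in \<open>auto simp: insert_commute\<close>)
    qed
  qed
  define z where "z m = var m - const (p m) * var k" for m
  define A where "A n m = power_quotient n (var m) (const (p m) * var k)" for n m
  define h where "h = A a i * A b j - A a j * A b i"
  have zk: "z k = 0"
    by (simp add: z_def p(1) ring_map_simps[OF ring_map_const])
  have exp: "power_sum n = z i * A n i + z j * A n j + z l * A n l" if "(\<Sum>i\<in>UNIV. p i ^ n) = 0" for n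
    unfolding power_sum_expansion[OF that, of k] z_def[symmetric] A_def[symmetric]
    using ij l by (simp add: U zk add.assoc)
  have line_z: "line p (z m) = 0" for m
    by (simp add: z_def ring_map_simps[OF ring_map_line] line_const line_var p(1))
  have line_A: "line p (A n m) = of_nat n * [:0, p m:] ^ (n - 1)" for n m
    unfolding A_def by (subst power_quotient_hom[OF ring_map_line])
      (simp_all add: ring_map_simps[OF ring_map_line] line_const line_var p(1))
  have "poly (line p h) 1 = of_nat a * of_nat b * (p i ^ (a - 1) * p j ^ (b - 1) - p j ^ (a - 1) * p i ^ (b - 1))"
    by (simp add: h_def ring_map_simps[OF ring_map_line] line_A algebra_simps)
  also have "\<dots> \<noteq> 0"
    using minor ab by simp
  finally have h: "line p h \<noteq> 0"
    by auto
  let ?Q = "cone_ideal a b" and ?P = "{f. line p f = 0}"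
  let ?J = "ideal_span (insert (z l) ?Q)"
  have J: "is_ideal ?J" by simp
  have in_J: "u * power_sum a + v * power_sum b + w * z l \<in> ?J" for u v w
    by (intro idl.span_add idl.span_scale idl.span_base) (auto simp: cone_ideal_lincomb)
  have hz: "h * z m \<in> ?J" for m
  proof -
    have "h * z i = A b j * power_sum a + (- A a j) * power_sum b + (A a j * A b l - A a l * A b j) * z l"
      unfolding exp[OF p(2)] exp[OF p(3)] h_def by (simp add: algebra_simps)
    then have 1: "h * z i \<in> ?J"
      by (simp only: in_J)
    have "h * z j = (- A b i) * power_sum a + A a i * power_sum b + (A a l * A b i - A a i * A b l) * z l"
      unfolding exp[OF p(2)] exp[OF p(3)] h_def by (simp add: algebra_simps)
    then have 2: "h * z j \<in> ?J"
      by (simp only: in_J)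
    have 3: "h * z l \<in> ?J" "h * z k \<in> ?J"
      using in_J[of 0 0 h] in_J[of 0 0 0] by (simp_all add: zk)
    have "m \<in> {k, i, j, l}"
      unfolding U[symmetric] by simp
    then show ?thesis
      using 1 2 3 by blast
  qed
  have "uniformizer ?Q ?P h (z l)"
  proof
    show "noetherian TYPE(poly4)" by (rule noetherian_poly4)
    show "is_ideal ?Q" by (rule is_ideal_cone_ideal)
    show "is_prime ?P" by (rule is_prime_kernel[OF ring_map_line])
    show "?Q \<subseteq> ?P"
      using cone_ideal_kernel[OF ring_map_line line_power_sum line_power_sum, OF p(2,3)] by blast
    show "h \<notin> ?P" "z l \<in> ?P"
      using h line_z by simp_all
    show "\<exists>g. h * f - z l * g \<in> ?Q" if "f \<in> ?P" for f
    proof -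
      have "h * (var m - const (p m) * var k) \<in> ?J" for m
        using hz[of m] unfolding z_def[of m] .
      then have "h * f \<in> ?J"
        using that by (intro line_kernel_mult[OF J, of h p k f]) simp_all
      then show ?thesis
        by (simp add: ideal_span_insert[OF is_ideal_cone_ideal] mult.commute)
    qed
    show "f \<in> ?Q" if "z l * f \<in> ?Q" for f
      using linear_form_regular[OF ab v2 l(1)[symmetric]] that unfolding z_def by blast
  qed
  then show ?thesis by blast
qed

section \<open>Leading forms modulo a homogeneous ideal\<close>

text \<open>The degree of the leading form of the residue class of \<open>f\<close> modulo a homogeneous ideal: components of
\<open>f\<close> that lie in \<open>Q\<close> do not count.\<close>

definition is_top :: "poly4 set \<Rightarrow> poly4 \<Rightarrow> nat \<Rightarrow> bool"
  where "is_top Q f d \<longleftrightarrow> hcomp d f \<notin> Q \<and> (\<forall>e>d. hcomp e f \<in> Q)"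

lemma top_exists:
  assumes Q: "is_ideal Q" and f: "f \<notin> Q"
  shows "\<exists>d. is_top Q f d"
proof -
  let ?D = "{d. hcomp d f \<notin> Q}"
  have "?D \<subseteq> {..degree (grade f)}"
    using hcomp_eq_0[of f] idl.subspace_0[OF Q] by (force simp: not_less[symmetric])
  then have "finite ?D"
    by (rule finite_subset) simp
  moreover have "?D \<noteq> {}"
    using mem_of_comps[OF Q] f by blast
  ultimately have "Max ?D \<in> ?D" "\<forall>e>Max ?D. e \<notin> ?D"
    using Max_in Max_ge by (blast, meson leD)
  then show ?thesis
    unfolding is_top_def by blast
qed

lemma top_unique: "is_top Q f d \<Longrightarrow> is_top Q f e \<Longrightarrow> d = e"
  unfolding is_top_def by (meson linorder_neqE_nat)

lemma hcomp_mult_top: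
  assumes Q: "is_ideal Q" and f: "\<And>i. d < i \<Longrightarrow> hcomp i f \<in> Q" and g: "\<And>i. e < i \<Longrightarrow> hcomp i g \<in> Q"
  shows "hcomp (d + e) (f * g) - hcomp d f * hcomp e g \<in> Q"
    and "d + e < n \<Longrightarrow> hcomp n (f * g) \<in> Q"
proof -
  have summand: "hcomp i f * hcomp (n - i) g \<in> Q" if "d < i \<or> e < n - i" for i n
    using that f[of i] g[of "n - i"] idl.subspace_scale[OF Q] ideal_mult_right[OF Q] by blast
  have "hcomp (d + e) (f * g) = hcomp d f * hcomp e g + (\<Sum>i\<in>{..d + e} - {d}. hcomp i f * hcomp (d + e - i) g)"
    unfolding hcomp_mult by (subst sum.remove[of _ d]) simp_all
  moreover have "(\<Sum>i\<in>{..d + e} - {d}. hcomp i f * hcomp (d + e - i) g) \<in> Q"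
    by (intro idl.subspace_sum[OF Q] summand) auto
  ultimately show "hcomp (d + e) (f * g) - hcomp d f * hcomp e g \<in> Q"
    by simp
  show "hcomp n (f * g) \<in> Q" if "d + e < n"
    unfolding hcomp_mult using that by (intro idl.subspace_sum[OF Q] summand) auto
qed

lemma top_mult:
  assumes Q: "is_prime Q" and f: "is_top Q f d" and g: "is_top Q g e"
  shows "is_top Q (f * g) (d + e)" "hcomp (d + e) (f * g) - hcomp d f * hcomp e g \<in> Q"
proof -
  have idl: "is_ideal Q" using Q by (simp add: is_prime_def)
  show 1: "hcomp (d + e) (f * g) - hcomp d f * hcomp e g \<in> Q"
    using hcomp_mult_top(1)[OF idl] f g unfolding is_top_def by blast
  have "hcomp n (f * g) \<in> Q" if "d + e < n" for n
    using hcomp_mult_top(2)[OF idl _ _ that] f g unfolding is_top_def by blast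
  then show "is_top Q (f * g) (d + e)"
    using f g ideal_diff_cong[OF idl 1] prime_mult_iff[OF Q] unfolding is_top_def by blast
qed

lemma top_power:
  assumes Q: "is_prime Q" and f: "is_top Q f d"
  shows "is_top Q (f ^ n) (n * d) \<and> hcomp (n * d) (f ^ n) - hcomp d f ^ n \<in> Q"
proof (induction n)
  case 0
  then show ?case
    using Q by (auto simp: is_top_def is_prime_def hcomp_one idl.subspace_0)
next
  case (Suc n)
  have idl: "is_ideal Q" using Q by (simp add: is_prime_def)
  have "hcomp d f * hcomp (n * d) (f ^ n) - hcomp d f * hcomp d f ^ n \<in> Q"
    using idl.subspace_scale[OF idl conjunct2[OF Suc], of "hcomp d f"] by (simp add: algebra_simps)
  then show ?case
    using top_mult[OF Q f conjunct1[OF Suc]] ideal_cong_trans[OF idl] by auto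
qed

lemma top_cong:
  assumes Q: "homogeneous_ideal Q" and fg: "f - g \<in> Q"
  shows "is_top Q f d \<longleftrightarrow> is_top Q g d" "hcomp d f - hcomp d g \<in> Q"
proof -
  have idl: "is_ideal Q" using Q by (simp add: homogeneous_ideal_def)
  have 1: "hcomp e f - hcomp e g \<in> Q" for e
    using Q fg unfolding homogeneous_ideal_def by (metis hcomp_diff)
  then show "hcomp d f - hcomp d g \<in> Q" .
  show "is_top Q f d \<longleftrightarrow> is_top Q g d"
    using ideal_diff_cong[OF idl 1] by (simp add: is_top_def)
qed

section \<open>The smooth case\<close>

lemma homogeneous_colon:
  assumes Q: "homogeneous_ideal Q" and s: "hcomp \<sigma> s = s" and u: "hcomp \<delta> u = u"
  shows "homogeneous_ideal {e. \<exists>r. e * u - s * r \<in> Q}"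
proof -
  have idl: "is_ideal Q" using Q by (simp add: homogeneous_ideal_def)
  have "is_ideal {e. \<exists>r. e * u - s * r \<in> Q}"
    unfolding idl.subspace_def
  proof (intro conjI ballI allI)
    show "0 \<in> {e. \<exists>r. e * u - s * r \<in> Q}"
      using idl.subspace_0[OF idl] by (auto intro: exI[of _ 0])
  next
    fix x y assume "x \<in> {e. \<exists>r. e * u - s * r \<in> Q}" "y \<in> {e. \<exists>r. e * u - s * r \<in> Q}"
    then obtain r r' where "x * u - s * r \<in> Q" "y * u - s * r' \<in> Q"
      by blast
    from idl.subspace_add[OF idl this] have "(x + y) * u - s * (r + r') \<in> Q"
      by (simp add: algebra_simps)
    then show "x + y \<in> {e. \<exists>r. e * u - s * r \<in> Q}" by blast
  next
    fix c x assume "x \<in> {e. \<exists>r. e * u - s * r \<in> Q}"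
    then obtain r where "x * u - s * r \<in> Q"
      by blast
    from idl.subspace_scale[OF idl this, of c] have "(c * x) * u - s * (c * r) \<in> Q"
      by (simp add: algebra_simps)
    then show "c * x \<in> {e. \<exists>r. e * u - s * r \<in> Q}" by blast
  qed
  moreover have "\<exists>r. hcomp d e * u - s * r \<in> Q" if e: "e * u - s * r \<in> Q" for e r d
  proof -
    have "hcomp (d + \<delta>) (e * u - s * r) \<in> Q"
      using Q e by (simp add: homogeneous_ideal_def)
    also have "hcomp (d + \<delta>) (e * u - s * r) = hcomp (d + \<delta>) (u * e) - hcomp (d + \<delta>) (s * r)"
      by (simp add: hcomp_diff mult.commute)
    also have "\<dots> = hcomp d e * u - s * (if \<sigma> \<le> d + \<delta> then hcomp (d + \<delta> - \<sigma>) r else 0)"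
      using hcomp_hcomp_mult[of "d + \<delta>" \<delta> u e] hcomp_hcomp_mult[of "d + \<delta>" \<sigma> s r]
      by (simp add: s u mult.commute)
    finally show ?thesis by blast
  qed
  ultimately show ?thesis
    unfolding homogeneous_ideal_def by blast
qed

lemma homogeneous_sum_ideal:
  assumes I: "homogeneous_ideal I" and J: "homogeneous_ideal J"
  shows "homogeneous_ideal {x + y | x y. x \<in> I \<and> y \<in> J}"
proof -
  have idl: "is_ideal I" "is_ideal J" using I J by (simp_all add: homogeneous_ideal_def)
  have "ideal_span (I \<union> J) = {x + y | x y. x \<in> I \<and> y \<in> J}"
    using idl.span_Un[of I J] idl[THEN idl.span_eq_iff[THEN iffD2]] by (simp only:)
  then have "is_ideal {x + y | x y. x \<in> I \<and> y \<in> J}"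
    by (metis idl.subspace_span)
  then show ?thesis
    using I J unfolding homogeneous_ideal_def by (force simp: hcomp_add)
qed

context
  fixes a b :: nat
  assumes ab: "0 < a" "a < b" and v2: "\<not> multiplicity 2 a < multiplicity 2 (b - a)"
    and v3: "a = 1 \<or> \<not> multiplicity 3 a < multiplicity 3 (b - a)"
begin

private abbreviation (input) "Q \<equiv> cone_ideal a b"
private lemmas idlQ = is_ideal_cone_ideal[of a b]

text \<open>A homogeneous ideal that is locally trivial at all points of the curve has no projective zero; so the
Nullstellensatz applies.\<close>

lemma variable_power_in_ideal:
  assumes K: "homogeneous_ideal K" "Q \<subseteq> K"
    and unit: "\<And>p h \<pi>. uniformizer Q {f. line p f = 0} h \<pi> \<Longrightarrow> \<exists>c\<in>K. line p c \<noteq> 0"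
  shows "\<exists>N. var k ^ N \<in> K"
proof (rule ccontr)
  assume "\<not> ?thesis"
  then obtain p where p: "p k = 1" "\<forall>f\<in>K. line p f = 0"
    using homogeneous_nullstellensatz[OF K(1)] by blast
  have "power_sum a \<in> K" "power_sum b \<in> K"
    using K(2) unfolding cone_ideal_def by (auto intro: idl.span_base)
  then have "(\<Sum>i\<in>UNIV. p i ^ a) = 0" "(\<Sum>i\<in>UNIV. p i ^ b) = 0"
    using p(2) line_eq_0_imp_ev by (metis ev_power_sum)+
  then obtain h \<pi> where "uniformizer Q {f. line p f = 0} h \<pi>"
    using uniformizer_at_point[OF ab v2 v3, of p k] p(1) by blast
  with unit p(2) show False by blast
qed

lemma variable_regular: "var k * f \<in> Q \<Longrightarrow> f \<in> Q"
proof -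
  assume f: "var k * f \<in> Q"
  obtain l where "l \<noteq> k"
    using index4_distinct(1) by metis
  then show "f \<in> Q"
    using linear_form_regular[OF ab v2, of l k 0 f] f by (simp add: ring_map_simps[OF ring_map_const])
qed

lemma variable_power_regular: "var k ^ N * f \<in> Q \<Longrightarrow> f \<in> Q"
  by (induction N) (auto simp: mult.assoc dest: variable_regular)

lemma const_cancel:
  assumes "const c * f \<in> Q" "c \<noteq> 0"
  shows "f \<in> Q"
proof -
  have "(const (1 / c) * const c) * f \<in> Q"
    using idl.subspace_scale[OF idlQ assms(1), of "const (1 / c)"] by (simp only: mult.assoc)
  then show ?thesis
    using assms(2) by (simp add: const_inverse)
qed

text \<open>Let \<open>I\<close> be the annihilator of \<open>f\<close> modulo \<open>Q\<close>, and \<open>J\<close> the annihilator of \<open>I\<close>. The local rings of the curve are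
domains, so at each point \<open>f\<close> or \<open>I\<close> vanishes, and \<open>I + J\<close> is locally trivial. Hence \<open>x\<^sub>0 ^ N = i + j\<close> and
\<open>x\<^sub>1 ^ M = i' + j'\<close> with \<open>i, i'\<close> in \<open>I\<close> and \<open>j, j'\<close> in \<open>J\<close>. From \<open>I J \<subseteq> Q\<close> one gets
\<open>x\<^sub>1 ^ M i = x\<^sub>0 ^ N i'\<close> modulo \<open>Q\<close>, so \<open>x\<^sub>0 ^ N\<close> divides \<open>i\<close>, and by degrees the component of \<open>i\<close>
of degree \<open>N\<close> is a constant multiple of \<open>x\<^sub>0 ^ N\<close>. A nonzero constant puts \<open>x\<^sub>0 ^ N\<close> in \<open>I\<close> and kills \<open>f\<close>,
the constant 0 puts it in \<open>J\<close> and kills \<open>g\<close>. This is the elementwise form of the connectedness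
of the curve.\<close>

lemma no_homogeneous_zero_divisors:
  assumes f: "hcomp d f = f" "f \<notin> Q" and g: "g \<notin> Q" and fg: "f * g \<in> Q"
  shows False
proof -
  have hQ: "homogeneous_ideal Q" by (rule homogeneous_cone_ideal)
  define I where "I = {x. x * f \<in> Q}"
  define J where "J = {x. \<forall>i\<in>I. x * i \<in> Q}"
  have "I = {e. \<exists>r. e * f - 0 * r \<in> Q}"
    by (simp add: I_def)
  then have I: "homogeneous_ideal I"
    using homogeneous_colon[OF hQ _ f(1), of 0 0] by (simp add: hcomp_zero)
  then have idlI: "is_ideal I" by (simp add: homogeneous_ideal_def)
  have idlJ: "is_ideal J"
    unfolding idl.subspace_def J_def
    using idl.subspace_0[OF idlQ] idl.subspace_add[OF idlQ] idl.subspace_scale[OF idlQ]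
    by (auto simp: distrib_right mult.assoc)
  have "hcomp n x * i \<in> Q" if x: "x \<in> J" and i: "i \<in> I" for x i n
  proof (rule mem_of_comps[OF idlQ])
    fix m
    show "hcomp m (hcomp n x * i) \<in> Q"
    proof (cases "n \<le> m")
      case True
      have "x * hcomp (m - n) i \<in> Q"
        using x i I unfolding J_def homogeneous_ideal_def by blast
      then have "hcomp m (x * hcomp (m - n) i) \<in> Q"
        using hQ by (simp add: homogeneous_ideal_def)
      moreover have "hcomp m (hcomp n x * i) = hcomp m (x * hcomp (m - n) i)"
        using hcomp_hcomp_mult[of m n x i] hcomp_hcomp_mult[of m "m - n" i x] True
        by (simp add: mult.commute)
      ultimately show ?thesis
        by simp
    next
      case False
      then show ?thesis
        by (simp add: hcomp_hcomp_mult idl.subspace_0[OF idlQ])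
    qed
  qed
  then have J: "homogeneous_ideal J"
    using idlJ by (auto simp: homogeneous_ideal_def J_def)
  have QI: "Q \<subseteq> I" and QJ: "Q \<subseteq> J"
    unfolding I_def J_def using ideal_mult_right[OF idlQ] by auto
  let ?K = "{x + y | x y. x \<in> I \<and> y \<in> J}"
  have IK: "x \<in> ?K" if "x \<in> I" for x
    using that idl.subspace_0[OF idlJ] by force
  have JK: "y \<in> ?K" if "y \<in> J" for y
    using that idl.subspace_0[OF idlI] by force
  have K: "\<exists>N. var k ^ N \<in> ?K" for k
  proof (rule variable_power_in_ideal[OF homogeneous_sum_ideal[OF I J]])
    show "Q \<subseteq> ?K"
      using QI IK by blast
    show "\<exists>c\<in>?K. line p c \<noteq> 0" if U: "uniformizer Q {f. line p f = 0} h \<pi>" for p h \<pi>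
    proof -
      interpret U: uniformizer Q "{f. line p f = 0}" h \<pi>
        by (rule U)
      show ?thesis
      proof (cases "\<exists>c. line p c \<noteq> 0 \<and> c * f \<in> Q")
        case True
        then show ?thesis
          using IK unfolding I_def by blast
      next
        case False
        have kill: "\<exists>c. line p c \<noteq> 0 \<and> c * i \<in> Q" if "i \<in> I" for i
          using U.local_domain[of i f] that False by (auto simp: I_def)
        obtain A where A: "finite A" "ideal_span A = I"
          using noetherian_poly4 idlI unfolding noetherian_def by blast
        have "\<exists>c. line p c \<noteq> 0 \<and> (\<forall>i\<in>B. c * i \<in> Q)" if "finite B" "B \<subseteq> I" for B
          using that
        proof induction
          case empty
          then show ?case by (intro exI[of _ 1]) (simp add: ring_map_simps[OF ring_map_line])
        next
          case (insert i B)
          then obtain c c' where c: "line p c \<noteq> 0" "\<forall>i\<in>B. c * i \<in> Q" "line p c' \<noteq> 0" "c' * i \<in> Q"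
            using kill by (metis insert_subset)
          have "c * c' * j \<in> Q" if "j \<in> insert i B" for j
          proof (cases "j = i")
            case True
            then show ?thesis
              using idl.subspace_scale[OF idlQ c(4), of c] by (simp add: mult.assoc)
          next
            case False
            then have "c' * (c * j) \<in> Q"
              using that c(2) idl.subspace_scale[OF idlQ, of "c * j" c'] by simp
            then show ?thesis
              by (simp add: ac_simps)
          qed
          then show ?case
            using c by (intro exI[of _ "c * c'"]) (simp add: ring_map_simps[OF ring_map_line])
        qed
        moreover have "A \<subseteq> I"
          using A(2) idl.span_superset[of A] by simp
        ultimately obtain c where c: "line p c \<noteq> 0" "\<forall>i\<in>A. c * i \<in> Q"
          using A(1) by blast
        have "is_ideal {x. c * x \<in> Q}"
          unfolding idl.subspace_def
          using idl.subspace_0[OF idlQ] idl.subspace_add[OF idlQ] idl.subspace_scale[OF idlQ]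
          by (auto simp: distrib_left mult.left_commute[of c])
        then have "I \<subseteq> {x. c * x \<in> Q}"
          unfolding A(2)[symmetric] using c(2) by (intro idl.span_minimal) auto
        then have "c \<in> J"
          by (auto simp: J_def)
        then show ?thesis
          using c(1) JK by blast
      qed
    qed
  qed
  obtain N i j where N: "var 0 ^ N = i + j" "i \<in> I" "j \<in> J"
    using K[of 0] by blast
  obtain M i' j' where M: "var 1 ^ M = i' + j'" "i' \<in> I" "j' \<in> J"
    using K[of 1] by blast
  have "var 1 ^ M * i - var 0 ^ N * i' = j' * i - j * i'"
    by (simp add: N(1) M(1) algebra_simps)
  also have "\<dots> \<in> Q"
    using N M by (intro idl.subspace_diff[OF idlQ]) (auto simp: J_def)
  finally obtain t where t: "i - var 0 ^ N * t \<in> Q"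
    using variable_powers_regular_sequence[OF ab v2, of 1 0 M i N i'] by auto
  obtain c where c: "hcomp 0 t = const c"
    using hcomp_0 by blast
  have "hcomp N (i - var 0 ^ N * t) \<in> Q"
    using t hQ by (simp add: homogeneous_ideal_def)
  moreover have "hcomp N (var 0 ^ N * t) = var 0 ^ N * const c"
    using hcomp_hcomp_mult[of N N "var 0 ^ N" t] by (simp add: hcomp_var_power c)
  ultimately have i: "hcomp N i - var 0 ^ N * const c \<in> Q"
    by (simp add: hcomp_diff)
  have iI: "hcomp N i \<in> I" and jJ: "hcomp N j \<in> J"
    using I J N by (simp_all add: homogeneous_ideal_def)
  have sum: "var 0 ^ N = hcomp N i + hcomp N j"
    using hcomp_var_power[of N 0 N] by (simp add: N(1) hcomp_add)
  show False
  proof (cases "c = 0")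
    case False
    have "hcomp N i * f - var 0 ^ N * const c * f \<in> Q"
      using ideal_mult_right[OF idlQ i, of f] by (simp add: algebra_simps)
    moreover have "hcomp N i * f \<in> Q"
      using iI by (simp add: I_def)
    ultimately have "var 0 ^ N * (const c * f) \<in> Q"
      using ideal_diff_cong[OF idlQ] by (simp add: mult.assoc)
    then show False
      using variable_power_regular const_cancel False f(2) by blast
  next
    case True
    then have "hcomp N i \<in> Q"
      using i by (simp add: ring_map_simps[OF ring_map_const])
    then have "var 0 ^ N \<in> J"
      unfolding sum using QJ jJ by (intro idl.subspace_add[OF idlJ]) auto
    moreover have "g \<in> I"
      using fg by (simp add: I_def mult.commute)
    ultimately show False
      using variable_power_regular g by (auto simp: J_def)
  qed
qed

theorem cone_ideal_prime: "is_prime Q"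
  unfolding is_prime_def
proof (intro conjI allI impI)
  have hQ: "homogeneous_ideal Q" by (rule homogeneous_cone_ideal)
  show "is_ideal Q" by (rule idlQ)
  show "1 \<notin> Q"
    using cone_ideal_kernel[OF ring_map_ev[of "\<lambda>_. 0"], of a b 1] ab
    by (auto simp: ev_power_sum ring_map_simps[OF ring_map_ev])
  fix f g assume fg: "f * g \<in> Q"
  show "f \<in> Q \<or> g \<in> Q"
  proof (rule ccontr)
    assume "\<not> ?thesis"
    then obtain d e where d: "is_top Q f d" and e: "is_top Q g e"
      using top_exists[OF idlQ] by blast
    have "hcomp (d + e) (f * g) - hcomp d f * hcomp e g \<in> Q"
      using d e by (intro hcomp_mult_top idlQ) (auto simp: is_top_def)
    moreover have "hcomp (d + e) (f * g) \<in> Q"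
      using fg hQ by (simp add: homogeneous_ideal_def)
    ultimately have "hcomp d f * hcomp e g \<in> Q"
      using ideal_diff_cong[OF idlQ] by blast
    then show False
      using no_homogeneous_zero_divisors[of d "hcomp d f" "hcomp e g"] d e
      by (simp add: is_top_def hcomp_hcomp)
  qed
qed

text \<open>The ideal of all \<open>e\<close> for which \<open>s\<close> divides \<open>e u\<close> is homogeneous and locally trivial, so it contains powers of
\<open>x\<^sub>0\<close> and \<open>x\<^sub>1\<close>. These form a regular sequence, and a fraction that has both as denominators lies in the
ring.\<close>

lemma homogeneous_almost_integral:
  assumes s: "hcomp \<sigma> s = s" "s \<notin> Q" and u: "hcomp \<delta> u = u" and c: "c \<notin> Q"
    and almost: "\<And>n. \<exists>r. c * u ^ n - s ^ n * r \<in> Q"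
  shows "\<exists>r. u - s * r \<in> Q"
proof -
  have hQ: "homogeneous_ideal Q" by (rule homogeneous_cone_ideal)
  let ?K = "{e. \<exists>r. e * u - s * r \<in> Q}"
  have K: "\<exists>N. var k ^ N \<in> ?K" for k
  proof (rule variable_power_in_ideal[OF homogeneous_colon[OF hQ s(1) u]])
    have "e * u - s * 0 \<in> Q" if "e \<in> Q" for e
      using ideal_mult_right[OF idlQ that] by simp
    then show "Q \<subseteq> ?K" by blast
    show "\<exists>c\<in>?K. line p c \<noteq> 0" if U: "uniformizer Q {f. line p f = 0} h \<pi>" for p h \<pi>
      using uniformizer.local_almost_integral[OF U cone_ideal_prime s(2) c almost] by auto
  qed
  obtain N r where N: "var 0 ^ N * u - s * r \<in> Q"
    using K[of 0] by blast
  obtain M r' where M: "var 1 ^ M * u - s * r' \<in> Q"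
    using K[of 1] by blast
  have "s * (var 1 ^ M * r - var 0 ^ N * r')
    = var 0 ^ N * (var 1 ^ M * u - s * r') + (- (var 1 ^ M)) * (var 0 ^ N * u - s * r)"
    by (simp add: algebra_simps)
  also have "\<dots> \<in> Q"
    by (intro ideal_lincomb2 idlQ M N)
  finally have "var 1 ^ M * r - var 0 ^ N * r' \<in> Q"
    using prime_mult_iff[OF cone_ideal_prime] s(2) by blast
  then obtain t where t: "r - var 0 ^ N * t \<in> Q"
    using variable_powers_regular_sequence[OF ab v2, of 1 0 M r N r'] by auto
  have "var 0 ^ N * (u - s * t) = 1 * (var 0 ^ N * u - s * r) + s * (r - var 0 ^ N * t)"
    by (simp add: algebra_simps)
  also have "\<dots> \<in> Q"
    by (intro ideal_lincomb2 idlQ N t)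
  finally show ?thesis
    using variable_power_regular by blast
qed

text \<open>The leading forms of \<open>c\<close>, \<open>u\<close> and \<open>s\<close> satisfy the same divisibilities, because leading forms are multiplicative
modulo the prime ideal \<open>Q\<close>. So the leading form of \<open>s\<close> divides that of \<open>u\<close>, and subtracting a multiple of \<open>s\<close>
lowers the degree of \<open>u\<close>. By the binomial theorem the difference is still almost integral with the
same \<open>c\<close>.\<close>

theorem almost_integral_in_ring:
  assumes s: "s \<notin> Q" and c: "c \<notin> Q" and almost: "\<And>n. \<exists>r. c * u ^ n - s ^ n * r \<in> Q"
  shows "\<exists>r. u - s * r \<in> Q"
proof -
  note prime = cone_ideal_prime
  have hQ: "homogeneous_ideal Q" by (rule homogeneous_cone_ideal)
  obtain \<sigma> where \<sigma>: "is_top Q s \<sigma>"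
    using top_exists[OF idlQ s] by blast
  obtain \<gamma> where \<gamma>: "is_top Q c \<gamma>"
    using top_exists[OF idlQ c] by blast
  have "\<exists>r. u - s * r \<in> Q"
    if "\<And>e. n \<le> e \<Longrightarrow> hcomp e u \<in> Q" "\<And>m. \<exists>r. c * u ^ m - s ^ m * r \<in> Q" for n u
    using that
  proof (induction n arbitrary: u)
    case 0
    then have "u - s * 0 \<in> Q"
      using mem_of_comps[OF idlQ, of u] by simp
    then show ?case by blast
  next
    case (Suc n)
    show ?case
    proof (cases "hcomp n u \<in> Q")
      case True
      then have "hcomp e u \<in> Q" if "n \<le> e" for e
        using that Suc.prems(1)[of e] by (cases "e = n") auto
      then show ?thesis
        using Suc.IH Suc.prems(2) by blast
    next
      case False
      then have top_u: "is_top Q u n"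
        using Suc.prems(1) by (auto simp: is_top_def Suc_le_eq)
      have "\<exists>r. hcomp \<gamma> c * hcomp n u ^ m - hcomp \<sigma> s ^ m * r \<in> Q" for m
      proof -
        obtain r where r: "c * u ^ m - s ^ m * r \<in> Q"
          using Suc.prems(2) by blast
        note pu = top_power[OF prime top_u, of m] and ps = top_power[OF prime \<sigma>, of m]
        note cu = top_mult[OF prime \<gamma> conjunct1[OF pu]]
        have "r \<notin> Q"
        proof
          assume "r \<in> Q"
          then have "c * u ^ m \<in> Q"
            using ideal_diff_cong[OF idlQ r] idl.subspace_scale[OF idlQ] by blast
          then have "hcomp (\<gamma> + m * n) (c * u ^ m) \<in> Q"
            using hQ by (simp add: homogeneous_ideal_def)
          then show False
            using cu(1) by (simp add: is_top_def)
        qed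
        then obtain \<rho> where \<rho>: "is_top Q r \<rho>"
          using top_exists[OF idlQ] by blast
        note sr = top_mult[OF prime conjunct1[OF ps] \<rho>]
        have deg: "\<gamma> + m * n = m * \<sigma> + \<rho>"
          using cu(1) sr(1) top_cong(1)[OF hQ r] top_unique by blast
        have 1: "hcomp \<gamma> c * hcomp (m * n) (u ^ m) - hcomp \<gamma> c * hcomp n u ^ m \<in> Q"
          using idl.subspace_scale[OF idlQ conjunct2[OF pu], of "hcomp \<gamma> c"] by (simp add: algebra_simps)
        have 2: "hcomp (m * \<sigma>) (s ^ m) * hcomp \<rho> r - hcomp \<sigma> s ^ m * hcomp \<rho> r \<in> Q"
          using ideal_mult_right[OF idlQ conjunct2[OF ps], of "hcomp \<rho> r"] by (simp add: algebra_simps)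
        have 3: "hcomp (\<gamma> + m * n) (c * u ^ m) - hcomp (\<gamma> + m * n) (s ^ m * r) \<in> Q"
          by (rule top_cong(2)[OF hQ r])
        have "hcomp \<gamma> c * hcomp n u ^ m - hcomp (\<gamma> + m * n) (c * u ^ m) \<in> Q"
          using ideal_cong_sym[OF idlQ ideal_cong_trans[OF idlQ cu(2) 1]] .
        moreover have "hcomp (\<gamma> + m * n) (s ^ m * r) - hcomp \<sigma> s ^ m * hcomp \<rho> r \<in> Q"
          using ideal_cong_trans[OF idlQ sr(2) 2] by (simp add: deg)
        ultimately show ?thesis
          using ideal_cong_trans[OF idlQ ideal_cong_trans[OF idlQ _ 3]] by blast
      qed
      then obtain t where t: "hcomp n u - hcomp \<sigma> s * t \<in> Q"
        using homogeneous_almost_integral[of \<sigma> "hcomp \<sigma> s" n "hcomp n u" "hcomp \<gamma> c"] \<sigma> \<gamma>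
        by (auto simp: is_top_def hcomp_hcomp)
      have "hcomp n (hcomp n u - hcomp \<sigma> s * t) \<in> Q"
        using t hQ by (simp add: homogeneous_ideal_def)
      then have lead: "hcomp n u - (if \<sigma> \<le> n then hcomp \<sigma> s * hcomp (n - \<sigma>) t else 0) \<in> Q"
        by (simp add: hcomp_diff hcomp_hcomp hcomp_hcomp_mult)
      then have le: "\<sigma> \<le> n"
        using False by (auto split: if_splits)
      define t' where "t' = hcomp (n - \<sigma>) t"
      have lead': "hcomp n u - hcomp \<sigma> s * t' \<in> Q"
        using lead le by (simp add: t'_def)
      let ?u = "u - s * t'"
      have comp: "hcomp e (s * t') = hcomp (e - (n - \<sigma>)) s * t'" if "n \<le> e" for e
        using hcomp_hcomp_mult[of e "n - \<sigma>" t s] that by (simp add: t'_def mult.commute)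
      have high: "hcomp e ?u \<in> Q" if "n \<le> e" for e
      proof (cases "e = n")
        case True
        then show ?thesis
          using lead' le comp[of n] by (simp add: hcomp_diff)
      next
        case False
        then have "hcomp (e - (n - \<sigma>)) s \<in> Q"
          using \<sigma> that le by (auto simp: is_top_def)
        then show ?thesis
          using Suc.prems(1)[of e] False that unfolding hcomp_diff comp[OF that]
          by (intro idl.subspace_diff[OF idlQ] ideal_mult_right[OF idlQ]) auto
      qed
      obtain R where R: "\<And>m. c * u ^ m - s ^ m * R m \<in> Q"
        using Suc.prems(2) by metis
      have almost': "\<exists>r. c * ?u ^ m - s ^ m * r \<in> Q" for m
      proof
        let ?C = "\<lambda>i. of_nat (m choose i) * (- t') ^ (m - i)"
        have "c * ?u ^ m - s ^ m * (\<Sum>i\<le>m. ?C i * R i)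
          = (\<Sum>i\<le>m. c * (of_nat (m choose i) * u ^ i * (- (s * t')) ^ (m - i)) - s ^ m * (?C i * R i))"
          using binomial_ring[of u "- (s * t')" m] by (simp add: sum_distrib_left sum_subtractf)
        also have "\<dots> = (\<Sum>i\<le>m. ?C i * s ^ (m - i) * (c * u ^ i - s ^ i * R i))"
        proof (intro sum.cong refl)
          fix i assume "i \<in> {..m}"
          then have "s ^ m = s ^ (m - i) * s ^ i"
            by (simp flip: power_add)
          moreover have "(- (s * t')) ^ (m - i) = s ^ (m - i) * (- t') ^ (m - i)"
            by (simp flip: power_mult_distrib)
          ultimately show "c * (of_nat (m choose i) * u ^ i * (- (s * t')) ^ (m - i)) - s ^ m * (?C i * R i)
            = ?C i * s ^ (m - i) * (c * u ^ i - s ^ i * R i)"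
            by (simp only:) (simp add: algebra_simps)
        qed
        also have "\<dots> \<in> Q"
          by (intro idl.subspace_sum[OF idlQ] idl.subspace_scale[OF idlQ] R)
        finally show "c * ?u ^ m - s ^ m * (\<Sum>i\<le>m. ?C i * R i) \<in> Q" .
      qed
      obtain r where "?u - s * r \<in> Q"
        using Suc.IH[OF high almost'] by blast
      then have "u - s * (t' + r) \<in> Q"
        by (simp add: algebra_simps)
      then show ?thesis by blast
    qed
  qed
  moreover have "hcomp e u \<in> Q" if "Suc (degree (grade u)) \<le> e" for e
    using that by (simp add: hcomp_eq_0 idl.subspace_0[OF idlQ])
  ultimately show ?thesis
    using almost by blast
qed

end

section \<open>The singular case\<close>

text \<open>Elements of the ideal have no linear part, unless \<open>a = 1\<close>, when it is a multiple of the sum of the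
variables. This certifies that certain linear forms are not in the ideal.\<close>

lemma linear_part_zero:
  assumes ab: "0 < a" "a < b" and f: "f \<in> cone_ideal a b" and p: "a = 1 \<Longrightarrow> (\<Sum>i\<in>UNIV. p i) = 0"
  shows "ev p (hcomp 1 f) = 0"
proof -
  have low: "ev p (hcomp 1 (u * power_sum n)) = 0" if "0 < n" "n = 1 \<Longrightarrow> (\<Sum>i\<in>UNIV. p i) = 0" for u n
  proof -
    have "hcomp 1 (u * power_sum n) = (if n \<le> 1 then power_sum n * hcomp (1 - n) u else 0)"
      using hcomp_hcomp_mult[of 1 n "power_sum n" u] by (simp add: hcomp_power_sum mult.commute)
    moreover have "n = 1" if "n \<le> 1"
      using that \<open>0 < n\<close> by simp
    ultimately show ?thesis
      using that(2) by (auto simp: ring_map_simps[OF ring_map_ev] ev_power_sum)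
  qed
  obtain u v where "f = u * power_sum a + v * power_sum b"
    using f by (auto simp: mem_cone_ideal_iff)
  then show ?thesis
    using low[of a u] low[of b v] ab p by (simp add: hcomp_add ring_map_simps[OF ring_map_ev])
qed

text \<open>If \<open>\<zeta> ^ a = \<zeta> ^ b = -1\<close>, both power sums lie in the ideal of the plane \<open>L = M = 0\<close> with
\<open>L = x\<^sub>0 - \<zeta> x\<^sub>1\<close> and \<open>M = x\<^sub>2 - \<zeta> x\<^sub>3\<close>. By Cramer's rule the determinant \<open>e\<close> of their coefficients satisfies
\<open>e L \<in> Q\<close>. It does not vanish at \<open>(\<zeta>, 1, 2 \<zeta>, 2)\<close>, a point of the plane, so a prime ideal \<open>Q\<close>
would contain \<open>L\<close>, but the linear part of \<open>L\<close> does not vanish at \<open>(1, 0, -1, 0)\<close>.\<close>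

lemma plane_component:
  assumes ab: "0 < a" "a < b" and v2: "multiplicity 2 a < multiplicity 2 (b - a)"
  shows "\<not> is_prime (cone_ideal a b)"
proof
  assume prime: "is_prime (cone_ideal a b)"
  obtain z :: complex where z: "z ^ (b - a) = 1" "(z ^ a)\<^sup>2 = 1" "z ^ a \<noteq> 1"
    using exists_root_of_unity[of 2 a "b - a"] ab v2 by auto
  have za: "z ^ a = - 1"
    using z(2,3) by (simp add: power2_eq_1_iff)
  have zb: "z ^ b = - 1"
    using ab z(1) za power_add[of z a "b - a"] by simp
  define L where "L = var 0 - const z * var 1"
  define M where "M = var 2 - const z * var 3"
  define A where "A n = power_quotient n (var 0) (const z * var 1)" for n
  define B where "B n = power_quotient n (var 2) (const z * var 3)" for n
  define e where "e = A a * B b - A b * B a"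
  have exp: "power_sum n = L * A n + M * B n" if "z ^ n = - 1" for n
  proof -
    have "const z ^ n = - 1"
      using arg_cong[OF that, of const] by (simp add: ring_map_simps[OF ring_map_const])
    then show ?thesis
      unfolding L_def M_def A_def B_def power_quotient
      by (simp add: power_sum_def sum_index4 power_mult_distrib)
  qed
  have "e * L = B b * power_sum a + (- B a) * power_sum b"
    unfolding e_def exp[OF za] exp[OF zb] by (simp add: algebra_simps)
  then have eL: "e * L \<in> cone_ideal a b"
    by (simp only: cone_ideal_lincomb)
  define p :: "4 \<Rightarrow> complex" where "p = (\<lambda>i. if i = 0 then z else if i = 1 then 1 else if i = 2 then 2 * z else 2)"
  have ps: "ev p (power_sum n) = 0" if "z ^ n = - 1" for n
    using that by (simp add: ev_power_sum sum_index4 p_def power_mult_distrib)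
  have evA: "ev p (A n) = of_nat n * z ^ (n - 1)" "ev p (B n) = of_nat n * (2 * z) ^ (n - 1)" for n
    unfolding A_def B_def
    by (subst power_quotient_hom[OF ring_map_ev]; simp add: ring_map_simps[OF ring_map_ev] ev_const ev_var p_def)+
  have "ev p e = of_nat a * of_nat b * (z ^ (a - 1) * z ^ (b - 1)) * (2 ^ (b - 1) - 2 ^ (a - 1))"
    by (simp add: e_def ring_map_simps[OF ring_map_ev] evA power_mult_distrib algebra_simps)
  moreover have "z \<noteq> 0"
    using za ab by (auto simp: power_0_left)
  moreover have "(2::complex) ^ (b - 1) \<noteq> 2 ^ (a - 1)"
  proof
    assume "(2::complex) ^ (b - 1) = 2 ^ (a - 1)"
    then have "norm ((2::complex) ^ (b - 1)) = norm ((2::complex) ^ (a - 1))"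
      by (simp only:)
    then have "(2::real) ^ (b - 1) = 2 ^ (a - 1)"
      by (simp only: norm_power norm_numeral)
    then show False
      using ab by simp
  qed
  ultimately have "ev p e \<noteq> 0"
    using ab by simp
  then have "e \<notin> cone_ideal a b"
    using cone_ideal_kernel[OF ring_map_ev ps[OF za] ps[OF zb]] by blast
  then have L: "L \<in> cone_ideal a b"
    using eL prime_mult_iff[OF prime] by blast
  let ?q = "\<lambda>i::4. if i = 0 then 1 else if i = 2 then - 1 else (0::complex)"
  have "ev ?q (hcomp 1 L) = 0"
    by (rule linear_part_zero[OF ab L]) (simp add: sum_index4)
  then show False
    by (simp add: L_def hcomp_diff hcomp_var hcomp_const_mult_var[unfolded One_nat_def]
        ring_map_simps[OF ring_map_ev] ev_var)
qed

text \<open>Modulo \<open>x\<^sub>3\<close> the power sums lie in the ideal \<open>(y\<^sub>1, y\<^sub>2)\<close> of the point \<open>(1, \<zeta>, \<zeta>\<^sup>2)\<close>; let \<open>u\<close> be the determinant of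
their coefficients. By Cramer's rule, \<open>u y\<^sub>1\<close> and \<open>u y\<^sub>2\<close> are in \<open>Q + (x\<^sub>3\<^sup>2)\<close>, since the powers
\<open>x\<^sub>3 ^ a\<close> and \<open>x\<^sub>3 ^ b\<close> are multiples of \<open>x\<^sub>3\<^sup>2\<close>. As the point is singular, \<open>u\<close> vanishes there, so
\<open>u \<in> (y\<^sub>1, y\<^sub>2)\<close> and \<open>u\<^sup>2 \<in> Q + (x\<^sub>3\<^sup>2)\<close>. On the other hand, \<open>u \<in> Q + (x\<^sub>3)\<close> would yield a syzygy of the power
sums modulo \<open>x\<^sub>3\<close>, which is trivial by coprimality; restricted to a line on which \<open>y\<^sub>1\<close> vanishes, it says
that the coefficient \<open>A\<close> of \<open>y\<^sub>2\<close> in the first power sum satisfies \<open>A (1 + w y\<^sub>2) = 0\<close>, although \<open>A\<close> is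
nonzero and \<open>y\<^sub>2\<close> is not a unit.\<close>

lemma double_point:
  assumes ab: "1 < a" "a < b" and v2: "\<not> multiplicity 2 a < multiplicity 2 (b - a)"
    and v3: "multiplicity 3 a < multiplicity 3 (b - a)"
  shows "\<exists>u r. u\<^sup>2 - (var 3)\<^sup>2 * r \<in> cone_ideal a b \<and> (\<forall>t. u - var 3 * t \<notin> cone_ideal a b)"
    and "var 3 \<notin> cone_ideal a b"
proof -
  have a0: "0 < a" using ab by simp
  show "var 3 \<notin> cone_ideal a b"
  proof
    assume "var 3 \<in> cone_ideal a b"
    then have "ev (\<lambda>_. 1) (hcomp 1 (var 3)) = 0"
      by (rule linear_part_zero[OF a0 ab(2)]) (use ab in simp)
    then show False
      by (simp add: hcomp_var ev_var)
  qed
  obtain z :: complex where z: "z ^ (b - a) = 1" "(z ^ a) ^ 3 = 1" "z ^ a \<noteq> 1"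
    using exists_root_of_unity[of 3 a "b - a"] ab v3 by auto
  have "(z ^ a - 1) * (1 + z ^ a + (z ^ a)\<^sup>2) = (z ^ a) ^ 3 - 1"
    by (simp add: algebra_simps power2_eq_square power3_eq_cube)
  then have za: "1 + z ^ a + (z ^ a)\<^sup>2 = 0"
    using z(2,3) by simp
  have zab: "z ^ b = z ^ a"
    using ab z(1) power_add[of z a "b - a"] by simp
  have z0: "z \<noteq> 0"
    using z(1) ab by (auto simp: power_0_left)
  have zab1: "z ^ (b - 1) = z ^ (a - 1)"
    using ab z(1) power_add[of z "a - 1" "b - a"] by simp
  define p :: "4 \<Rightarrow> complex" where "p = (\<lambda>i. if i = 0 then 1 else if i = 1 then z else if i = 2 then z\<^sup>2 else 0)"
  define y where "y m = var m - const (p m) * var 0" for m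
  define A where "A n m = power_quotient n (var m) (const (p m) * var 0)" for n m
  define u where "u = A a 1 * A b 2 - A a 2 * A b 1"
  have exp: "power_sum n = y 1 * A n 1 + y 2 * A n 2 + var 3 ^ n" if n: "z ^ n = z ^ a" "0 < n" for n
  proof -
    have "(\<Sum>j\<in>UNIV. p j ^ n) = 1 + z ^ n + (z ^ n)\<^sup>2"
      using n by (simp add: sum_index4 p_def power_0_left add.assoc power2_eq_square power_mult_distrib)
    then have "(\<Sum>j\<in>UNIV. p j ^ n) = 0"
      using za n by simp
    then have "power_sum n = (\<Sum>j\<in>UNIV. y j * A n j)"
      using power_sum_expansion[of p n 0] by (simp add: y_def A_def)
    moreover have "y 0 = 0"
      by (simp add: y_def p_def ring_map_simps[OF ring_map_const])
    moreover have "y 3 * A n 3 = var 3 ^ n"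
      using n unfolding y_def A_def power_quotient by (simp add: p_def ring_map_simps[OF ring_map_const] power_0_left)
    ultimately show ?thesis
      by (simp add: sum_index4 add.assoc)
  qed
  note expa = exp[OF refl a0] and expb = exp[OF zab less_trans[OF a0 ab(2)]]
  obtain a' b' where a': "a = Suc (Suc a')" and b': "b = Suc (Suc b')"
    using ab by (metis less_imp_Suc_add add_Suc add_Suc_right One_nat_def less_trans)
  have x: "var 3 ^ a = (var 3)\<^sup>2 * var 3 ^ a'" "var 3 ^ b = (var 3)\<^sup>2 * var 3 ^ b'"
    unfolding a' b' by (simp_all add: power2_eq_square mult.assoc)
  have uy: "\<exists>r. u * y m - (var 3)\<^sup>2 * r \<in> cone_ideal a b" if "m \<in> {1, 2}" for m
  proof -
    have "u * y 1 - (var 3)\<^sup>2 * (A a 2 * var 3 ^ b' - A b 2 * var 3 ^ a')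
      = A b 2 * power_sum a + (- A a 2) * power_sum b"
      unfolding u_def expa expb x by (simp add: algebra_simps)
    then have 1: "u * y 1 - (var 3)\<^sup>2 * (A a 2 * var 3 ^ b' - A b 2 * var 3 ^ a') \<in> cone_ideal a b"
      by (simp only: cone_ideal_lincomb)
    have "u * y 2 - (var 3)\<^sup>2 * (A b 1 * var 3 ^ a' - A a 1 * var 3 ^ b')
      = (- A b 1) * power_sum a + A a 1 * power_sum b"
      unfolding u_def expa expb x by (simp add: algebra_simps)
    then have 2: "u * y 2 - (var 3)\<^sup>2 * (A b 1 * var 3 ^ a' - A a 1 * var 3 ^ b') \<in> cone_ideal a b"
      by (simp only: cone_ideal_lincomb)
    show ?thesis
      using 1 2 that by blast
  qed
  have u_in: "u \<in> ideal_span {y 1, y 2}"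
  proof -
    define \<theta> where "\<theta> = subst const (\<lambda>m. if m = 3 then var 3 else const (p m) * var 0)"
    note \<theta> = ring_map_subst[OF ring_map_const, of "\<lambda>m. if m = 3 then var 3 else const (p m) * var 0", folded \<theta>_def]
    have \<theta>_simps: "\<theta> (const c) = const c" "\<theta> (var m) = (if m = 3 then var 3 else const (p m) * var 0)" for c m
      by (simp_all add: \<theta>_def subst_const[OF ring_map_const] subst_var[OF ring_map_const])
    have "f - \<theta> f \<in> ideal_span {y 1, y 2}" for f
    proof (induction f rule: poly4_induct)
      case (var m)
      have "y m \<in> ideal_span {y 1, y 2}" if "m \<noteq> 3"
      proof -
        have "m = 0 \<or> m = 1 \<or> m = 2"
          using exhaust_index4[of m] that by auto
        moreover have "y 0 = 0"
          by (simp add: y_def p_def ring_map_simps[OF ring_map_const])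
        ultimately show ?thesis
          by (auto intro: idl.span_base simp: idl.span_zero)
      qed
      then show ?case
        by (auto simp: \<theta>_simps y_def idl.span_zero)
    next
      case (add f g)
      then show ?case
        using idl.subspace_add[OF idl.subspace_span add] by (simp add: ring_map_simps[OF \<theta>] algebra_simps)
    next
      case (mult f g)
      then show ?case
        using ideal_lincomb2[OF idl.subspace_span mult, of g "\<theta> f"]
        by (simp add: ring_map_simps[OF \<theta>] algebra_simps)
    qed (simp add: \<theta>_simps idl.span_zero)
    moreover have "\<theta> u = 0"
    proof -
      have A: "\<theta> (A n m) = of_nat n * (const (p m) * var 0) ^ (n - 1)" if "m \<noteq> 3" for n m
        unfolding A_def using that
        by (subst power_quotient_hom[OF \<theta>]) (simp_all add: ring_map_simps[OF \<theta>] \<theta>_simps p_def ring_map_simps[OF ring_map_const])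
      have "p 1 ^ (a - 1) * p 2 ^ (b - 1) = p 2 ^ (a - 1) * p 1 ^ (b - 1)"
        using zab1 by (simp add: p_def power2_eq_square power_mult_distrib)
      then have "const (p 1) ^ (a - 1) * const (p 2) ^ (b - 1) = const (p 2) ^ (a - 1) * const (p 1) ^ (b - 1)"
        by (metis ring_map_simps(3,7)[OF ring_map_const])
      then have "const (p 1) ^ (a - 1) * const (p 2) ^ (b - 1) * K = const (p 2) ^ (a - 1) * const (p 1) ^ (b - 1) * K" for K
        by simp
      from this[of "of_nat a * of_nat b * var 0 ^ (a - 1) * var 0 ^ (b - 1)"] show ?thesis
        by (simp add: u_def ring_map_simps[OF \<theta>] A power_mult_distrib ac_simps)
    qed
    ultimately show ?thesis
      by (metis diff_zero)
  qed
  have sq: "\<exists>r. u\<^sup>2 - (var 3)\<^sup>2 * r \<in> cone_ideal a b"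
  proof -
    obtain \<alpha> \<beta> where "u - \<alpha> * y 1 = \<beta> * y 2"
      using u_in by (auto simp: idl.span_insert[of _ "{y 2}"] ideal_span_singleton)
    then have u: "u = \<alpha> * y 1 + \<beta> * y 2"
      by (simp add: algebra_simps)
    obtain r s where r: "u * y 1 - (var 3)\<^sup>2 * r \<in> cone_ideal a b" and s: "u * y 2 - (var 3)\<^sup>2 * s \<in> cone_ideal a b"
      using uy by blast
    have "u\<^sup>2 = u * (\<alpha> * y 1 + \<beta> * y 2)"
      by (simp add: power2_eq_square flip: u)
    then have "u\<^sup>2 - (var 3)\<^sup>2 * (\<alpha> * r + \<beta> * s) = \<alpha> * (u * y 1 - (var 3)\<^sup>2 * r) + \<beta> * (u * y 2 - (var 3)\<^sup>2 * s)"
      by (simp add: algebra_simps)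
    also have "\<dots> \<in> cone_ideal a b"
      by (intro ideal_lincomb2 is_ideal_cone_ideal r s)
    finally show ?thesis by blast
  qed
  have "u - var 3 * t \<notin> cone_ideal a b" for t
  proof
    assume "u - var 3 * t \<in> cone_ideal a b"
    then obtain \<alpha> \<beta> where u: "u - var 3 * t = \<alpha> * power_sum a + \<beta> * power_sum b"
      by (auto simp: mem_cone_ideal_iff)
    have uy1: "u * y 1 = A b 2 * (power_sum a - var 3 ^ a) - A a 2 * (power_sum b - var 3 ^ b)"
      unfolding u_def expa expb by (simp add: algebra_simps)
    have "(\<alpha> * y 1 - A b 2) * power_sum a + (\<beta> * y 1 + A a 2) * power_sum b
      = (u - var 3 * t) * y 1 - A b 2 * power_sum a + A a 2 * power_sum b"
      unfolding u by (simp add: algebra_simps)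
    also have "\<dots> = u * y 1 - A b 2 * power_sum a + A a 2 * power_sum b - var 3 * t * y 1"
      by (simp add: algebra_simps)
    also have "\<dots> = (A a 2 * var 3 ^ Suc b' - A b 2 * var 3 ^ Suc a' - t * y 1) * (var 3 - const 0 * var 0)"
      unfolding uy1 x by (simp add: algebra_simps power2_eq_square ring_map_simps[OF ring_map_const])
    finally have "(\<alpha> * y 1 - A b 2) * power_sum a + (\<beta> * y 1 + A a 2) * power_sum b
      \<in> ideal_span {var 3 - const 0 * var 0}"
      unfolding ideal_span_singleton by blast
    from power_sum_syzygy_mod_linear[OF a0 ab(2) v2 _ this] obtain w x
      where w: "\<beta> * y 1 + A a 2 + w * power_sum a = x * (var 3 - const 0 * var 0)"
      unfolding ideal_span_singleton by auto
    \<comment> \<open>restriction to the line through the double point along which only the third coordinate moves\<close>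
    define \<eta> :: "4 \<Rightarrow> complex poly"
      where "\<eta> = (\<lambda>m. if m = 2 then [:0, 1:] else [:p m:])"
    define \<theta> where "\<theta> = subst (\<lambda>c. [:c:]) \<eta>"
    note hk = ring_map_const_poly[OF ring_map_id]
    note \<theta> = ring_map_subst[OF hk, of \<eta>, folded \<theta>_def]
    have \<theta>_simps: "\<theta> (const c) = [:c:]" "\<theta> (var m) = \<eta> m" for c m
      by (simp_all add: \<theta>_def subst_const[OF hk] subst_var[OF hk])
    have y1: "\<theta> (y 1) = 0" and y2: "\<theta> (y 2) = [:- z\<^sup>2, 1:]" and v3: "\<theta> (var 3) = 0"
      by (simp_all add: y_def ring_map_simps[OF \<theta>] \<theta>_simps \<eta>_def p_def)
    have "\<theta> (A a 2) + \<theta> w * (\<theta> (y 2) * \<theta> (A a 2)) = 0"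
      using arg_cong[OF w, of \<theta>] a0 by (simp add: ring_map_simps[OF \<theta>] expa y1 v3 \<theta>_simps \<eta>_def p_def power_0_left)
    then have "\<theta> (A a 2) * (1 + \<theta> w * \<theta> (y 2)) = 0"
      by (simp add: algebra_simps)
    moreover have "1 + \<theta> w * \<theta> (y 2) \<noteq> 0"
    proof
      assume "1 + \<theta> w * \<theta> (y 2) = 0"
      then have "poly (1 + \<theta> w * \<theta> (y 2)) (z\<^sup>2) = 0"
        by (simp only: poly_0)
      then show False
        by (simp add: y2)
    qed
    moreover have "poly (\<theta> (A a 2)) (z\<^sup>2) = of_nat a * (z\<^sup>2) ^ (a - 1)"
    proof -
      have hom: "ring_map (\<lambda>f. poly (\<theta> f) (z\<^sup>2))"
        using \<theta> by (simp add: ring_map_def)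
      show ?thesis
        unfolding A_def by (subst power_quotient_hom[OF hom]) (simp_all add: ring_map_simps[OF \<theta>] \<theta>_simps \<eta>_def p_def)
    qed
    then have "\<theta> (A a 2) \<noteq> 0"
      using z0 a0 by auto
    ultimately show False
      by simp
  qed
  with sq show "\<exists>u r. u\<^sup>2 - (var 3)\<^sup>2 * r \<in> cone_ideal a b \<and> (\<forall>t. u - var 3 * t \<notin> cone_ideal a b)"
    by blast
qed

section \<open>Normality of a quotient ring in terms of representatives\<close>

lemma ring_of_type_algebra_simps:
  "carrier (ring_of_type_algebra :: 'a::comm_ring_1 ring) = UNIV"
  "x \<otimes>\<^bsub>ring_of_type_algebra\<^esub> y = (x * y :: 'a)" "x \<oplus>\<^bsub>ring_of_type_algebra\<^esub> y = (x + y :: 'a)"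
  "\<one>\<^bsub>ring_of_type_algebra\<^esub> = (1 :: 'a)" "\<zero>\<^bsub>ring_of_type_algebra\<^esub> = (0 :: 'a)"
  by (simp_all add: ring_of_type_algebra_def)

lemma ring_of_type_algebra_minus:
  "x \<ominus>\<^bsub>ring_of_type_algebra\<^esub> y = (x - y :: 'a::comm_ring_1)"
proof -
  interpret cring "ring_of_type_algebra :: 'a ring" by (rule cring_from_type_algebra)
  have "\<ominus>\<^bsub>ring_of_type_algebra\<^esub> y = - y"
    by (rule minus_equality) (simp_all add: ring_of_type_algebra_simps)
  then show ?thesis
    by (simp add: a_minus_def ring_of_type_algebra_simps)
qed

lemma ideal_ring_of_type_algebra:
  "ideal I (ring_of_type_algebra :: 'a::comm_ring_1 ring) \<longleftrightarrow> is_ideal I"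
proof
  assume "ideal I (ring_of_type_algebra :: 'a ring)"
  then interpret ideal I "ring_of_type_algebra :: 'a ring" .
  show "is_ideal I"
    unfolding idl.subspace_def
    using additive_subgroup.zero_closed[OF is_additive_subgroup]
      additive_subgroup.a_closed[OF is_additive_subgroup] I_l_closed by (simp add: ring_of_type_algebra_simps)
next
  assume I: "is_ideal I"
  interpret cring "ring_of_type_algebra :: 'a ring" by (rule cring_from_type_algebra)
  have "\<ominus>\<^bsub>ring_of_type_algebra\<^esub> x = - x" for x :: 'a
    by (rule minus_equality) (simp_all add: ring_of_type_algebra_simps)
  then have "subgroup I (add_monoid (ring_of_type_algebra :: 'a ring))"
    using I by (intro add.subgroupI)
      (auto simp: ring_of_type_algebra_simps idl.subspace_add idl.subspace_neg a_inv_def[symmetric]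
        dest: idl.subspace_0)
  then show "ideal I (ring_of_type_algebra :: 'a ring)"
    using I ring_axioms by (intro idealI)
      (auto simp: ring_of_type_algebra_simps idl.subspace_scale ideal_mult_right)
qed

lemma genideal_ring_of_type_algebra:
  "Idl\<^bsub>ring_of_type_algebra\<^esub> A = ideal_span (A :: 'a::comm_ring_1 set)"
proof -
  interpret cring "ring_of_type_algebra :: 'a ring" by (rule cring_from_type_algebra)
  show ?thesis
  proof
    show "Idl\<^bsub>ring_of_type_algebra\<^esub> A \<subseteq> ideal_span A"
      by (rule genideal_minimal) (simp_all add: ideal_ring_of_type_algebra idl.span_superset)
    have "ideal (Idl\<^bsub>ring_of_type_algebra\<^esub> A) (ring_of_type_algebra :: 'a ring)"
      by (rule genideal_ideal) (simp add: ring_of_type_algebra_simps)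
    then show "ideal_span A \<subseteq> Idl\<^bsub>ring_of_type_algebra\<^esub> A"
      by (intro idl.span_minimal genideal_self) (simp_all add: ideal_ring_of_type_algebra ring_of_type_algebra_simps)
  qed
qed

text \<open>If \<open>x\<close> is integral over \<open>A\<close> of degree \<open>m\<close>, then all powers of \<open>x\<close> are \<open>A\<close>-linear combinations of the first
\<open>m\<close>, and so they have a common denominator, a power of the denominator of \<open>x\<close>.\<close>

lemma (in cring) monic_root_denominators:
  assumes A: "subring A R" and x: "x \<in> carrier R" and d: "d \<in> A" "d \<otimes> x \<in> A"
    and p: "set p \<subseteq> A" "p \<noteq> []" "hd p = \<one>" "eval p x = \<zero>"
  shows "d [^] length p \<otimes> x [^] (n::nat) \<in> A"
proof -
  note AE = subringE[OF A]
  have carr: "y \<in> carrier R" if "y \<in> A" for y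
    using that AE(1) by blast
  have pow: "y [^] (k::nat) \<in> A" if "y \<in> A" for y k
    using that by (induction k) (auto intro: AE)
  define M where "M = length p"
  obtain q where q: "p = \<one> # q"
    using p(2,3) by (cases p) auto
  have dM: "d [^] M \<in> carrier R"
    using d(1) carr by simp
  have tail: "d [^] M \<otimes> x [^] (k::nat) \<otimes> eval r x \<in> A"
    if "set r \<subseteq> A" "\<And>j. j < k + length r \<Longrightarrow> d [^] M \<otimes> x [^] j \<in> A" for r k
    using that
  proof (induction r)
    case Nil
    then show ?case using dM x AE(2) by simp
  next
    case (Cons c r)
    have c: "c \<in> A" and r: "set r \<subseteq> carrier R"
      using Cons.prems(1) AE(1) by auto
    have e: "eval r x \<in> carrier R"
      using r x by (rule eval_in_carrier)
    have "d [^] M \<otimes> x [^] k \<otimes> eval (c # r) x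
      = c \<otimes> (d [^] M \<otimes> x [^] (k + length r)) \<oplus> d [^] M \<otimes> x [^] k \<otimes> eval r x"
      using carr[OF c] dM x e by (simp add: r_distr m_ac nat_pow_mult[symmetric])
    also have "\<dots> \<in> A"
      using Cons c by (intro AE(7) AE(6)[OF c]) auto
    finally show ?case .
  qed
  show ?thesis
    unfolding M_def[symmetric]
  proof (induction n rule: less_induct)
    case (less n)
    show ?case
    proof (cases "n \<le> M")
      case True
      have "d [^] M \<otimes> x [^] n = d [^] (M - n) \<otimes> (d \<otimes> x) [^] n"
      proof -
        have "d [^] M = d [^] (M - n) \<otimes> d [^] n"
          using True carr[OF d(1)] by (simp add: nat_pow_mult)
        then show ?thesis
          using carr[OF d(1)] x by (simp add: nat_pow_distrib m_assoc)
      qed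
      also have "\<dots> \<in> A"
        by (intro AE pow d)
      finally show ?thesis .
    next
      case False
      define m where "m = length q"
      have M: "M = Suc m"
        by (simp add: M_def q m_def)
      define k where "k = n - m"
      have n: "n = k + m"
        using False M by (simp add: k_def)
      have qA: "set q \<subseteq> A"
        using p(1) q by simp
      have e: "eval q x \<in> carrier R"
        using qA AE(1) x by (intro eval_in_carrier) auto
      have root: "x [^] m \<oplus> eval q x = \<zero>"
        using p(4) x by (simp add: q m_def)
      have "d [^] M \<otimes> x [^] k \<otimes> eval q x \<in> A"
        using qA less.IH by (intro tail) (auto simp: n m_def)
      moreover have "d [^] M \<otimes> x [^] n = \<ominus> (d [^] M \<otimes> x [^] k \<otimes> eval q x)"
      proof -
        have "x [^] m = \<ominus> (eval q x)"
          using root e x by (simp add: minus_equality[symmetric] a_comm)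
        then have "d [^] M \<otimes> x [^] n = d [^] M \<otimes> x [^] k \<otimes> \<ominus> (eval q x)"
          using dM x e by (simp add: n nat_pow_mult[symmetric] m_assoc)
        then show ?thesis
          using dM x e by (simp add: r_minus)
      qed
      ultimately show ?thesis
        using AE(5) by simp
    qed
  qed
qed

context
  fixes Q :: "'a::comm_ring_1 set"
  assumes Q: "is_ideal Q"
begin

private abbreviation (input) "S \<equiv> ring_of_type_algebra :: 'a ring"
private abbreviation (input) "R \<equiv> S Quot Q"
private definition cls where "cls f = Q +>\<^bsub>S\<^esub> f"

private lemma ideal_Q: "ideal Q S"
  by (simp add: ideal_ring_of_type_algebra Q)

private lemma cls_eq_iff: "cls f = cls g \<longleftrightarrow> f - g \<in> Q"
proof -
  interpret cring S by (rule cring_from_type_algebra)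
  show ?thesis
    using quotient_eq_iff_same_a_r_cos[OF ideal_Q, of f g]
    by (simp add: cls_def ring_of_type_algebra_simps ring_of_type_algebra_minus)
qed

private lemma cls_simps:
  "cls f \<otimes>\<^bsub>R\<^esub> cls g = cls (f * g)" "cls f \<oplus>\<^bsub>R\<^esub> cls g = cls (f + g)"
  "\<one>\<^bsub>R\<^esub> = cls 1" "\<zero>\<^bsub>R\<^esub> = cls 0" "cls f \<in> carrier R"
proof -
  interpret ideal Q S by (rule ideal_Q)
  note hom = rcos_ring_hom
  show "cls f \<otimes>\<^bsub>R\<^esub> cls g = cls (f * g)" "cls f \<oplus>\<^bsub>R\<^esub> cls g = cls (f + g)"
    "\<one>\<^bsub>R\<^esub> = cls 1" "cls f \<in> carrier R"
    using ring_hom_mult[OF hom, of f g] ring_hom_add[OF hom, of f g] ring_hom_one[OF hom]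
      ring_hom_closed[OF hom, of f]
    by (simp_all add: cls_def ring_of_type_algebra_simps)
  interpret h: ring_hom_ring S R "(+>\<^bsub>S\<^esub>) Q"
    by (rule rcos_ring_hom_ring)
  show "\<zero>\<^bsub>R\<^esub> = cls 0"
    using h.hom_zero by (simp add: cls_def ring_of_type_algebra_simps)
qed

private lemma cls_surj: "U \<in> carrier R \<Longrightarrow> \<exists>f. U = cls f"
  by (auto simp: cls_def FactRing_def A_RCOSETS_def' ring_of_type_algebra_simps)

private lemma cls_pow:
  assumes "cring R"
  shows "cls f [^]\<^bsub>R\<^esub> (n::nat) = cls (f ^ n)"
proof -
  interpret cring R by (rule assms)
  show ?thesis
    by (induction n) (simp_all add: cls_simps(1,3) mult.commute)
qed

lemma domain_quotient_iff: "domain R \<longleftrightarrow> is_prime Q"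
proof
  assume "domain R"
  then interpret domain R .
  have zero: "cls f = \<zero>\<^bsub>R\<^esub> \<longleftrightarrow> f \<in> Q" for f
    by (simp add: cls_simps(4) cls_eq_iff)
  show "is_prime Q"
    unfolding is_prime_def
  proof (intro conjI allI impI)
    show "1 \<notin> Q"
      using one_not_zero zero[of 1] by (simp add: cls_simps(3))
    fix x y assume "x * y \<in> Q"
    then have "cls x \<otimes>\<^bsub>R\<^esub> cls y = \<zero>\<^bsub>R\<^esub>"
      by (simp add: cls_simps(1) zero)
    then show "x \<in> Q \<or> y \<in> Q"
      using integral[of "cls x" "cls y"] by (simp add: cls_simps(5) zero)
  qed (rule Q)
next
  assume P: "is_prime Q"
  have "primeideal Q S"
  proof (rule primeidealI)
    show "ideal Q S" by (rule ideal_Q)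
    show "cring S" by (rule cring_from_type_algebra)
    show "carrier S \<noteq> Q"
      using P by (auto simp: is_prime_def ring_of_type_algebra_simps)
    show "x \<in> Q \<or> y \<in> Q" if "x \<otimes>\<^bsub>S\<^esub> y \<in> Q" for x y
      using that P by (simp add: is_prime_def ring_of_type_algebra_simps)
  qed
  then show "domain R"
    by (rule primeideal.quotient_is_domain)
qed

private lemma frac_pair:
  "domain R \<Longrightarrow> (cls u, cls s) \<in> frac_pairs R \<longleftrightarrow> s \<notin> Q"
  by (simp add: domain.frac_pairs_iff cls_simps(4,5) cls_eq_iff)

text \<open>The fraction \<open>u / s\<close> is a root of \<open>X\<^sup>2 - r\<close>.\<close>

lemma normal_domain_square:
  assumes normal: "normal_domain R" and s: "s \<notin> Q" and sq: "u ^ 2 - s ^ 2 * r \<in> Q"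
  shows "\<exists>t. u - s * t \<in> Q"
proof -
  have dom: "domain R"
    using normal by (simp add: normal_domain_def)
  interpret R: domain R by (rule dom)
  let ?K = "frac_field R" and ?e = "frac_embed R"
  interpret K: field ?K by (rule R.field_frac_field)
  interpret e: ring_hom_ring R ?K ?e
    using R.frac_embed_hom R.ring_axioms K.ring_axioms by (rule ring_hom_ringI2[rotated 2])
  let ?y = "frac_class R (cls u) (cls s)"
  have one: "1 \<notin> Q"
    using dom domain_quotient_iff by (simp add: is_prime_def)
  have s2: "s * s \<notin> Q"
    using dom s domain_quotient_iff by (auto simp: is_prime_def)
  note fp = frac_pair[OF dom]
  have y: "?y \<in> carrier ?K"
    using s by (intro R.frac_in_carrier) (simp add: fp)
  have "?y \<otimes>\<^bsub>?K\<^esub> ?y = frac_class R (cls (u * u)) (cls (s * s))"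
    using s by (simp add: R.frac_mult fp cls_simps(1))
  also have "\<dots> = ?e (cls r)"
    unfolding frac_embed_def cls_simps(3)
    using s2 one sq by (simp add: R.frac_eq_iff fp cls_simps(1) cls_eq_iff power2_eq_square mult.commute)
  finally have yy: "?y \<otimes>\<^bsub>?K\<^esub> ?y = ?e (cls r)" .
  have er: "?e (cls r) \<in> carrier ?K"
    by (simp add: cls_simps(5))
  have "integral_over ?K (?e ` carrier R) ?y"
    unfolding integral_over_def
  proof (intro exI conjI)
    let ?p = "[\<one>\<^bsub>?K\<^esub>, \<zero>\<^bsub>?K\<^esub>, \<ominus>\<^bsub>?K\<^esub> ?e (cls r)]"
    have sub: "subring (?e ` carrier R) ?K"
      using e.img_is_subring[OF R.carrier_is_subring] .
    show "polynomial\<^bsub>?K\<^esub> (?e ` carrier R) ?p"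
      using subringE[OF sub] by (auto simp: polynomial_def cls_simps(5))
    show "?p \<noteq> []" "hd ?p = \<one>\<^bsub>?K\<^esub>"
      by simp_all
    show "ring.eval ?K ?p ?y = \<zero>\<^bsub>?K\<^esub>"
      using y er by (simp add: numeral_2_eq_2 yy K.r_neg)
  qed
  then have "?y \<in> ?e ` carrier R"
    using normal y by (simp add: normal_domain_def)
  then obtain t where "?y = ?e (cls t)"
    using cls_surj by blast
  then have "u - t * s \<in> Q"
    unfolding frac_embed_def cls_simps(3)
    using s one by (simp add: R.frac_eq_iff fp cls_simps(1) cls_eq_iff)
  then show ?thesis
    by (metis mult.commute)
qed

text \<open>An integral fraction is almost integral, by the common denominator of its powers.\<close>

lemma normal_domain_quotientI:
  assumes prime: "is_prime Q"
    and closed: "\<And>c s u. s \<notin> Q \<Longrightarrow> c \<notin> Q \<Longrightarrow> (\<And>n. \<exists>r. c * u ^ n - s ^ n * r \<in> Q) \<Longrightarrow> \<exists>r. u - s * r \<in> Q"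
  shows "normal_domain R"
  unfolding normal_domain_def
proof (intro conjI ballI impI)
  show dom: "domain R"
    using prime domain_quotient_iff by blast
  interpret R: domain R by (rule dom)
  let ?K = "frac_field R" and ?e = "frac_embed R"
  interpret K: field ?K by (rule R.field_frac_field)
  interpret e: ring_hom_ring R ?K ?e
    using R.frac_embed_hom R.ring_axioms K.ring_axioms by (rule ring_hom_ringI2[rotated 2])
  note fp = frac_pair[OF dom] and pow = cls_pow[OF R.is_cring]
  have one: "1 \<notin> Q"
    using prime by (simp add: is_prime_def)
  fix x assume x: "x \<in> carrier ?K" and int: "integral_over ?K (?e ` carrier R) x"
  obtain U V where UV: "x = frac_class R U V" "(U, V) \<in> frac_pairs R"
    using R.frac_carrierE[OF x] by blast
  then obtain u s where us: "U = cls u" "V = cls s"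
    using cls_surj by (metis R.frac_pairs_iff)
  have s: "s \<notin> Q"
    using UV(2) by (simp add: us fp)
  have sx: "?e (cls s) \<otimes>\<^bsub>?K\<^esub> x = ?e (cls u)"
    unfolding UV(1) us frac_embed_def cls_simps(3)
    using s one by (simp add: R.frac_mult fp cls_simps(1) R.frac_eq_iff cls_eq_iff mult.commute idl.subspace_0[OF Q])
  obtain p where p: "polynomial\<^bsub>?K\<^esub> (?e ` carrier R) p" "p \<noteq> []" "hd p = \<one>\<^bsub>?K\<^esub>" "K.eval p x = \<zero>\<^bsub>?K\<^esub>"
    using int unfolding integral_over_def by blast
  have sub: "subring (?e ` carrier R) ?K"
    using e.img_is_subring[OF R.carrier_is_subring] .
  have ecl: "?e (cls f) \<in> carrier ?K" for f
    by (simp add: cls_simps(5))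
  have e_mult: "?e (cls f) \<otimes>\<^bsub>?K\<^esub> ?e (cls g) = ?e (cls (f * g))" for f g
    using e.hom_mult[of "cls f" "cls g"] by (simp add: cls_simps(1,5))
  have e_pow: "?e (cls f) [^]\<^bsub>?K\<^esub> (n::nat) = ?e (cls (f ^ n))" for f n
    using e.hom_nat_pow[of "cls f" n] by (simp add: pow cls_simps(5))
  have e_inj: "?e (cls f) = ?e (cls g) \<longleftrightarrow> f - g \<in> Q" for f g
    using inj_onD[OF R.inj_on_frac_embed, of "cls f" "cls g"] cls_eq_iff[of f g] by (auto simp: cls_simps(5))
  have "\<exists>r. s ^ length p * u ^ n - s ^ n * r \<in> Q" for n
  proof -
    have "?e (cls s) [^]\<^bsub>?K\<^esub> length p \<otimes>\<^bsub>?K\<^esub> x [^]\<^bsub>?K\<^esub> n \<in> ?e ` carrier R"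
      using p by (intro K.monic_root_denominators[OF sub x]) (auto simp: polynomial_def sx cls_simps(5))
    then obtain r where r: "?e (cls s) [^]\<^bsub>?K\<^esub> length p \<otimes>\<^bsub>?K\<^esub> x [^]\<^bsub>?K\<^esub> n = ?e (cls r)"
      using cls_surj by blast
    have "?e (cls (s ^ length p * u ^ n))
      = ?e (cls s) [^]\<^bsub>?K\<^esub> length p \<otimes>\<^bsub>?K\<^esub> (?e (cls s) \<otimes>\<^bsub>?K\<^esub> x) [^]\<^bsub>?K\<^esub> n"
      by (simp add: sx e_pow e_mult)
    also have "\<dots> = ?e (cls s) [^]\<^bsub>?K\<^esub> n \<otimes>\<^bsub>?K\<^esub> (?e (cls s) [^]\<^bsub>?K\<^esub> length p \<otimes>\<^bsub>?K\<^esub> x [^]\<^bsub>?K\<^esub> n)"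
      using x ecl by (simp add: K.nat_pow_distrib K.m_ac)
    also have "\<dots> = ?e (cls (s ^ n * r))"
      unfolding r by (simp add: e_pow e_mult)
    finally show ?thesis
      using e_inj by blast
  qed
  moreover have "s ^ length p \<notin> Q"
    using prime_power[OF prime] s by blast
  ultimately obtain r where r: "u - s * r \<in> Q"
    using closed[OF s] by blast
  have "x = ?e (cls r)"
    unfolding UV(1) us frac_embed_def cls_simps(3)
    using s one r by (simp add: R.frac_eq_iff fp cls_simps(1) cls_eq_iff mult.commute)
  then show "x \<in> ?e ` carrier R"
    by (simp add: cls_simps(5))
qed

end

section \<open>The classification\<close>

lemma normal_domain_iff:
  assumes ab: "0 < a" "a < b"
  shows "normal_domain (S4 Quot (Idl\<^bsub>S4\<^esub> {power_sum a, power_sum b})) \<longleftrightarrow>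
    \<not> multiplicity 2 a < multiplicity 2 (b - a) \<and> (a = 1 \<or> \<not> multiplicity 3 a < multiplicity 3 (b - a))"
proof -
  have Q: "Idl\<^bsub>S4\<^esub> {power_sum a, power_sum b} = cone_ideal a b"
    by (simp add: genideal_ring_of_type_algebra cone_ideal_def)
  note idl = is_ideal_cone_ideal[of a b]
  show ?thesis
    unfolding Q
  proof (intro iffI conjI)
    assume normal: "normal_domain (S4 Quot cone_ideal a b)"
    then have "is_prime (cone_ideal a b)"
      using domain_quotient_iff[OF idl] by (simp add: normal_domain_def)
    then show v2: "\<not> multiplicity 2 a < multiplicity 2 (b - a)"
      using plane_component[OF ab] by blast
    show "a = 1 \<or> \<not> multiplicity 3 a < multiplicity 3 (b - a)"
    proof (rule ccontr)
      assume "\<not> ?thesis"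
      then have "1 < a" "multiplicity 3 a < multiplicity 3 (b - a)"
        using ab by auto
      note double = double_point[OF this(1) ab(2) v2 this(2)]
      show False
        using double(1) normal_domain_square[OF idl normal double(2)] by blast
    qed
  next
    assume "\<not> multiplicity 2 a < multiplicity 2 (b - a) \<and> (a = 1 \<or> \<not> multiplicity 3 a < multiplicity 3 (b - a))"
    then have v: "\<not> multiplicity 2 a < multiplicity 2 (b - a)" "a = 1 \<or> \<not> multiplicity 3 a < multiplicity 3 (b - a)"
      by blast+
    show "normal_domain (S4 Quot cone_ideal a b)"
      by (intro normal_domain_quotientI idl cone_ideal_prime[OF ab v] almost_integral_in_ring[OF ab v])
  qed
qed

theorem theorem3p1:
  fixes a b :: nat
  assumes "0 < a" and "a < b"
  shows "(a = 1 \<longrightarrow>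
           (normal_domain (S4 Quot (Idl\<^bsub>S4\<^esub> {power_sum a, power_sum b})) \<longleftrightarrow> even b))
       \<and> (1 < a \<longrightarrow>
           (normal_domain (S4 Quot (Idl\<^bsub>S4\<^esub> {power_sum a, power_sum b})) \<longleftrightarrow>
              multiplicity (2::int) (int a) \<noteq> multiplicity (2::int) (int b)
            \<and> (multiplicity (3::int) (int a) \<noteq> multiplicity (3::int) (int b)
               \<or> (multiplicity (3::int) (int a) = multiplicity (3::int) (int b)
                  \<and> multiplicity (3::int) (int b) = multiplicity (3::int) (int a - int b)))))"
proof -
  have int: "multiplicity (int q) (int a) = multiplicity q a" "multiplicity (int q) (int b) = multiplicity q b"
    "multiplicity (int q) (int a - int b) = multiplicity q (b - a)" if "1 < q" for q
  proof -
    show "multiplicity (int q) (int a) = multiplicity q a" "multiplicity (int q) (int b) = multiplicity q b"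
      using assms that by (simp_all add: multiplicity_int_nat)
    have "int a - int b = (- 1) * int (b - a)"
      using assms by (simp add: of_nat_diff)
    moreover have "multiplicity (int q) ((- 1) * int (b - a)) = multiplicity (int q) (int (b - a))"
      by (rule multiplicity_times_unit_right) simp
    ultimately have "multiplicity (int q) (int a - int b) = multiplicity (int q) (int (b - a))"
      by (simp only:)
    then show "multiplicity (int q) (int a - int b) = multiplicity q (b - a)"
      using assms that by (simp only: multiplicity_int_nat zero_less_diff)
  qed
  have int2: "multiplicity (2::int) (int a) = multiplicity 2 a" "multiplicity (2::int) (int b) = multiplicity 2 b"
    using int(1,2)[of 2] by simp_all
  have int3: "multiplicity (3::int) (int a) = multiplicity 3 a" "multiplicity (3::int) (int b) = multiplicity 3 b"
    "multiplicity (3::int) (int a - int b) = multiplicity 3 (b - a)"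
    using int[of 3] by simp_all
  have odd: "multiplicity 2 b = 0 \<longleftrightarrow> odd b"
    using assms by (simp add: multiplicity_eq_zero_iff)
  have v3: "multiplicity 3 a < multiplicity 3 (b - a) \<longleftrightarrow>
    multiplicity 3 a = multiplicity 3 b \<and> multiplicity 3 b \<noteq> multiplicity 3 (b - a)"
    by (rule multiplicity_less_diff_iff[OF _ assms]) simp
  show ?thesis
    unfolding normal_domain_iff[OF assms] int2 int3 multiplicity_2_less_diff_iff[OF assms] v3
    using odd by auto
qed

end
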